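(* Let $\mathcal F\in\{A\mathrm J,B\mathrm J,A\mathrm M,B\mathrm M\}$ be any of the four families of interpolation polynomials. (1) The following recursion characterizes the binomial coefficients $b_{\lambda\mu}$ ($\lambda,\mu\in\mathcal P_n$), given that $b_{\lambda\mu}=0$ whenever $|\lambda|\leqslant|\mu|$ and $\lambda\ne\mu$: (i) $b_{\lambda\lambda}=1$; (ii) for $|\lambda|>|\mu|$, $$\bigl(\|\overline\lambda\|-\|\overline\mu\|\bigr)b_{\lambda\mu}=\sum_{\nu\gtrdot\mu}b_{\lambda\nu}\bigl(\|\overline\nu\|-\|\overline\mu\|\bigr)a_{\nu\mu}.$$ (2) The following recursion characterizes the inverse binomial coefficients $b'_{\lambda\mu}$ ($\lambda,\mu\in\mathcal P_n$), given that $b'_{\lambda\mu}=0$ whenever $|\lambda|\leqslant|\mu|$ and $\lambda\neq\mu$: (i) $b'_{\lambda\lambda}=1$; (ii) for $|\lambda|>|\mu|$, $$\bigl(\|\overline\lambda\|-\|\overline\mu\|\bigr)b'_{\lambda\mu}=\sum_{\nu:\,\lambda\gtrdot\nu}a_{\lambda\nu}\bigl(\|\overline\nu\|-\|\overline\lambda\|\bigr)b'_{\nu\mu}.$$ (3) The matrices $A,B,Z$ satisfy $$\text{(i) }[Z,B]=B[Z,A];\qquad\text{(ii) }[Z,B^{-1}]=-[Z,A]B^{-1}.$$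
   Context: Fix $n\geqslant1$. $\mathcal P_n=\{\lambda\in\mathbb Z^n:\lambda_1\geqslant\cdots\geqslant\lambda_n\geqslant0\}$, $|\lambda|=\lambda_1+\dots+\lambda_n$; $\lambda\supseteq\mu$ means $\lambda_i\geqslant\mu_i$ for all $i$; $\lambda\gtrdot\mu$ means $\lambda\supseteq\mu$ and $|\lambda|=|\mu|+1$. The four families $\mathcal F$ have the following data (base field $\mathbb F$, ring $\Lambda$, shifting map $\mathcal P_n\to\mathbb F^n$, $\lambda\mapsto\overline\lambda$, and "norm" $\|x\|$), with indeterminate parameters: - $A\mathrm J$: $\mathbb F=\mathbb Q(\tau)$; $\Lambda=\mathbb F[x_1,\dots,x_n]^{S_n}$; $\overline\lambda_i=\lambda_i+(n-i)\tau$; $\|x\|=\sum_i x_i$. - $B\mathrm J$: $\mathbb F=\mathbb Q(\tau,\alpha)$; $\Lambda=\mathbb F[x_1^2,\dots,x_n^2]^{S_n}$; $\overline\lambda_i=\lambda_i+(n-i)\tau+\alpha$; $\|x\|=\sum_i x_i^2$. - $A\mathrm M$: $\mathbb F=\mathbb Q(q,t)$; $\Lambda=\mathbb F[x_1,\dots,x_n]^{S_n}$; $\overline\lambda_i=q^{\lambda_i}t^{n-i}$; $\|x\|=\sum_i x_i$. - $B\mathrm M$: $\mathbb F=\mathbb Q(q,t,a)$; $\Lambda=\mathbb F[x_1+x_1^{-1},\dots,x_n+x_n^{-1}]^{S_n}$; $\overline\lambda_i=aq^{\lambda_i}t^{n-i}$; $\|x\|=\sum_i(x_i+x_i^{-1})$.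 The degree of a Laurent polynomial is the maximum of $|\alpha_1|+\dots+|\alpha_n|$ over monomials $x^\alpha$ occurring in it. For $\mu\in\mathcal P_n$, the (unital) interpolation polynomial $h_\mu$ is the unique element of $\Lambda$ of degree at most $|\mu|$ (at most $2|\mu|$ when $\mathcal F=B\mathrm J$) with $h_\mu(\overline\lambda)=\delta_{\lambda\mu}$ for all $\lambda\in\mathcal P_n$ with $|\lambda|\leqslant|\mu|$ (existence and uniqueness are known). The binomial coefficients are $b_{\lambda\mu}=h_\mu(\overline\lambda)\in\mathbb F$, and the adjacent binomial coefficients are $a_{\lambda\mu}=b_{\lambda\mu}$ if $\lambda\gtrdot\mu$ and $a_{\lambda\mu}=0$ otherwise. $A=(a_{\lambda\mu})$, $B=(b_{\lambda\mu})$, $Z=(\|\overline\mu\|\delta_{\lambda\mu})$ are infinite matrices with rows and columns indexed by $\lambda,\mu\in\mathcal P_n$, ordered by a total order compatible with size. $B$ is unitriangular (by definition $b_{\lambda\lambda}=1$ and $b_{\lambda\mu}=0$ if $|\lambda|\leqslant|\mu|$, $\lambda\ne\mu$), hence invertible; the entries of $B^{-1}=(b'_{\lambda\mu})$ are the inverse binomial coefficients. $[X,Y]=XY-YX$. "Characterizes" means that the stated array satisfies the recursion and is the only array doing so. *)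

theory Defs
  imports
    "HOL-Library.Poly_Mapping"
    "HOL-Combinatorics.Permutations"
    "HOL-Computational_Algebra.Polynomial"
    "HOL-Computational_Algebra.Fraction_Field"
begin

text \<open>An element of \<open>\<P>\<^sub>n\<close> is a function on \<open>nat\<close> whose components are the values at \<open>1, \<dots>, n\<close>;
  it is set to \<open>0\<close> elsewhere, so that equality of functions is equality of \<open>n\<close>-tuples.\<close>

type_synonym part = "nat \<Rightarrow> nat"

definition Parts :: "nat \<Rightarrow> part set" where
  "Parts n = {l. (\<forall>i j. 1 \<le> i \<and> i \<le> j \<and> j \<le> n \<longrightarrow> l j \<le> l i) \<and> (\<forall>i. i \<notin> {1..n} \<longrightarrow> l i = 0)}"

definition psize :: "nat \<Rightarrow> part \<Rightarrow> nat" where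
  "psize n l = (\<Sum>i=1..n. l i)"

definition contains :: "nat \<Rightarrow> part \<Rightarrow> part \<Rightarrow> bool" where
  "contains n l m \<longleftrightarrow> (\<forall>i\<in>{1..n}. m i \<le> l i)"

definition covers :: "nat \<Rightarrow> part \<Rightarrow> part \<Rightarrow> bool" where
  "covers n l m \<longleftrightarrow> contains n l m \<and> psize n l = psize n m + 1"

text \<open>A Laurent polynomial maps exponent vectors to coefficients. The variables are indexed by all
  of \<open>nat\<close>; the subalgebras below only involve those with index in \<open>{1..n}\<close>.\<close>

type_synonym 'k laurent = "(nat \<Rightarrow>\<^sub>0 int) \<Rightarrow>\<^sub>0 'k"

definition xpow :: "nat \<Rightarrow> int \<Rightarrow> 'k::comm_ring_1 laurent" where
  "xpow i e = Poly_Mapping.single (Poly_Mapping.single i e) 1"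

definition leval :: "'k::field laurent \<Rightarrow> (nat \<Rightarrow> 'k) \<Rightarrow> 'k" where
  "leval f x = (\<Sum>m\<in>Poly_Mapping.keys f. Poly_Mapping.lookup f m *
                  (\<Prod>i\<in>Poly_Mapping.keys m. x i powi Poly_Mapping.lookup m i))"

text \<open>The zero polynomial has degree \<open>0\<close>, hence satisfies every degree bound.\<close>

definition mdegree :: "(nat \<Rightarrow>\<^sub>0 int) \<Rightarrow> nat" where
  "mdegree m = (\<Sum>i\<in>Poly_Mapping.keys m. nat \<bar>Poly_Mapping.lookup m i\<bar>)"

definition ldegree :: "'k::zero laurent \<Rightarrow> nat" where
  "ldegree f = Max (insert 0 (mdegree ` Poly_Mapping.keys f))"

definition symmetric :: "nat \<Rightarrow> 'k::zero laurent \<Rightarrow> bool" where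
  "symmetric n f \<longleftrightarrow> (\<forall>p. p permutes {1..n} \<longrightarrow>
     (\<forall>m. Poly_Mapping.lookup f (Poly_Mapping.map_key p m) = Poly_Mapping.lookup f m))"

inductive_set adjoin :: "'k::comm_ring_1 laurent set \<Rightarrow> 'k laurent set"
  for G :: "'k laurent set" where
  const: "Poly_Mapping.single 0 c \<in> adjoin G"
| gen: "g \<in> G \<Longrightarrow> g \<in> adjoin G"
| add: "f \<in> adjoin G \<Longrightarrow> g \<in> adjoin G \<Longrightarrow> f + g \<in> adjoin G"
| mult: "f \<in> adjoin G \<Longrightarrow> g \<in> adjoin G \<Longrightarrow> f * g \<in> adjoin G"

text \<open>
  \<^item> \<open>gen i\<close> is the element \<open>y\<^sub>i\<close> in \<open>\<Lambda> = \<bbbF>[y\<^sub>1, \<dots>, y\<^sub>n]\<^bsup>S\<^sub>n\<^esup>\<close>;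
  \<^item> \<open>shift n l\<close> is the shifted partition;
  \<^item> \<open>nrm n x\<close> is the norm of the point \<open>x\<close>;
  \<^item> \<open>dscale * psize n m\<close> is the degree bound for the interpolation polynomial of \<open>m\<close>.
\<close>

record (overloaded) 'k::zero family =
  gen :: "nat \<Rightarrow> 'k laurent"
  shift :: "nat \<Rightarrow> part \<Rightarrow> nat \<Rightarrow> 'k"
  nrm :: "nat \<Rightarrow> (nat \<Rightarrow> 'k) \<Rightarrow> 'k"
  dscale :: nat

text \<open>A field of rational functions is the field of fractions of an iterated polynomial ring:
  \<open>\<rat>(\<tau>) = Frac \<rat>[\<tau>]\<close>, \<open>\<rat>(\<tau>,\<alpha>) = Frac \<rat>[\<tau>][\<alpha>]\<close>, \<open>\<rat>(q,t) = Frac \<rat>[q][t]\<close>,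
  \<open>\<rat>(q,t,a) = Frac \<rat>[q][t][a]\<close>. The outermost indeterminate is \<open>[:0, 1:]\<close>.\<close>

definition AJ :: "rat poly fract family" where
  "AJ = (let \<tau> = Fraction_Field.Fract [:0, 1:] 1 in
    \<lparr> gen = (\<lambda>i. xpow i 1),
      shift = (\<lambda>n l i. of_nat (l i) + of_nat (n - i) * \<tau>),
      nrm = (\<lambda>n x. \<Sum>i=1..n. x i),
      dscale = 1 \<rparr>)"

definition BJ :: "rat poly poly fract family" where
  "BJ = (let \<tau> = Fraction_Field.Fract [:[:0, 1:]:] 1; \<alpha> = Fraction_Field.Fract [:0, 1:] 1 in
    \<lparr> gen = (\<lambda>i. xpow i 2),
      shift = (\<lambda>n l i. of_nat (l i) + of_nat (n - i) * \<tau> + \<alpha>),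
      nrm = (\<lambda>n x. \<Sum>i=1..n. (x i)\<^sup>2),
      dscale = 2 \<rparr>)"

definition AM :: "rat poly poly fract family" where
  "AM = (let q = Fraction_Field.Fract [:[:0, 1:]:] 1; t = Fraction_Field.Fract [:0, 1:] 1 in
    \<lparr> gen = (\<lambda>i. xpow i 1),
      shift = (\<lambda>n l i. q ^ l i * t ^ (n - i)),
      nrm = (\<lambda>n x. \<Sum>i=1..n. x i),
      dscale = 1 \<rparr>)"

definition BM :: "rat poly poly poly fract family" where
  "BM = (let q = Fraction_Field.Fract [:[:[:0, 1:]:]:] 1; t = Fraction_Field.Fract [:[:0, 1:]:] 1; a = Fraction_Field.Fract [:0, 1:] 1 in
    \<lparr> gen = (\<lambda>i. xpow i 1 + xpow i (- 1)),
      shift = (\<lambda>n l i. a * q ^ l i * t ^ (n - i)),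
      nrm = (\<lambda>n x. \<Sum>i=1..n. (x i + inverse (x i))),
      dscale = 1 \<rparr>)"

definition Lam :: "'k::field family \<Rightarrow> nat \<Rightarrow> 'k laurent set" where
  "Lam F n = {f \<in> adjoin (gen F ` {1..n}). symmetric n f}"

definition znorm :: "'k::field family \<Rightarrow> nat \<Rightarrow> part \<Rightarrow> 'k" where
  "znorm F n l = nrm F n (shift F n l)"

definition hpoly :: "'k::field family \<Rightarrow> nat \<Rightarrow> part \<Rightarrow> 'k laurent" where
  "hpoly F n m = (THE f. f \<in> Lam F n \<and> ldegree f \<le> dscale F * psize n m \<and>
     (\<forall>l\<in>Parts n. psize n l \<le> psize n m \<longrightarrow> leval f (shift F n l) = (if l = m then 1 else 0)))"

definition binom :: "'k::field family \<Rightarrow> nat \<Rightarrow> part \<Rightarrow> part \<Rightarrow> 'k" where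
  "binom F n l m = leval (hpoly F n m) (shift F n l)"

definition adj :: "'k::field family \<Rightarrow> nat \<Rightarrow> part \<Rightarrow> part \<Rightarrow> 'k" where
  "adj F n l m = (if covers n l m then binom F n l m else 0)"

text \<open>Only the entries with both indices in \<open>Parts n\<close> are meaningful.
  In a matrix product the sum runs over the nonzero terms. All products considered have a left
  factor with finitely many nonzero entries in each row, so these sums are finite.\<close>

type_synonym 'k mtx = "part \<Rightarrow> part \<Rightarrow> 'k"

definition mtx_mult :: "nat \<Rightarrow> 'k::field mtx \<Rightarrow> 'k mtx \<Rightarrow> 'k mtx" where
  "mtx_mult n X Y l m = (\<Sum>k | k \<in> Parts n \<and> X l k * Y k m \<noteq> 0. X l k * Y k m)"

definition mtx_comm :: "nat \<Rightarrow> 'k::field mtx \<Rightarrow> 'k mtx \<Rightarrow> 'k mtx" where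
  "mtx_comm n X Y l m = mtx_mult n X Y l m - mtx_mult n Y X l m"

definition mtx_eq :: "nat \<Rightarrow> 'k mtx \<Rightarrow> 'k mtx \<Rightarrow> bool" where
  "mtx_eq n X Y \<longleftrightarrow> (\<forall>l\<in>Parts n. \<forall>m\<in>Parts n. X l m = Y l m)"

definition mtx_one :: "'k::field mtx" where
  "mtx_one l m = (if l = m then 1 else 0)"

text \<open>The first condition only pins down the meaningless entries. A unitriangular matrix with
  finitely many indices of each size has exactly one two-sided inverse.\<close>

definition mtx_inv :: "nat \<Rightarrow> 'k::field mtx \<Rightarrow> 'k mtx" where
  "mtx_inv n X = (THE Y. (\<forall>l m. l \<notin> Parts n \<or> m \<notin> Parts n \<longrightarrow> Y l m = 0) \<and>
     mtx_eq n (mtx_mult n X Y) mtx_one \<and> mtx_eq n (mtx_mult n Y X) mtx_one)"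

definition zmtx :: "'k::field family \<Rightarrow> nat \<Rightarrow> 'k mtx" where
  "zmtx F n l m = (if l = m then znorm F n m else 0)"

definition inv_binom :: "'k::field family \<Rightarrow> nat \<Rightarrow> part \<Rightarrow> part \<Rightarrow> 'k" where
  "inv_binom F n = mtx_inv n (binom F n)"

definition vanishing :: "nat \<Rightarrow> 'k::field mtx \<Rightarrow> bool" where
  "vanishing n b \<longleftrightarrow>
     (\<forall>l\<in>Parts n. \<forall>m\<in>Parts n. psize n l \<le> psize n m \<and> l \<noteq> m \<longrightarrow> b l m = 0)"

definition binom_recursion :: "'k::field family \<Rightarrow> nat \<Rightarrow> 'k mtx \<Rightarrow> bool" where
  "binom_recursion F n b \<longleftrightarrow>
     (\<forall>l\<in>Parts n. b l l = 1) \<and>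
     (\<forall>l\<in>Parts n. \<forall>m\<in>Parts n. psize n l > psize n m \<longrightarrow>
        (znorm F n l - znorm F n m) * b l m =
        (\<Sum>k | k \<in> Parts n \<and> covers n k m. b l k * (znorm F n k - znorm F n m) * adj F n k m))"

definition inv_binom_recursion :: "'k::field family \<Rightarrow> nat \<Rightarrow> 'k mtx \<Rightarrow> bool" where
  "inv_binom_recursion F n b \<longleftrightarrow>
     (\<forall>l\<in>Parts n. b l l = 1) \<and>
     (\<forall>l\<in>Parts n. \<forall>m\<in>Parts n. psize n l > psize n m \<longrightarrow>
        (znorm F n l - znorm F n m) * b l m =
        (\<Sum>k | k \<in> Parts n \<and> covers n l k. adj F n l k * (znorm F n k - znorm F n l) * b k m))"

end

theory Submission imports Defs
begin

text \<open>
  As symmetric polynomials in \<open>y\<^sub>i = x\<^sub>i\<^sup>d + e x\<^sub>i\<^sup>-\<^sup>1\<close> the elements of \<open>\<Lambda>\<close> are evaluated at the grid points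
  \<open>y\<^sub>i = c(\<lambda>\<^sub>i, n - i)\<close>. The crucial fact is that a symmetric polynomial of degree less than \<open>|\<nu>|\<close> that
  vanishes at all partitions properly contained in \<open>\<nu>\<close> also vanishes at \<open>\<nu>\<close>. If \<open>\<nu>\<^sub>n = 0\<close>, one specialises
  \<open>y\<^sub>n\<close>. Otherwise one applies a divided difference operator in all variables, of the form
  \<open>f \<mapsto> \<Delta>(y)\<^sup>-\<^sup>1 \<Sum>\<^sub>I (-1)\<^bsup>|I|\<^esup> \<Delta>(w\<^sub>I) f(y\<^sub>I) / \<Prod>\<^sub>i 2r\<^sub>i\<close>, which lowers the degree by \<open>n\<close>, and whose value at
  \<open>\<lambda>\<close> is a combination of the values of \<open>f\<close> at the partitions \<open>\<lambda> + \<epsilon>\<close>, \<open>\<epsilon> \<in> {0,1}\<^sup>n\<close>.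
  This yields the uniqueness of the interpolation polynomials and \<open>b\<^bsub>\<nu>\<mu>\<^esub> = 0\<close> for \<open>|\<nu>| = |\<mu>| + 1\<close>, \<open>\<nu>\<close> not
  containing \<open>\<mu>\<close>. Now \<open>(\<parallel>x\<parallel> - \<parallel>\<mu>\<parallel>) h\<^sub>\<mu>\<close> vanishes at all partitions of size at most \<open>|\<mu>|\<close>, hence is a combination of
  the \<open>h\<^sub>\<nu>\<close> with \<open>\<nu>\<close> covering \<open>\<mu>\<close>; evaluation at \<open>\<lambda>\<close> is the matrix identity \<open>[Z, B] = B [Z, A]\<close>, and
  multiplying it by \<open>B\<^sup>-\<^sup>1\<close> on both sides gives the one for \<open>B\<^sup>-\<^sup>1\<close>.
\<close>

text \<open>Polynomial functions replace formal polynomials because in characteristic zero they are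
  determined by their values at the grid points of partitions. This matters for the lowering
  operator: the r_i are square roots of quadratics in y_i, which the field need not contain for
  arbitrary y, so its identities are proved at grid points and extended by density.

  Degree count: \<Delta>(w) f has degree k + n(n-1)/2. Alternating over the signs of the r_i leaves
  the terms odd in every r_i, so their product splits off and takes n degrees with it. The cofactor
  is antisymmetric, so dividing by \<Delta>(y) takes the remaining n(n-1)/2.

  The obstacle is that the operator also reaches points \<lambda> + \<epsilon> that are not
  partitions, where nothing is known about f. The weights \<Delta>(w_I) are there to remove these
  terms.

  Lowering also changes the grid: \<delta> = 0 in the family BJ becomes 1, and \<beta> = 1 in BM
  becomes 1/q. The induction therefore runs over a class of grids with free parameters.\<close>

section \<open>Polynomial functions\<close>

text \<open>The degree bound is an integer, so that a negative bound forces the zero function.\<close>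

inductive polyfun :: "'v set \<Rightarrow> int \<Rightarrow> (('v \<Rightarrow> 'k::comm_ring_1) \<Rightarrow> 'k) \<Rightarrow> bool" for V where
  zero: "polyfun V k (\<lambda>_. 0)"
| const: "0 \<le> k \<Longrightarrow> polyfun V k (\<lambda>_. c)"
| var: "i \<in> V \<Longrightarrow> 1 \<le> k \<Longrightarrow> polyfun V k (\<lambda>y. y i)"
| add: "polyfun V k f \<Longrightarrow> polyfun V k g \<Longrightarrow> polyfun V k (\<lambda>y. f y + g y)"
| mult: "polyfun V j f \<Longrightarrow> polyfun V k g \<Longrightarrow> polyfun V (j + k) (\<lambda>y. f y * g y)"

lemma polyfun_neg: "polyfun V k f \<Longrightarrow> k < 0 \<Longrightarrow> f y = 0"
proof (induction rule: polyfun.induct)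
  case (mult j f k g)
  then have "j < 0 \<or> k < 0" by linarith
  with mult.IH show ?case by auto
qed auto

lemma polyfun_mono: "polyfun V k f \<Longrightarrow> k \<le> k' \<Longrightarrow> V \<subseteq> V' \<Longrightarrow> polyfun V' k' f"
proof (induction arbitrary: k' rule: polyfun.induct)
  case (mult j f k g)
  have "polyfun V' ((k' - k) + k) (\<lambda>y. f y * g y)"
    using mult by (intro polyfun.mult) auto
  then show ?case by simp
qed (auto intro: polyfun.intros)

lemma polyfun_mult': "polyfun V j f \<Longrightarrow> polyfun V k g \<Longrightarrow> j + k \<le> l \<Longrightarrow> polyfun V l (\<lambda>y. f y * g y)"
  using polyfun_mono[OF polyfun.mult] by blast

lemma polyfun_cmult: "polyfun V k f \<Longrightarrow> polyfun V k (\<lambda>y. c * f y)"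
  by (rule polyfun_mult'[OF polyfun.const[of 0]]) auto

lemma polyfun_diff: "polyfun V k f \<Longrightarrow> polyfun V k g \<Longrightarrow> polyfun V k (\<lambda>y. f y - g y)"
  using polyfun.add[OF _ polyfun_cmult[of V k g "-1"]] by simp

lemma polyfun_sum: "(\<And>a. a \<in> A \<Longrightarrow> polyfun V k (f a)) \<Longrightarrow> polyfun V k (\<lambda>y. \<Sum>a\<in>A. f a y)"
  by (induction A rule: infinite_finite_induct) (auto intro: polyfun.intros)

lemma polyfun_prod:
  "(\<And>a. a \<in> A \<Longrightarrow> polyfun V (d a) (f a)) \<Longrightarrow> sum d A \<le> k \<Longrightarrow> polyfun V k (\<lambda>y. \<Prod>a\<in>A. f a y)"
proof (induction A arbitrary: k rule: infinite_finite_induct)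
  case (insert x F)
  have "polyfun V k (\<lambda>y. f x y * (\<Prod>a\<in>F. f a y))"
    by (rule polyfun_mult'[where j="d x" and k="sum d F"]) (use insert in auto)
  then show ?case using insert by simp
qed (auto intro: polyfun.intros)

lemma polyfun_power: "polyfun V d f \<Longrightarrow> int m * d \<le> k \<Longrightarrow> polyfun V k (\<lambda>y. f y ^ m)"
  using polyfun_prod[of "{..<m}" V "\<lambda>_. d" "\<lambda>_. f" k] by simp

lemma polyfun_cong: "polyfun V k f \<Longrightarrow> (\<And>i. i \<in> V \<Longrightarrow> y i = y' i) \<Longrightarrow> f y = f y'"
  by (induction rule: polyfun.induct) auto

lemma polyfun_subst:
  "polyfun V k f \<Longrightarrow> (\<And>i. i \<in> V \<Longrightarrow> polyfun V' 1 (s i)) \<Longrightarrow> polyfun V' k (\<lambda>y. f (\<lambda>i. s i y))"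
proof (induction rule: polyfun.induct)
  case (var i k)
  then show ?case using polyfun_mono by blast
qed (auto intro: polyfun.intros)

lemma polyfun_fun_upd_var: "polyfun V k f \<Longrightarrow> j \<in> V \<Longrightarrow> polyfun V k (\<lambda>y. f (y(i := y j)))"
  unfolding fun_upd_def
proof (rule polyfun_subst[of V k f V "\<lambda>a y. if a = i then y j else y a"])
  fix a assume "a \<in> V" "j \<in> V"
  then show "polyfun V 1 (\<lambda>y. if a = i then y j else y a)"
    by (cases "a = i") (auto intro: polyfun.var)
qed

lemma polyfun_transpose:
  "polyfun V k f \<Longrightarrow> i \<in> V \<Longrightarrow> j \<in> V \<Longrightarrow> polyfun V k (\<lambda>y. f (y \<circ> Transposition.transpose i j))"
  unfolding comp_def
  by (rule polyfun_subst[of V k f V "\<lambda>a y. y (Transposition.transpose i j a)"])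
    (auto intro: polyfun.intros simp: Transposition.transpose_def)

text \<open>Restriction to a line reduces questions about zeros and factors to univariate
  polynomials.\<close>

lemma polyfun_line:
  assumes "polyfun V k f"
  shows "\<exists>p. \<forall>s. f (\<lambda>i. a i + s * b i) = poly p s"
  using assms
proof (induction rule: polyfun.induct)
  case (var i k)
  show ?case by (rule exI[of _ "[:a i, b i:]"]) simp
next
  case (add k f g)
  then show ?case by (metis poly_add)
next
  case (mult j f k g)
  then show ?case by (metis poly_mult)
next
  case (zero k)
  show ?case by (rule exI[of _ 0]) simp
next
  case (const k c)
  show ?case by (rule exI[of _ "[:c:]"]) simp
qed

text \<open>On the line from \<open>a\<close> to \<open>b\<close> the factors become univariate
  polynomials p and q with p q = 0, as the field is infinite. Since p is nonzero at parameter 0, q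
  is zero, and its value at parameter 1 is \<open>g b\<close>.\<close>

lemma polyfun_mult_eq_0:
  fixes f g :: "('v \<Rightarrow> 'k::field_char_0) \<Rightarrow> 'k"
  assumes "polyfun V j f" "polyfun V k g" "\<And>y. f y * g y = 0" "f a \<noteq> 0"
  shows "g b = 0"
proof -
  obtain p where p: "f (\<lambda>i. a i + s * (b i - a i)) = poly p s" for s
    using polyfun_line[OF assms(1)] by metis
  obtain q where q: "g (\<lambda>i. a i + s * (b i - a i)) = poly q s" for s
    using polyfun_line[OF assms(2)] by metis
  have "poly (p * q) s = 0" for s using assms(3) p q by (metis poly_mult)
  then have "p * q = 0" by (simp add: poly_eq_poly_eq_iff[symmetric] fun_eq_iff)
  moreover have "p \<noteq> 0" using p[of 0] assms(4) by auto
  ultimately show ?thesis using q[of 1] by simp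
qed

text \<open>A product rule for differences. If f vanishes wherever y_i = y_j, the subtracted term is
  zero, and y_i - y_j is a factor of f whose cofactor has degree one less.\<close>

lemma polyfun_diff_quotient:
  fixes f :: "('v \<Rightarrow> 'k::comm_ring_1) \<Rightarrow> 'k"
  assumes "polyfun V k f" "i \<in> V" "j \<in> V"
  shows "\<exists>g. polyfun V (k - 1) g \<and> (\<forall>y. f y - f (y(i := y j)) = (y i - y j) * g y)"
  using assms(1)
proof (induction rule: polyfun.induct)
  case (zero k)
  show ?case by (rule exI[of _ "\<lambda>_. 0"]) (auto intro: polyfun.intros)
next
  case (const k c)
  show ?case by (rule exI[of _ "\<lambda>_. 0"]) (auto intro: polyfun.intros)
next
  case (var l k)
  show ?case
    by (rule exI[of _ "\<lambda>_. if l = i then 1 else 0"]) (use var in \<open>auto intro: polyfun.intros\<close>)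
next
  case (add k f g)
  from add.IH obtain f1 g1 where 1: "polyfun V (k - 1) f1" "\<forall>y. f y - f (y(i := y j)) = (y i - y j) * f1 y"
    "polyfun V (k - 1) g1" "\<forall>y. g y - g (y(i := y j)) = (y i - y j) * g1 y" by blast
  have 2: "a + b - (c + d) = z * (p + q)" if "a - c = z * p" "b - d = z * q" for a b c d z p q :: 'k
    using that by (simp add: algebra_simps)
  show ?case
    by (intro exI[of _ "\<lambda>y. f1 y + g1 y"] conjI allI polyfun.add 2) (use 1 in blast)+
next
  case (mult m f k g)
  from mult.IH obtain f1 g1 where 1: "polyfun V (m - 1) f1" "\<forall>y. f y - f (y(i := y j)) = (y i - y j) * f1 y"
    "polyfun V (k - 1) g1" "\<forall>y. g y - g (y(i := y j)) = (y i - y j) * g1 y" by blast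
  let ?h = "\<lambda>y. f1 y * g y + f (y(i := y j)) * g1 y"
  have "polyfun V (m + k - 1) ?h"
    by (intro polyfun.add polyfun_mult'[OF 1(1) mult(2)] polyfun_mult'[OF polyfun_fun_upd_var[OF mult(1) assms(3)] 1(3)]) auto
  moreover have "f y * g y - f (y(i := y j)) * g (y(i := y j)) = (y i - y j) * ?h y" for y
  proof -
    have "f y * g y - f (y(i := y j)) * g (y(i := y j)) =
      (f y - f (y(i := y j))) * g y + f (y(i := y j)) * (g y - g (y(i := y j)))" by (simp add: algebra_simps)
    then show ?thesis using 1 by (simp add: algebra_simps)
  qed
  ultimately show ?case by blast
qed

section \<open>Density of the grid points of partitions\<close>

definition grid_point :: "(nat \<Rightarrow> nat \<Rightarrow> 'k::zero) \<Rightarrow> nat \<Rightarrow> part \<Rightarrow> nat \<Rightarrow> 'k" where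
  "grid_point c n l = (\<lambda>i. if i \<in> {1..n} then c (l i) (n - i) else 0)"

text \<open>Coordinates are freed from the front: once the later rows are fixed, the row before them
  may be arbitrarily long, so f has infinitely many zeros in that coordinate.\<close>

lemma grid_dense:
  fixes f :: "(nat \<Rightarrow> 'k::field_char_0) \<Rightarrow> 'k"
  assumes f: "polyfun {1..n} k f" and inj: "\<And>j. inj (\<lambda>m. c m j)"
    and van: "\<And>l. l \<in> Parts n \<Longrightarrow> f (grid_point c n l) = 0"
  shows "f y = 0"
proof -
  \<comment> \<open>The first m coordinates are arbitrary and only the later ones lie on the grid; m
    = 0 is the hypothesis, m = n the claim.\<close>
  have *: "(\<forall>i j. m < i \<and> i \<le> j \<and> j \<le> n \<longrightarrow> l j \<le> l i) \<Longrightarrow>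
      (\<forall>i. m < i \<and> i \<le> n \<longrightarrow> y i = c (l i) (n - i)) \<Longrightarrow> f y = 0" if "m \<le> n" for m l y
    using that
  proof (induction m arbitrary: l y)
    case 0
    let ?l = "\<lambda>i. if i \<in> {1..n} then l i else 0"
    have "?l \<in> Parts n" using 0 by (auto simp: Parts_def)
    then have "f (grid_point c n ?l) = 0" by (rule van)
    moreover have "f y = f (grid_point c n ?l)"
      by (rule polyfun_cong[OF f]) (use 0 in \<open>auto simp: grid_point_def\<close>)
    ultimately show ?case by simp
  next
    case (Suc m)
    obtain p where p: "f (\<lambda>i. (y(Suc m := 0)) i + s * (if i = Suc m then 1 else 0)) = poly p s" for s
      using polyfun_line[OF f] by metis
    have eq: "(\<lambda>i. (y(Suc m := 0)) i + s * (if i = Suc m then 1 else 0)) = y(Suc m := s)" for s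
      by auto
    let ?L = "\<Sum>i\<in>{1..n}. l i"
    have L: "l j \<le> ?L" if "m < j" "j \<le> n" for j
      by (rule member_le_sum) (use that in auto)
    \<comment> \<open>\<open>?L\<close> bounds all later rows, so every \<open>b\<close> from
      \<open>?L\<close> on is an admissible length for row \<open>Suc m\<close>.\<close>
    have "poly p (c b (n - Suc m)) = 0" if "?L \<le> b" for b
    proof -
      have "f (y(Suc m := c b (n - Suc m))) = 0"
      proof (rule Suc.IH[of "l(Suc m := b)"])
        show "\<forall>i j. m < i \<and> i \<le> j \<and> j \<le> n \<longrightarrow> (l(Suc m := b)) j \<le> (l(Suc m := b)) i"
        proof (intro allI impI)
          fix i j assume a: "m < i \<and> i \<le> j \<and> j \<le> n"
          show "(l(Suc m := b)) j \<le> (l(Suc m := b)) i"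
          proof (cases "i = Suc m")
            case True
            then show ?thesis using a L[of j] \<open>?L \<le> b\<close> by auto
          next
            case False
            then show ?thesis using a Suc.prems(1) by auto
          qed
        qed
      qed (use Suc.prems in auto)
      then show ?thesis using p eq by metis
    qed
    then have "(\<lambda>b. c b (n - Suc m)) ` {?L..} \<subseteq> {x. poly p x = 0}" by auto
    moreover have "infinite ((\<lambda>b. c b (n - Suc m)) ` {?L..})"
      using finite_imageD[OF _ inj_on_subset[OF inj]] infinite_Ici by blast
    ultimately have "p = 0" using poly_roots_finite finite_subset by blast
    then show ?case using p[of "y (Suc m)"] eq by simp
  qed
  show ?thesis by (rule *[of n "\<lambda>_. 0"]) auto
qed

definition symfun :: "nat \<Rightarrow> ((nat \<Rightarrow> 'k) \<Rightarrow> 'a) \<Rightarrow> bool" where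
  "symfun n f \<longleftrightarrow> (\<forall>i\<in>{1..n}. \<forall>j\<in>{1..n}. \<forall>y. f (y \<circ> Transposition.transpose i j) = f y)"

section \<open>The Vandermonde product\<close>

definition pairs :: "nat \<Rightarrow> (nat \<times> nat) set" where
  "pairs n = {(i, j). 1 \<le> i \<and> i < j \<and> j \<le> n}"

lemma mem_pairs [simp]: "(i, j) \<in> pairs n \<longleftrightarrow> 1 \<le> i \<and> i < j \<and> j \<le> n"
  by (simp add: pairs_def)

lemma finite_pairs [simp]: "finite (pairs n)"
  by (rule finite_subset[of _ "{1..n} \<times> {1..n}"]) (auto simp: pairs_def)

definition vdm :: "nat \<Rightarrow> (nat \<Rightarrow> 'k::comm_ring_1) \<Rightarrow> 'k" where
  "vdm n y = (\<Prod>(i, j)\<in>pairs n. y i - y j)"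

lemma polyfun_pairs:
  assumes "P \<subseteq> pairs n"
  shows "polyfun {1..n} (int (card P)) (\<lambda>y. \<Prod>(i, j)\<in>P. y i - y j)"
proof -
  have "polyfun {1..n} (int (card P)) (\<lambda>y. \<Prod>p\<in>P. (\<lambda>y. y (fst p) - y (snd p)) y)"
    by (rule polyfun_prod[where d = "\<lambda>_. 1"])
      (use assms in \<open>fastforce intro!: polyfun_diff polyfun.var \<close>)+
  then show ?thesis by (simp add: case_prod_beta)
qed

lemma polyfun_vdm: "polyfun {1..n} (int (card (pairs n))) (vdm n)"
  using polyfun_pairs[of "pairs n" n] unfolding vdm_def by simp

lemma vdm_nonzero:
  fixes y :: "nat \<Rightarrow> 'k::idom"
  shows "inj_on y {1..n} \<Longrightarrow> vdm n y \<noteq> 0"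
  unfolding vdm_def by (subst prod_zero_iff) (fastforce dest: inj_onD)+

text \<open>Up to sign, the square is the product over all ordered pairs of distinct indices, and a
  transposition only permutes these pairs.\<close>

lemma vdm_sq_transpose:
  fixes y :: "nat \<Rightarrow> 'k::idom"
  assumes "a \<in> {1..n}" "b \<in> {1..n}"
  shows "(vdm n (y \<circ> Transposition.transpose a b))\<^sup>2 = (vdm n y)\<^sup>2"
proof -
  let ?Q = "\<lambda>y :: nat \<Rightarrow> 'k. \<Prod>(i, j)\<in>{(i, j). i \<in> {1..n} \<and> j \<in> {1..n} \<and> i \<noteq> j}. y i - y j"
  let ?t = "Transposition.transpose a b"
  have Q: "?Q y = (- 1) ^ card (pairs n) * (vdm n y)\<^sup>2" for y
  proof -
    have "{(i, j). i \<in> {1..n} \<and> j \<in> {1..n} \<and> i \<noteq> j} = pairs n \<union> prod.swap ` pairs n"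
      by auto
    then have "?Q y = (\<Prod>(i, j)\<in>pairs n. y i - y j) * (\<Prod>(i, j)\<in>prod.swap ` pairs n. y i - y j)"
      by (simp only:) (rule prod.union_disjoint, auto)
    also have "(\<Prod>(i, j)\<in>prod.swap ` pairs n. y i - y j) = (\<Prod>p\<in>pairs n. - 1 * (case p of (i, j) \<Rightarrow> y i - y j))"
      by (subst prod.reindex) (auto simp: case_prod_beta)
    also have "\<dots> = (- 1) ^ card (pairs n) * (\<Prod>(i, j)\<in>pairs n. y i - y j)"
      by (simp only: prod.distrib prod_constant)
    finally show ?thesis by (simp add: vdm_def power2_eq_square)
  qed
  have "?Q (y \<circ> ?t) = ?Q y"
    by (rule prod.reindex_bij_witness[of _ "\<lambda>(i, j). (?t i, ?t j)" "\<lambda>(i, j). (?t i, ?t j)"])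
      (use assms in \<open>auto simp: Transposition.transpose_def split: if_splits\<close>)
  then show ?thesis unfolding Q by (simp add: comp_def)
qed

text \<open>Let v be the Vandermonde product and v' its transpose. The squares agree, so (v' - v)(v'
  + v) = 0, and one of the two factors vanishes identically. It remains to exclude v' = v.\<close>

lemma vdm_transpose:
  fixes y :: "nat \<Rightarrow> 'k::field_char_0"
  assumes "a \<in> {1..n}" "b \<in> {1..n}" "a \<noteq> b"
  shows "vdm n (y \<circ> Transposition.transpose a b) = - vdm n y"
proof -
  have "vdm n (y \<circ> Transposition.transpose a b) = - vdm n y" if ab: "a \<in> {1..n}" "b \<in> {1..n}" "a < b" for a b and y :: "nat \<Rightarrow> 'k"
  proof -
    let ?t = "Transposition.transpose a b"
    let ?M = "\<lambda>y :: nat \<Rightarrow> 'k. \<Prod>(i, j)\<in>pairs n - {(a, b)}. y i - y j"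
    let ?N = "int (card (pairs n))"
    have pv: "polyfun {1..n} ?N (\<lambda>y. vdm n (y \<circ> ?t) :: 'k)"
      using polyfun_transpose[OF polyfun_vdm] ab by blast
    have pM: "polyfun {1..n} ?N ?M"
      by (rule polyfun_mono[OF polyfun_pairs[of _ n]]) (auto intro: card_mono)
    have pMt: "polyfun {1..n} ?N (\<lambda>y. ?M (y \<circ> ?t))"
      by (rule polyfun_transpose[OF pM]) (use ab in auto)
    have vM: "vdm n y = (y a - y b) * ?M y" for y
      using ab prod.remove[of "pairs n" "(a, b)" "\<lambda>(i, j). y i - y j"]
      by (auto simp: vdm_def)
    \<comment> \<open>If v were invariant, splitting off y_a - y_b would make the cofactor
      \<open>?M\<close> change sign, hence vanish wherever y_a = y_b.\<close>
    have False if eq: "\<And>y :: nat \<Rightarrow> 'k. vdm n (y \<circ> ?t) = vdm n y"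
    proof -
      have "(y a - y b) * (?M (y \<circ> ?t) + ?M y) = 0" for y
      proof -
        have "(y b - y a) * ?M (y \<circ> ?t) = (y a - y b) * ?M y"
          using eq[of y] unfolding vM by simp
        then show ?thesis by (simp add: algebra_simps)
      qed
      then have *: "?M (y \<circ> ?t) + ?M y = 0" for y
        by (rule polyfun_mult_eq_0[of "{1..n}" 1 "\<lambda>y. y a - y b" ?N "\<lambda>y. ?M (y \<circ> ?t) + ?M y" "(\<lambda>_. 0)(a := 1)" y, rotated 2])
          (use ab pM pMt in \<open>auto intro!: polyfun_diff polyfun.intros\<close>)
      \<comment> \<open>The only coincidence among the entries of \<open>z\<close> is at a and b, so
        no factor of \<open>?M\<close> vanishes there.\<close>
      define z :: "nat \<Rightarrow> 'k" where "z = (of_nat :: nat \<Rightarrow> 'k)(b := of_nat a)"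
      have "z \<circ> ?t = z" by (auto simp: z_def Transposition.transpose_def fun_eq_iff)
      then have "?M z = 0" using *[of z] by simp
      then have "\<exists>p\<in>pairs n - {(a, b)}. (case p of (i, j) \<Rightarrow> z i - z j) = 0"
        by (subst (asm) prod_zero_iff) auto
      then show False using ab by (auto simp: z_def pairs_def split: if_splits)
    qed
    then obtain y0 :: "nat \<Rightarrow> 'k" where y0: "vdm n (y0 \<circ> ?t) \<noteq> vdm n y0" by blast
    have "(vdm n (y \<circ> ?t) - vdm n y) * (vdm n (y \<circ> ?t) + vdm n y) = 0" for y :: "nat \<Rightarrow> 'k"
      using vdm_sq_transpose[OF ab(1,2), of y] by (simp add: algebra_simps power2_eq_square)
    then have "vdm n (y \<circ> ?t) + vdm n y = 0"
      using y0 by (intro polyfun_mult_eq_0[where V = "{1..n}" and j = ?N and k = ?N and f = "\<lambda>y. vdm n (y \<circ> ?t) - vdm n y" and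
        g = "\<lambda>y. vdm n (y \<circ> ?t) + vdm n y" and a = y0 and b = y]
        polyfun_diff[OF pv polyfun_vdm] polyfun.add[OF pv polyfun_vdm]) auto
    then show ?thesis by (simp add: eq_neg_iff_add_eq_0)
  qed
  from this[of a b y] this[of b a y] assms show ?thesis
    by (metis linorder_neqE_nat transpose_commute)
qed

text \<open>The factors are split off one at a time. The current cofactor still vanishes on y_i =
  y_j: f does, by antisymmetry and characteristic zero, while the factors already removed do not
  vanish identically there.\<close>

lemma antisymmetric_divisible_by_vdm:
  fixes f :: "(nat \<Rightarrow> 'k::field_char_0) \<Rightarrow> 'k"
  assumes f: "polyfun {1..n} k f"
    and anti: "\<And>i j y. i \<in> {1..n} \<Longrightarrow> j \<in> {1..n} \<Longrightarrow> i \<noteq> j \<Longrightarrow> f (y \<circ> Transposition.transpose i j) = - f y"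
  shows "\<exists>g. polyfun {1..n} (k - int (card (pairs n))) g \<and> symfun n g \<and> (\<forall>y. f y = vdm n y * g y)"
proof -
  have "P \<subseteq> pairs n \<Longrightarrow> \<exists>g. polyfun {1..n} (k - int (card P)) g \<and> (\<forall>y. f y = (\<Prod>(i, j)\<in>P. y i - y j) * g y)"
    if "finite P" for P using that
  proof (induction P)
    case empty
    then show ?case using f by auto
  next
    case (insert p P)
    obtain i j where p: "p = (i, j)" by fastforce
    have ij: "i \<in> {1..n}" "j \<in> {1..n}" "i < j" using insert p by auto
    obtain g where g: "polyfun {1..n} (k - int (card P)) g" and fg: "\<And>y. f y = (\<Prod>(i, j)\<in>P. y i - y j) * g y"
      using insert by auto
    define \<pi> :: "(nat \<Rightarrow> 'k) \<Rightarrow> 'k" where "\<pi> y = (\<Prod>(i, j)\<in>P. y i - y j)" for y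
    have p\<pi>: "polyfun {1..n} (int (card P)) \<pi>"
      using polyfun_pairs[of P n] insert by (simp add: \<pi>_def[abs_def])
    have "g (y(i := y j)) = 0" for y
    proof (rule polyfun_mult_eq_0[of "{1..n}" "int (card P)" "\<lambda>y. \<pi> (y(i := y j))" "k - int (card P)" "\<lambda>y. g (y(i := y j))" of_nat])
      show "polyfun {1..n} (int (card P)) (\<lambda>y. \<pi> (y(i := y j)))"
        by (rule polyfun_fun_upd_var[OF p\<pi> ij(2)])
      show "polyfun {1..n} (k - int (card P)) (\<lambda>y. g (y(i := y j)))"
        by (rule polyfun_fun_upd_var[OF g ij(2)])
      show "\<pi> (y(i := y j)) * g (y(i := y j)) = 0" for y
      proof -
        let ?y = "y(i := y j)"
        have "?y \<circ> Transposition.transpose i j = ?y" by (auto simp: Transposition.transpose_def fun_eq_iff)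
        then have "f ?y = - f ?y" using anti[of i j ?y] ij by simp
        then have "f ?y = 0" by simp
        then show ?thesis using fg by (simp add: \<pi>_def)
      qed
      \<comment> \<open>At this point only the coordinates i and j agree, and (i, j) is not in
        P.\<close>
      show "\<pi> (of_nat(i := of_nat j)) \<noteq> 0"
      proof
        assume "\<pi> (of_nat(i := of_nat j)) = 0"
        then have "\<exists>q\<in>P. (case q of (a, b) \<Rightarrow> (of_nat(i := of_nat j)) a - (of_nat(i := of_nat j)) b) = (0::'k)"
          unfolding \<pi>_def using insert by (subst (asm) prod_zero_iff) auto
        then show False using insert p by (auto split: if_splits)
      qed
    qed
    moreover obtain h where "polyfun {1..n} (k - int (card P) - 1) h" "\<And>y. g y - g (y(i := y j)) = (y i - y j) * h y"
      using polyfun_diff_quotient[OF g ij(1,2)] by blast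
    ultimately have "polyfun {1..n} (k - int (card (insert p P))) h" "\<And>y. g y = (y i - y j) * h y"
      using insert by (simp_all add: algebra_simps)
    then show ?case using fg insert p by (intro exI[of _ h]) (simp add: mult_ac)
  qed
  from this[of "pairs n"] obtain g where g: "polyfun {1..n} (k - int (card (pairs n))) g"
    and fg: "\<And>y. f y = vdm n y * g y" by (auto simp: vdm_def)
  have "g (y \<circ> Transposition.transpose i j) = g y" if ij: "i \<in> {1..n}" "j \<in> {1..n}" for i j y
  proof (cases "i = j")
    case False
    have "vdm n y * (g (y \<circ> Transposition.transpose i j) - g y) = 0" for y
      using anti[OF ij False, of y] vdm_transpose[OF ij False, of y] by (simp add: fg algebra_simps)
    then have "g (y \<circ> Transposition.transpose i j) - g y = 0"
      by (rule polyfun_mult_eq_0[OF polyfun_vdm, rotated, where a = of_nat])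
        (use g ij in \<open>auto intro!: polyfun_diff polyfun_transpose vdm_nonzero inj_onI\<close>)
    then show ?thesis by simp
  qed simp
  then show ?thesis using g fg by (auto simp: symfun_def)
qed

section \<open>The lowering operator\<close>

text \<open>The relation \<open>r\<^sub>i\<^sup>2 = \<rho>(y\<^sub>i)\<close> reduces a polynomial in \<open>y\<close> and \<open>r\<close> to one that is multilinear in \<open>r\<close>.\<close>

lemma polyfun_sqrt_split:
  fixes f :: "('v \<Rightarrow> 'k::comm_ring_1) \<Rightarrow> 'k" and idx :: "'v \<Rightarrow> nat"
  assumes "polyfun V k f" and N: "finite N" and idx: "\<And>v. v \<in> V \<Longrightarrow> idx v \<in> N"
  shows "\<exists>G. (\<forall>J. J \<subseteq> N \<longrightarrow> polyfun N (k - int (card J)) (G J)) \<and>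
    (\<forall>y r. (\<forall>i\<in>N. (r i)\<^sup>2 = \<rho>2 * (y i)\<^sup>2 + \<rho>1 * y i + \<rho>0) \<longrightarrow>
      f (\<lambda>v. a v * y (idx v) + b v + e v * r (idx v)) = (\<Sum>J\<in>Pow N. (\<Prod>i\<in>J. r i) * G J y))"
  using assms(1)
proof (induction rule: polyfun.induct)
  case (zero k)
  show ?case by (rule exI[of _ "\<lambda>_ _. 0"]) (simp add: polyfun.zero)
next
  case (const k c)
  have "(\<Sum>J\<in>Pow N. (\<Prod>i\<in>J. r i) * (if J = {} then c else 0)) = c" for r :: "nat \<Rightarrow> 'k"
    using N by (subst sum.remove[of _ "{}"]) auto
  then show ?case
    by (intro exI[of _ "\<lambda>J _. if J = {} then c else 0"]) (use const in \<open>simp add: polyfun.zero polyfun.const\<close>)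
next
  case (var v k)
  let ?G = "\<lambda>J y. if J = {} then a v * y (idx v) + b v else if J = {idx v} then e v else 0"
  have "(\<Sum>J\<in>Pow N. (\<Prod>i\<in>J. r i) * ?G J y) = a v * y (idx v) + b v + e v * r (idx v)" for r y :: "nat \<Rightarrow> 'k"
  proof -
    have "(\<Sum>J\<in>Pow N. (\<Prod>i\<in>J. r i) * ?G J y) = (\<Sum>J\<in>{{}, {idx v}}. (\<Prod>i\<in>J. r i) * ?G J y)"
      using N idx[OF var(1)] by (intro sum.mono_neutral_right) auto
    then show ?thesis by (simp add: mult.commute)
  qed
  moreover have "polyfun N (k - int (card J)) (?G J)" if "J \<subseteq> N" for J
  proof -
    have "polyfun N k (\<lambda>y. a v * y (idx v) + b v)"
      using var idx[OF var(1)] by (intro polyfun.add polyfun_cmult polyfun.var polyfun.const) auto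
    then show ?thesis
      using var polyfun.zero polyfun.const[of "k - 1" N "e v"]
      by (cases "J = {}"; cases "J = {idx v}") simp_all
  qed
  ultimately show ?case by (intro exI[of _ ?G] conjI allI impI) (simp_all only:)
next
  case (add k f g)
  from add.IH(1) obtain F where F: "(\<forall>J. J \<subseteq> N \<longrightarrow> polyfun N (k - int (card J)) (F J)) \<and>
      (\<forall>y r. (\<forall>i\<in>N. (r i)\<^sup>2 = \<rho>2 * (y i)\<^sup>2 + \<rho>1 * y i + \<rho>0) \<longrightarrow>
      f (\<lambda>v. a v * y (idx v) + b v + e v * r (idx v)) = (\<Sum>J\<in>Pow N. (\<Prod>i\<in>J. r i) * F J y))"
    by (rule exE)
  note F = conjunct1[OF F] conjunct2[OF F]
  from add.IH(2) obtain G where G: "(\<forall>J. J \<subseteq> N \<longrightarrow> polyfun N (k - int (card J)) (G J)) \<and>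
      (\<forall>y r. (\<forall>i\<in>N. (r i)\<^sup>2 = \<rho>2 * (y i)\<^sup>2 + \<rho>1 * y i + \<rho>0) \<longrightarrow>
      g (\<lambda>v. a v * y (idx v) + b v + e v * r (idx v)) = (\<Sum>J\<in>Pow N. (\<Prod>i\<in>J. r i) * G J y))"
    by (rule exE)
  note G = conjunct1[OF G] conjunct2[OF G]
  show ?case
    using F G by (intro exI[of _ "\<lambda>J y. F J y + G J y"] conjI allI impI polyfun.add)
      (simp_all only: distrib_left sum.distrib)
next
  case (mult j f k g)
  from mult.IH(1) obtain F where F: "(\<forall>J. J \<subseteq> N \<longrightarrow> polyfun N (j - int (card J)) (F J)) \<and>
      (\<forall>y r. (\<forall>i\<in>N. (r i)\<^sup>2 = \<rho>2 * (y i)\<^sup>2 + \<rho>1 * y i + \<rho>0) \<longrightarrow>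
      f (\<lambda>v. a v * y (idx v) + b v + e v * r (idx v)) = (\<Sum>J\<in>Pow N. (\<Prod>i\<in>J. r i) * F J y))"
    by (rule exE)
  note F = conjunct1[OF F] conjunct2[OF F]
  from mult.IH(2) obtain G where G: "(\<forall>J. J \<subseteq> N \<longrightarrow> polyfun N (k - int (card J)) (G J)) \<and>
      (\<forall>y r. (\<forall>i\<in>N. (r i)\<^sup>2 = \<rho>2 * (y i)\<^sup>2 + \<rho>1 * y i + \<rho>0) \<longrightarrow>
      g (\<lambda>v. a v * y (idx v) + b v + e v * r (idx v)) = (\<Sum>J\<in>Pow N. (\<Prod>i\<in>J. r i) * G J y))"
    by (rule exE)
  note G = conjunct1[OF G] conjunct2[OF G]
  \<comment> \<open>\<open>S L\<close> collects the pairs (J, K) with symmetric difference L: in the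
    product of their monomials in r, the indices common to J and K occur squared and are replaced by
    the quadratic \<open>R\<close>.\<close>
  define S where "S L = {(J, K) \<in> Pow N \<times> Pow N. (J - K) \<union> (K - J) = L}" for L
  define R where "R y i = \<rho>2 * (y i)\<^sup>2 + \<rho>1 * y i + \<rho>0" for y :: "nat \<Rightarrow> 'k" and i
  let ?H = "\<lambda>L y. \<Sum>(J, K)\<in>S L. (\<Prod>i\<in>J \<inter> K. R y i) * (F J y * G K y)"
  have "polyfun N (j + k - int (card L)) (?H L)" if L: "L \<subseteq> N" for L
    unfolding case_prod_beta
  proof (rule polyfun_sum)
    fix p assume "p \<in> S L"
    then obtain J K where p: "p = (J, K)" and JK: "J \<subseteq> N" "K \<subseteq> N" "(J - K) \<union> (K - J) = L"
      by (auto simp: S_def)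
    have fin: "finite J" "finite K" using JK N finite_subset by auto
    have "card J = card (J \<inter> K) + card (J - K)" "card K = card (J \<inter> K) + card (K - J)"
      using card_Int_Diff[OF fin(1), of K] card_Int_Diff[OF fin(2), of J] by (simp_all only: Int_commute)
    moreover have "card L = card (J - K) + card (K - J)"
      using fin JK(3) card_Un_disjoint[of "J - K" "K - J"] by auto
    \<comment> \<open>An index common to J and K adds degree 2 through \<open>R\<close>, which is
      what its two subtractions, one in J and one in K, pay for.\<close>
    ultimately have c: "2 * int (card (J \<inter> K)) + ((j - int (card J)) + (k - int (card K))) \<le> j + k - int (card L)"
      by linarith
    have "polyfun N (2 * int (card (J \<inter> K))) (\<lambda>y. \<Prod>i\<in>J \<inter> K. R y i)"
    proof (rule polyfun_prod[where d = "\<lambda>_. 2"])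
      fix i assume "i \<in> J \<inter> K"
      then have i: "i \<in> N" using JK by auto
      show "polyfun N 2 (\<lambda>y. R y i)"
        unfolding R_def using i
        by (intro polyfun.add polyfun_cmult polyfun_power[where d = 1] polyfun.var polyfun.const) auto
    qed simp
    from polyfun_mult'[OF this polyfun.mult c] F(1) G(1) JK
    show "polyfun N (j + k - int (card L))
          (\<lambda>y. (\<Prod>i\<in>fst p \<inter> snd p. R y i) * (F (fst p) y * G (snd p) y))"
      by (simp add: p)
  qed
  moreover have "f (\<lambda>v. a v * y (idx v) + b v + e v * r (idx v)) * g (\<lambda>v. a v * y (idx v) + b v + e v * r (idx v))
      = (\<Sum>L\<in>Pow N. (\<Prod>i\<in>L. r i) * ?H L y)" if r: "\<forall>i\<in>N. (r i)\<^sup>2 = \<rho>2 * (y i)\<^sup>2 + \<rho>1 * y i + \<rho>0" for y r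
  proof -
    have "f (\<lambda>v. a v * y (idx v) + b v + e v * r (idx v)) * g (\<lambda>v. a v * y (idx v) + b v + e v * r (idx v))
      = (\<Sum>(J, K)\<in>Pow N \<times> Pow N. ((\<Prod>i\<in>J. r i) * F J y) * ((\<Prod>i\<in>K. r i) * G K y))"
      unfolding F(2)[THEN spec, THEN spec, THEN mp, OF r] G(2)[THEN spec, THEN spec, THEN mp, OF r]
      by (simp add: sum_product sum.cartesian_product)
    also have "\<dots> = (\<Sum>L\<in>Pow N. \<Sum>(J, K)\<in>{p\<in>Pow N \<times> Pow N. (case p of (J, K) \<Rightarrow> (J - K) \<union> (K - J)) = L}.
        ((\<Prod>i\<in>J. r i) * F J y) * ((\<Prod>i\<in>K. r i) * G K y))"
      using N by (intro sum.group[symmetric]) auto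
    also have "\<dots> = (\<Sum>L\<in>Pow N. \<Sum>(J, K)\<in>S L. (\<Prod>i\<in>L. r i) * ((\<Prod>i\<in>J \<inter> K. R y i) * (F J y * G K y)))"
    proof (intro sum.cong refl)
      fix L show "{p\<in>Pow N \<times> Pow N. (case p of (J, K) \<Rightarrow> (J - K) \<union> (K - J)) = L} = S L"
        by (auto simp: S_def)
    next
      fix L p assume "p \<in> S L"
      then obtain J K where p: "p = (J, K)" and JK: "J \<subseteq> N" "K \<subseteq> N" "(J - K) \<union> (K - J) = L"
        by (auto simp: S_def)
      have fin: "finite J" "finite K" using JK N finite_subset by auto
      have "(\<Prod>i\<in>J. r i) = (\<Prod>i\<in>J - K. r i) * (\<Prod>i\<in>J \<inter> K. r i)"
        if "finite J" for J K :: "nat set" using prod.Int_Diff[OF that, of r K] by (simp add: mult.commute)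
      from this[OF fin(1), of K] this[OF fin(2), of J]
      have 1: "(\<Prod>i\<in>J. r i) = (\<Prod>i\<in>J - K. r i) * (\<Prod>i\<in>J \<inter> K. r i)"
        "(\<Prod>i\<in>K. r i) = (\<Prod>i\<in>K - J. r i) * (\<Prod>i\<in>J \<inter> K. r i)"
        by (simp_all only: Int_commute)
      have 2: "(\<Prod>i\<in>L. r i) = (\<Prod>i\<in>J - K. r i) * (\<Prod>i\<in>K - J. r i)"
        unfolding JK(3)[symmetric] using fin by (intro prod.union_disjoint) auto
      have 3: "(\<Prod>i\<in>J \<inter> K. r i) * (\<Prod>i\<in>J \<inter> K. r i) = (\<Prod>i\<in>J \<inter> K. R y i)"
        unfolding prod.distrib[symmetric] using JK r by (intro prod.cong) (auto simp: R_def power2_eq_square)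
      show "(case p of (J, K) \<Rightarrow> ((\<Prod>i\<in>J. r i) * F J y) * ((\<Prod>i\<in>K. r i) * G K y)) =
          (case p of (J, K) \<Rightarrow> (\<Prod>i\<in>L. r i) * ((\<Prod>i\<in>J \<inter> K. R y i) * (F J y * G K y)))"
        unfolding p prod.case 1 2 3[symmetric] by (simp only: mult_ac)
    qed
    also have "\<dots> = (\<Sum>L\<in>Pow N. (\<Prod>i\<in>L. r i) * ?H L y)"
      by (simp add: sum_distrib_left case_prod_beta)
    finally show ?thesis .
  qed
  ultimately show ?case by (intro exI[of _ ?H] conjI allI impI)
qed

text \<open>Alternating over the sign changes of the r_i keeps only the part odd in every r_i, the
  term J = N of \<open>polyfun_sqrt_split\<close>. Its cofactor has lost one degree per
  index.\<close>

lemma signed_sum_eq: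
  fixes f :: "('v \<Rightarrow> 'k::comm_ring_1) \<Rightarrow> 'k" and idx :: "'v \<Rightarrow> nat"
  assumes "polyfun V k f" and N: "finite N" and idx: "\<And>v. v \<in> V \<Longrightarrow> idx v \<in> N"
  shows "\<exists>G. polyfun N (k - int (card N)) G \<and>
    (\<forall>y r. (\<forall>i\<in>N. (r i)\<^sup>2 = \<rho>2 * (y i)\<^sup>2 + \<rho>1 * y i + \<rho>0) \<longrightarrow>
      (\<Sum>I\<in>Pow N. (- 1) ^ card I *
        f (\<lambda>v. a v * y (idx v) + b v + e v * (if idx v \<in> I then - r (idx v) else r (idx v))))
      = 2 ^ card N * (\<Prod>i\<in>N. r i) * G y)"
proof -
  from polyfun_sqrt_split[OF assms(1,2), where idx = idx and ?\<rho>2.0 = \<rho>2 and ?\<rho>1.0 = \<rho>1 and ?\<rho>0.0 = \<rho>0 and a = a and b = b and e = e] obtain G where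
    G: "polyfun N (k - int (card N)) (G N)" and
    exp: "\<And>y r. \<forall>i\<in>N. (r i)\<^sup>2 = \<rho>2 * (y i)\<^sup>2 + \<rho>1 * y i + \<rho>0 \<Longrightarrow>
      f (\<lambda>v. a v * y (idx v) + b v + e v * r (idx v)) = (\<Sum>J\<in>Pow N. (\<Prod>i\<in>J. r i) * G J y)"
    using idx by blast
  have "(\<Sum>I\<in>Pow N. (- 1) ^ card I *
        f (\<lambda>v. a v * y (idx v) + b v + e v * (if idx v \<in> I then - r (idx v) else r (idx v))))
      = 2 ^ card N * (\<Prod>i\<in>N. r i) * G N y" (is "?L = _")
    if r: "\<forall>i\<in>N. (r i)\<^sup>2 = \<rho>2 * (y i)\<^sup>2 + \<rho>1 * y i + \<rho>0" for y r
  proof -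
    have "?L = (\<Sum>I\<in>Pow N. (- 1) ^ card I * (\<Sum>J\<in>Pow N. (\<Prod>i\<in>J. if i \<in> I then - r i else r i) * G J y))"
    proof (rule sum.cong[OF refl])
      fix I
      have "f (\<lambda>v. a v * y (idx v) + b v + e v * (if idx v \<in> I then - r (idx v) else r (idx v))) =
        (\<Sum>J\<in>Pow N. (\<Prod>i\<in>J. if i \<in> I then - r i else r i) * G J y)"
        by (rule exp[of "\<lambda>i. if i \<in> I then - r i else r i" y]) (use r in auto)
      then show "(- 1) ^ card I * f (\<lambda>v. a v * y (idx v) + b v + e v * (if idx v \<in> I then - r (idx v) else r (idx v))) =
        (- 1) ^ card I * (\<Sum>J\<in>Pow N. (\<Prod>i\<in>J. if i \<in> I then - r i else r i) * G J y)" by simp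
    qed
    also have "\<dots> = (\<Sum>J\<in>Pow N. (\<Sum>I\<in>Pow N. (- 1) ^ card I * (\<Prod>i\<in>J. if i \<in> I then - r i else r i)) * G J y)"
      by (simp add: sum_distrib_left sum_distrib_right mult.assoc) (rule sum.swap)
    also have "\<dots> = (\<Sum>J\<in>Pow N. (if J = N then 2 ^ card N * (\<Prod>i\<in>N. r i) else 0) * G J y)"
    proof (rule sum.cong[OF refl], rule arg_cong2[where f = "(*)", OF _ refl])
      fix J assume "J \<in> Pow N"
      then have J: "J \<subseteq> N" "finite J" using N finite_subset by auto
      have "(- 1) ^ card I * (\<Prod>i\<in>J. if i \<in> I then - r i else r i) =
          (\<Prod>i\<in>J. r i) * (\<Prod>i\<in>I. if i \<in> J then 1 else - 1)" if "I \<in> Pow N" for I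
      proof -
        have I: "finite I" using that N finite_subset by auto
        have "(\<Prod>i\<in>J. if i \<in> I then - r i else r i) = (\<Prod>i\<in>J. (if i \<in> I then - 1 else 1) * r i)"
          by (intro prod.cong) auto
        also have "\<dots> = (\<Prod>i\<in>J \<inter> I. - 1) * (\<Prod>i\<in>J. r i)"
          by (simp only: prod.distrib prod.inter_restrict[OF J(2)])
        also have "(\<Prod>i\<in>J \<inter> I. - 1) = (\<Prod>i\<in>I. if i \<in> J then - 1 else (1::'k))"
          by (simp only: Int_commute[of J] prod.inter_restrict[OF I])
        finally have "(- 1) ^ card I * (\<Prod>i\<in>J. if i \<in> I then - r i else r i) =
            (\<Prod>i\<in>I. (- 1) * (if i \<in> J then - 1 else 1)) * (\<Prod>i\<in>J. r i)"
          by (simp only: prod.distrib prod_constant mult.assoc)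
        also have "(\<Prod>i\<in>I. (- 1) * (if i \<in> J then - 1 else 1)) = (\<Prod>i\<in>I. if i \<in> J then 1 else (- 1 :: 'k))"
          by (intro prod.cong) auto
        finally show ?thesis by (simp add: mult.commute)
      qed
      then have "(\<Sum>I\<in>Pow N. (- 1) ^ card I * (\<Prod>i\<in>J. if i \<in> I then - r i else r i)) =
          (\<Prod>i\<in>J. r i) * (\<Sum>I\<in>Pow N. (\<Prod>i\<in>I. if i \<in> J then 1 else - 1) * (\<Prod>i\<in>N - I. 1))"
        by (simp add: sum_distrib_left)
      \<comment> \<open>The signed sum over I factors over the indices, and an index outside J
        contributes -1 + 1 = 0.\<close>
      also have "\<dots> = (\<Prod>i\<in>J. r i) * (\<Prod>i\<in>N. (if i \<in> J then 1 else - 1) + 1)"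
        by (simp only: prod_add[OF N])
      also have "\<dots> = (if J = N then 2 ^ card N * (\<Prod>i\<in>N. r i) else 0)"
      proof (cases "J = N")
        case False
        then obtain i where "i \<in> N" "i \<notin> J" using J by auto
        then have "(\<Prod>i\<in>N. (if i \<in> J then 1 else - 1) + 1) = (0 :: 'k)"
          using N by (intro prod_zero) auto
        then show ?thesis using False by simp
      qed (auto simp: mult.commute)
      finally show "(\<Sum>I\<in>Pow N. (- 1) ^ card I * (\<Prod>i\<in>J. if i \<in> I then - r i else r i)) =
        (if J = N then 2 ^ card N * (\<Prod>i\<in>N. r i) else 0)" .
    qed
    also have "\<dots> = 2 ^ card N * (\<Prod>i\<in>N. r i) * G N y"
      using N by (subst sum.remove[of _ N]) auto
    finally show ?thesis .
  qed
  then show ?thesis using G by blast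
qed

text \<open>
  With \<open>y = c' m j\<close> the values \<open>c (Suc m) j\<close> and \<open>c m j\<close> are \<open>\<pi>(y) \<plusminus> r\<close>, where \<open>\<pi>\<close> is affine and \<open>r\<^sup>2\<close> is
  quadratic in \<open>y\<close>. The last two clauses concern the auxiliary nodes \<open>\<omega>(y) \<plusminus> \<kappa> r\<close>, \<open>\<omega>\<close> affine: the
  coincidence of the lower node of \<open>(m, Suc j)\<close> with the upper node of \<open>(m, j)\<close> makes the coefficients of
  non-partitions vanish.
\<close>

definition lowering :: "(nat \<Rightarrow> nat \<Rightarrow> 'k::field_char_0) \<Rightarrow> (nat \<Rightarrow> nat \<Rightarrow> 'k) \<Rightarrow> bool" where
  "lowering c c' \<longleftrightarrow> (\<exists>r p1 p0 w1 w0 \<kappa> \<rho>2 \<rho>1 \<rho>0.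
     (\<forall>m j. c (Suc m) j = p1 * c' m j + p0 + r m j \<and> c m j = p1 * c' m j + p0 - r m j \<and>
            r m j \<noteq> 0 \<and> (r m j)\<^sup>2 = \<rho>2 * (c' m j)\<^sup>2 + \<rho>1 * c' m j + \<rho>0) \<and>
     inj (\<lambda>(m, j). c' m j) \<and>
     inj (\<lambda>(m, j). w1 * c' m j + w0 + \<kappa> * r m j) \<and>
     (\<forall>m j. w1 * c' m (Suc j) + w0 - \<kappa> * r m (Suc j) = w1 * c' m j + w0 + \<kappa> * r m j))"

lemma loweringI:
  assumes "\<And>m j. c (Suc m) j = p1 * c' m j + p0 + r m j" "\<And>m j. c m j = p1 * c' m j + p0 - r m j"
    "\<And>m j. r m j \<noteq> 0" "\<And>m j. (r m j)\<^sup>2 = \<rho>2 * (c' m j)\<^sup>2 + \<rho>1 * c' m j + \<rho>0"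
    "inj (\<lambda>(m, j). c' m j)" "inj (\<lambda>(m, j). w1 * c' m j + w0 + \<kappa> * r m j)"
    "\<And>m j. w1 * c' m (Suc j) + w0 - \<kappa> * r m (Suc j) = w1 * c' m j + w0 + \<kappa> * r m j"
  shows "lowering c c'"
  unfolding lowering_def
  by (rule exI[of _ r], rule exI[of _ p1], rule exI[of _ p0], rule exI[of _ w1], rule exI[of _ w0],
      rule exI[of _ \<kappa>], rule exI[of _ \<rho>2], rule exI[of _ \<rho>1], rule exI[of _ \<rho>0])
    (intro conjI allI assms)

lemma sum_Pow_transpose:
  assumes "i \<in> {1..n}" "j \<in> {1..n}"
  shows "(\<Sum>I\<in>Pow {1..n}. F (Transposition.transpose i j ` I)) = (\<Sum>I\<in>Pow {1..n::nat}. F I)"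
proof -
  have "bij_betw (image (Transposition.transpose i j)) (Pow {1..n}) (Pow {1..n})"
    using assms by (intro bij_betw_Pow permutes_imp_bij permutes_swap_id)
  then show ?thesis by (rule sum.reindex_bij_betw)
qed

lemma Parts_adjacentI:
  assumes "\<And>i. 1 \<le> i \<Longrightarrow> i < n \<Longrightarrow> l (Suc i) \<le> l i" "\<And>i. i \<notin> {1..n} \<Longrightarrow> l i = 0"
  shows "l \<in> Parts n"
proof -
  have "l j \<le> l i" if "i \<le> j" "1 \<le> i" "j \<le> n" for i j
    using that
  proof (induction j rule: dec_induct)
    case (step m)
    then show ?case using assms(1)[of m] by simp
  qed simp
  then show ?thesis using assms(2) by (auto simp: Parts_def)
qed

lemma inj_on_grid_point:
  assumes "inj (\<lambda>(m, j). c m j)"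
  shows "inj_on (\<lambda>i. c (l i) (n - i)) {1..n::nat}"
proof (rule inj_onI)
  fix x y assume xy: "x \<in> {1..n}" "y \<in> {1..n}" and "c (l x) (n - x) = c (l y) (n - y)"
  then have "(l x, n - x) = (l y, n - y)" using injD[OF assms, of "(l x, n - x)" "(l y, n - y)"] by simp
  then show "x = y" using xy by auto
qed

text \<open>I is the set of negative signs of the square roots: a row in I takes the lower value
  \<open>c m j\<close> and gains no box. Thus \<open>I = {}\<close> adds a full column. The result
  need not be a partition.\<close>

definition add_strip :: "nat \<Rightarrow> nat set \<Rightarrow> part \<Rightarrow> part" where
  "add_strip n I l = (\<lambda>i. if i \<in> {1..n} - I then Suc (l i) else l i)"

lemma lowering_operator:
  fixes f :: "(nat \<Rightarrow> 'k::field_char_0) \<Rightarrow> 'k"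
  assumes low: "lowering c c'" and f: "polyfun {1..n} k f" and sym: "symfun n f"
  shows "\<exists>g. polyfun {1..n} (k - int n) g \<and> symfun n g \<and> (\<forall>l\<in>Parts n. \<exists>d.
    g (grid_point c' n l) = (\<Sum>I\<in>Pow {1..n}. d I * f (grid_point c n (add_strip n I l))) \<and>
    d {} \<noteq> 0 \<and> (\<forall>I\<in>Pow {1..n}. add_strip n I l \<notin> Parts n \<longrightarrow> d I = 0))"
proof -
  from low obtain r p1 p0 w1 w0 \<kappa> \<rho>2 \<rho>1 \<rho>0 where
    c: "\<And>m j. c (Suc m) j = p1 * c' m j + p0 + r m j" "\<And>m j. c m j = p1 * c' m j + p0 - r m j" and
    r: "\<And>m j. r m j \<noteq> 0" "\<And>m j. (r m j)\<^sup>2 = \<rho>2 * (c' m j)\<^sup>2 + \<rho>1 * c' m j + \<rho>0" and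
    inj': "inj (\<lambda>(m, j). c' m j)" and injw: "inj (\<lambda>(m, j). w1 * c' m j + w0 + \<kappa> * r m j)" and
    meet: "\<And>m j. w1 * c' m (Suc j) + w0 - \<kappa> * r m (Suc j) = w1 * c' m j + w0 + \<kappa> * r m j"
    unfolding lowering_def by blast
  define sg where "sg I s i = (if i \<in> I then - s i else s i)" for I and i :: nat and s :: "nat \<Rightarrow> 'k"
  define W where "W I y s = (\<lambda>i. w1 * y i + w0 + \<kappa> * sg I s i)" for I y s
  define X where "X I y s = (\<lambda>i. p1 * y i + p0 + sg I s i)" for I y s
  define E where "E y s = (\<Sum>I\<in>Pow {1..n}. (- 1) ^ card I * (vdm n (W I y s) * f (X I y s)))" for y s
  define rel where "rel y s \<longleftrightarrow> (\<forall>i\<in>{1..n}. (s i)\<^sup>2 = \<rho>2 * (y i)\<^sup>2 + \<rho>1 * y i + \<rho>0)" for y s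
  define R where "R l = (\<lambda>i. r (l i) (n - i))" for l :: part
  have rel: "rel (grid_point c' n l) (R l)" for l
    using r(2) by (simp add: rel_def grid_point_def R_def)

  let ?N = "int (card (pairs n))"
  \<comment> \<open>Each index carries two variables, \<open>Inl i\<close> for the auxiliary node
    and \<open>Inr i\<close> for the argument of f. Both are affine in y_i and the same r_i, so one
    application of \<open>signed_sum_eq\<close> covers them.\<close>
  let ?F = "\<lambda>v :: nat + nat \<Rightarrow> 'k. vdm n (\<lambda>i. v (Inl i)) * f (\<lambda>i. v (Inr i))"
  have "polyfun (Inl ` {1..n} \<union> Inr ` {1..n}) (?N + k) ?F"
    by (intro polyfun.mult polyfun_subst[OF polyfun_vdm] polyfun_subst[OF f]) (auto intro: polyfun.var)
  moreover have "case_sum id id v \<in> {1..n}" if "v \<in> Inl ` {1..n} \<union> Inr ` {1..n}" for v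
    using that by auto
  ultimately have "\<exists>G. polyfun {1..n} (?N + k - int n) G \<and>
      (\<forall>y s. rel y s \<longrightarrow> E y s = 2 ^ n * (\<Prod>i\<in>{1..n}. s i) * G y)"
    using signed_sum_eq[of "Inl ` {1..n} \<union> Inr ` {1..n}" "?N + k" ?F "{1..n}" "case_sum id id" "\<rho>2" "\<rho>1" "\<rho>0"
      "case_sum (\<lambda>_. w1) (\<lambda>_. p1)" "case_sum (\<lambda>_. w0) (\<lambda>_. p0)" "case_sum (\<lambda>_. \<kappa>) (\<lambda>_. 1)"]
    by (simp add: E_def W_def X_def sg_def rel_def cong: if_cong)
  then obtain G where G: "polyfun {1..n} (?N + k - int n) G" and
    EG: "\<And>y s. rel y s \<Longrightarrow> E y s = 2 ^ n * (\<Prod>i\<in>{1..n}. s i) * G y" by blast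
  have E_anti: "E (y \<circ> Transposition.transpose i j) (s \<circ> Transposition.transpose i j) = - E y s"
    if ij: "i \<in> {1..n}" "j \<in> {1..n}" "i \<noteq> j" for i j y s
  proof -
    let ?t = "Transposition.transpose i j"
    have im: "?t x \<in> ?t ` I \<longleftrightarrow> x \<in> I" for x and I :: "nat set"
      by (simp add: inj_image_mem_iff)
    have sg: "sg I (s \<circ> ?t) = sg (?t ` I) s \<circ> ?t" for I
      by (simp add: sg_def fun_eq_iff im)
    have WX: "W I (y \<circ> ?t) (s \<circ> ?t) = W (?t ` I) y s \<circ> ?t" "X I (y \<circ> ?t) (s \<circ> ?t) = X (?t ` I) y s \<circ> ?t" for I
      unfolding W_def X_def sg by auto
    have "(- 1) ^ card I * (vdm n (W I (y \<circ> ?t) (s \<circ> ?t)) * f (X I (y \<circ> ?t) (s \<circ> ?t))) =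
        - ((- 1) ^ card (?t ` I) * (vdm n (W (?t ` I) y s) * f (X (?t ` I) y s)))" for I
    proof -
      have "card (?t ` I) = card I" by (rule card_image) (rule inj_on_subset[OF inj_transpose subset_UNIV])
      moreover have "f (X (?t ` I) y s \<circ> ?t) = f (X (?t ` I) y s)"
        using sym ij by (simp add: symfun_def)
      ultimately show ?thesis
        using vdm_transpose[OF ij, of "W (?t ` I) y s"] WX[of I] by simp
    qed
    then have "E (y \<circ> ?t) (s \<circ> ?t) = (\<Sum>I\<in>Pow {1..n}. - ((- 1) ^ card (?t ` I) * (vdm n (W (?t ` I) y s) * f (X (?t ` I) y s))))"
      unfolding E_def by (rule sum.cong[OF refl])
    also have "\<dots> = (\<Sum>I\<in>Pow {1..n}. - ((- 1) ^ card I * (vdm n (W I y s) * f (X I y s))))"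
      by (rule sum_Pow_transpose[OF ij(1,2), of "\<lambda>I. - ((- 1) ^ card I * (vdm n (W I y s) * f (X I y s)))"])
    finally show ?thesis by (simp add: E_def sum_negf)
  qed
  \<comment> \<open>\<open>EG\<close> determines G only where the square roots exist, so the
    antisymmetry of E gives that of G at grid points; \<open>grid_dense\<close> extends it.\<close>
  have "G (y \<circ> Transposition.transpose i j) = - G y"
    if ij: "i \<in> {1..n}" "j \<in> {1..n}" "i \<noteq> j" for i j y
  proof -
    let ?t = "Transposition.transpose i j"
    have "G (y \<circ> ?t) + G y = 0" for y
    proof (rule grid_dense[where c = c' and n = n and f = "\<lambda>y. G (y \<circ> ?t) + G y" and y = y and k = "?N + k - int n"])
      show "polyfun {1..n} (?N + k - int n) (\<lambda>y. G (y \<circ> ?t) + G y)"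
        using ij by (intro polyfun.add polyfun_transpose G) auto
      show "\<And>j. inj (\<lambda>m. c' m j)"
        using inj' by (auto simp: inj_def)
      fix l assume "l \<in> Parts n"
      let ?y = "grid_point c' n l"
      have "rel (?y \<circ> ?t) (R l \<circ> ?t)"
        using rel[of l] ij unfolding rel_def by (auto simp: Transposition.transpose_def)
      moreover have "(\<Prod>i\<in>{1..n}. (R l \<circ> ?t) i) = (\<Prod>i\<in>{1..n}. R l i)"
        using prod.permute[OF permutes_swap_id[OF ij(1,2)], of "R l"] by simp
      moreover have "(\<Prod>i\<in>{1..n}. R l i) \<noteq> 0" using r by (simp add: R_def)
      ultimately have "2 ^ n * (\<Prod>i\<in>{1..n}. R l i) * (G (?y \<circ> ?t) + G ?y) = 0" "2 ^ n * (\<Prod>i\<in>{1..n}. R l i) \<noteq> 0"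
        using E_anti[OF ij, of ?y "R l"] EG[OF rel[of l]] EG[of "?y \<circ> ?t" "R l \<circ> ?t"]
        by (simp_all only: distrib_left) simp_all
      then show "G (?y \<circ> ?t) + G ?y = 0" by (metis mult_eq_0_iff)
    qed
    then show ?thesis by (simp add: eq_neg_iff_add_eq_0)
  qed
  from antisymmetric_divisible_by_vdm[OF G this] obtain g where
    g: "polyfun {1..n} (k - int n) g" "symfun n g" and Gg: "\<And>y. G y = vdm n y * g y"
    by (auto simp: algebra_simps)
  have "\<exists>d. g (grid_point c' n l) = (\<Sum>I\<in>Pow {1..n}. d I * f (grid_point c n (add_strip n I l))) \<and>
    d {} \<noteq> 0 \<and> (\<forall>I\<in>Pow {1..n}. add_strip n I l \<notin> Parts n \<longrightarrow> d I = 0)" if l: "l \<in> Parts n" for l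
  proof -
    let ?y = "grid_point c' n l"
    let ?Q = "2 ^ n * (\<Prod>i\<in>{1..n}. R l i) * vdm n ?y"
    have "inj_on ?y {1..n}"
      using inj_on_grid_point[OF inj', where l = l] by (rule inj_on_cong[THEN iffD1, rotated]) (simp add: grid_point_def)
    then have Q: "?Q \<noteq> 0" using r(1) vdm_nonzero[of ?y n] by (auto simp: R_def)
    let ?d = "\<lambda>I. (- 1) ^ card I * vdm n (W I ?y (R l)) / ?Q"
    have "f (X I ?y (R l)) = f (grid_point c n (add_strip n I l))" for I
    proof (rule polyfun_cong[OF f])
      fix i assume i: "i \<in> {1..n}"
      show "X I ?y (R l) i = grid_point c n (add_strip n I l) i"
        using i c(1)[of "l i" "n - i"] c(2)[of "l i" "n - i"]
        by (simp add: X_def sg_def grid_point_def add_strip_def R_def)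
    qed
    moreover have "g ?y = E ?y (R l) / ?Q"
      using EG[OF rel[of l]] Gg[of ?y] Q by simp
    ultimately have "g ?y = (\<Sum>I\<in>Pow {1..n}. ?d I * f (grid_point c n (add_strip n I l)))"
      by (simp add: E_def sum_divide_distrib mult.assoc)
    \<comment> \<open>For \<open>I = {}\<close> only upper nodes occur, and these are pairwise
      different.\<close>
    moreover have "?d {} \<noteq> 0"
    proof -
      have "inj_on (W {} ?y (R l)) {1..n}"
        using inj_on_grid_point[OF injw, where l = l]
        by (rule inj_on_cong[THEN iffD1, rotated]) (simp add: W_def sg_def grid_point_def R_def)
      then show ?thesis using Q vdm_nonzero[of "W {} ?y (R l)" n] by simp
    qed
    moreover have "?d I = 0" if I: "add_strip n I l \<notin> Parts n" for I
    proof -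
      have "add_strip n I l i = 0" if "i \<notin> {1..n}" for i
        using l that by (auto simp: add_strip_def Parts_def)
      then obtain i where i: "1 \<le> i" "i < n" "add_strip n I l (Suc i) > add_strip n I l i"
        using I Parts_adjacentI[of n "add_strip n I l"] by (meson not_le)
      moreover have "l (Suc i) \<le> l i" using l i by (auto simp: Parts_def)
      \<comment> \<open>The partition property fails only where two equal rows meet and just row
        \<open>Suc i\<close> gains a box. Then the lower node of row i coincides with the upper node
        of row \<open>Suc i\<close>.\<close>
      ultimately have I: "i \<in> I" "Suc i \<notin> I" "l (Suc i) = l i"
        by (auto simp: add_strip_def split: if_splits)
      have "n - i = Suc (n - Suc i)" using i by simp
      then have "W I ?y (R l) i = W I ?y (R l) (Suc i)"
        using I i meet[of "l i" "n - Suc i"] by (simp add: W_def sg_def grid_point_def R_def)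
      then have "vdm n (W I ?y (R l)) = 0"
        unfolding vdm_def using i by (intro prod_zero bexI[of _ "(i, Suc i)"]) auto
      then show ?thesis by simp
    qed
    ultimately show ?thesis by (intro exI[of _ ?d]) simp
  qed
  then show ?thesis using g by blast
qed

text \<open>Closure under the two reductions of \<open>extra_vanishing\<close>: removing a column
  replaces c by c', and removing an empty last row raises the second argument n - i by one.\<close>

definition lowerable :: "(nat \<Rightarrow> nat \<Rightarrow> 'k::field_char_0) set \<Rightarrow> bool" where
  "lowerable N \<longleftrightarrow> (\<forall>c\<in>N. (\<exists>c'\<in>N. lowering c c') \<and> (\<lambda>m j. c m (Suc j)) \<in> N)"

text \<open>The grid varies in the induction. Removing a column lowers the size of \<nu> and the
  degree bound both by n, so the strict inequality between them survives; removing an empty row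
  changes neither.\<close>

lemma extra_vanishing:
  fixes f :: "(nat \<Rightarrow> 'k::field_char_0) \<Rightarrow> 'k"
  assumes N: "lowerable N"
  shows "c \<in> N \<Longrightarrow> \<nu> \<in> Parts n \<Longrightarrow> polyfun {1..n} k f \<Longrightarrow> symfun n f \<Longrightarrow> k < int (psize n \<nu>) \<Longrightarrow>
    (\<And>l. l \<in> Parts n \<Longrightarrow> contains n \<nu> l \<Longrightarrow> l \<noteq> \<nu> \<Longrightarrow> f (grid_point c n l) = 0) \<Longrightarrow>
    f (grid_point c n \<nu>) = 0"
proof (induction "n + psize n \<nu>" arbitrary: n \<nu> c k f rule: less_induct)
  case less
  show ?case
  proof (cases "n = 0")
    case True
    \<comment> \<open>Here k is negative, so f is the zero function.\<close>
    then show ?thesis using less.prems polyfun_neg by (simp add: psize_def)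
  next
    case False
    then obtain m where m: "n = Suc m" using not0_implies_Suc by auto
    show ?thesis
    proof (cases "\<nu> n = 0")
      case True
      \<comment> \<open>\<open>c 0 0\<close> is the coordinate of an empty row n. For the other rows
        n - i = Suc (m - i), which explains the shift in \<open>?c\<close>.\<close>
      let ?f = "\<lambda>y. f (y(n := c 0 0))"
      let ?c = "\<lambda>m j. c m (Suc j)"
      have psz: "psize n l = psize m l" if "l n = 0" for l using that by (simp add: psize_def m)
      have sub: "l \<in> Parts n" "l n = 0" if "l \<in> Parts m" for l
        using that by (auto simp: Parts_def m) (metis le_Suc_eq le_zero_eq not_less_eq_eq order_refl)
      have \<nu>: "\<nu> \<in> Parts m" using less.prems(2) True by (auto simp: Parts_def m le_Suc_eq)
      have gp: "(grid_point ?c m l)(n := c 0 0) = grid_point c n l" if "l \<in> Parts m" for l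
        using sub[OF that] by (auto simp: grid_point_def m fun_eq_iff Suc_diff_le)
      have "?f (grid_point ?c m \<nu>) = 0"
      proof (rule less.hyps[of m \<nu> ?c k ?f])
        show "m + psize m \<nu> < n + psize n \<nu>" using psz[of \<nu>] True m by simp
        show "?c \<in> N" using N less.prems(1) by (auto simp: lowerable_def)
        show "\<nu> \<in> Parts m" by (rule \<nu>)
        show "polyfun {1..m} k ?f"
          unfolding fun_upd_def
        proof (rule polyfun_subst[OF less.prems(3), where s = "\<lambda>a y. if a = n then c 0 0 else y a"])
          fix a assume "a \<in> {1..n}"
          then show "polyfun {1..m} 1 (\<lambda>y. if a = n then c 0 0 else y a)"
            by (cases "a = n") (auto intro: polyfun.intros simp: m)
        qed
        show "symfun m ?f"
          unfolding symfun_def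
        proof (intro ballI allI)
          fix i j y assume ij: "i \<in> {1..m}" "j \<in> {1..m}"
          then have "(y \<circ> Transposition.transpose i j)(n := c 0 0) = y(n := c 0 0) \<circ> Transposition.transpose i j"
            by (auto simp: fun_eq_iff Transposition.transpose_def m)
          then show "?f (y \<circ> Transposition.transpose i j) = ?f y"
            using less.prems(4) ij by (auto simp: symfun_def m)
        qed
        show "k < int (psize m \<nu>)" using less.prems(5) psz[of \<nu>] True by simp
        fix l assume l: "l \<in> Parts m" "contains m \<nu> l" "l \<noteq> \<nu>"
        then have "contains n \<nu> l" using sub[OF l(1)] by (auto simp: contains_def m le_Suc_eq)
        then show "?f (grid_point ?c m l) = 0"
          using less.prems(6)[OF sub(1)[OF l(1)]] l gp by simp
      qed
      then show ?thesis using gp[OF \<nu>] by simp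
    next
      case False
      have pos: "\<nu> i > 0" if "i \<in> {1..n}" for i
      proof -
        have "\<nu> n \<le> \<nu> i" using less.prems(2) that by (auto simp: Parts_def)
        then show ?thesis using False by simp
      qed
      let ?\<nu> = "\<lambda>i. \<nu> i - 1"
      have \<nu>: "?\<nu> \<in> Parts n" using less.prems(2) by (auto simp: Parts_def intro: diff_le_mono)
      have "(\<Sum>i=1..n. \<nu> i) = (\<Sum>i=1..n. ?\<nu> i + 1)" using pos by (intro sum.cong) auto
      then have psz: "psize n \<nu> = psize n ?\<nu> + n" by (simp only: psize_def sum.distrib) simp
      obtain c' where c': "c' \<in> N" "lowering c c'" using N less.prems(1) by (auto simp: lowerable_def)
      from lowering_operator[OF c'(2) less.prems(3,4)] obtain g where
        g: "polyfun {1..n} (k - int n) g" "symfun n g" and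
        gf: "\<And>l. l \<in> Parts n \<Longrightarrow> \<exists>d.
          g (grid_point c' n l) = (\<Sum>I\<in>Pow {1..n}. d I * f (grid_point c n (add_strip n I l))) \<and>
          d {} \<noteq> 0 \<and> (\<forall>I\<in>Pow {1..n}. add_strip n I l \<notin> Parts n \<longrightarrow> d I = 0)" by blast
      \<comment> \<open>A partition obtained from some l inside \<open>?\<nu>\<close> by adding at
        most one box per row lies inside \<nu>, and it is \<nu> only for l = \<open>?\<nu>\<close>
        with the full column added. So the operator turns the hypotheses on f into those on g, and
        its value at \<open>?\<nu>\<close> is a nonzero multiple of that of f at \<nu>.\<close>
      have f0: "d * f (grid_point c n (add_strip n I l)) = 0"
        if "contains n ?\<nu> l" "l \<noteq> ?\<nu> \<or> I \<noteq> {}" "l \<in> Parts n" "I \<subseteq> {1..n}"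
          "add_strip n I l \<notin> Parts n \<longrightarrow> d = 0" for d I l
      proof (cases "add_strip n I l \<in> Parts n")
        case True
        have cont: "contains n \<nu> (add_strip n I l)"
          unfolding contains_def
        proof
          fix i assume i: "i \<in> {1..n}"
          then have "l i \<le> \<nu> i - 1" using that(1) by (auto simp: contains_def)
          then show "add_strip n I l i \<le> \<nu> i" using pos[OF i] by (auto simp: add_strip_def)
        qed
        have "add_strip n I l \<noteq> \<nu>"
        proof
          assume eq: "add_strip n I l = \<nu>"
          have "l i = ?\<nu> i \<and> i \<notin> I" if i: "i \<in> {1..n}" for i
          proof -
            have "l i \<le> \<nu> i - 1" using that(1) i \<open>contains n ?\<nu> l\<close> by (auto simp: contains_def)
            moreover have "\<nu> i = (if i \<in> I then l i else Suc (l i))"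
              using i eq[symmetric] by (simp add: add_strip_def)
            ultimately show ?thesis using pos[OF i] by (auto split: if_splits)
          qed
          moreover have "l i = ?\<nu> i" if "i \<notin> {1..n}" for i
            using \<open>l \<in> Parts n\<close> less.prems(2) that by (auto simp: Parts_def)
          ultimately have "l = ?\<nu>" "I = {}" using \<open>I \<subseteq> {1..n}\<close> by (auto simp: fun_eq_iff)
          then show False using that(2) by simp
        qed
        then show ?thesis using less.prems(6)[OF True cont] by simp
      qed (use that in simp)
      have "g (grid_point c' n ?\<nu>) = 0"
      proof (rule less.hyps[of n ?\<nu> c' "k - int n" g])
        show "n + psize n ?\<nu> < n + psize n \<nu>" "k - int n < int (psize n ?\<nu>)"
          using psz less.prems(5) m by auto
        fix l assume l: "l \<in> Parts n" "contains n ?\<nu> l" "l \<noteq> ?\<nu>"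
        from gf[OF l(1)] obtain d where
          d: "g (grid_point c' n l) = (\<Sum>I\<in>Pow {1..n}. d I * f (grid_point c n (add_strip n I l)))"
            "\<forall>I\<in>Pow {1..n}. add_strip n I l \<notin> Parts n \<longrightarrow> d I = 0" by blast
        show "g (grid_point c' n l) = 0"
          unfolding d(1) by (intro sum.neutral ballI f0) (use l d(2) in auto)
      qed (use c' \<nu> g in auto)
      moreover from gf[OF \<nu>] obtain d where
        d: "g (grid_point c' n ?\<nu>) = (\<Sum>I\<in>Pow {1..n}. d I * f (grid_point c n (add_strip n I ?\<nu>)))"
          "d {} \<noteq> 0" "\<forall>I\<in>Pow {1..n}. add_strip n I ?\<nu> \<notin> Parts n \<longrightarrow> d I = 0" by blast
      moreover have "(\<Sum>I\<in>Pow {1..n} - {{}}. d I * f (grid_point c n (add_strip n I ?\<nu>))) = 0"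
        by (intro sum.neutral ballI f0) (use \<nu> d(3) in \<open>auto simp: contains_def\<close>)
      ultimately have "d {} * f (grid_point c n (add_strip n {} ?\<nu>)) = 0"
        by (subst (asm) sum.remove[of _ "{}"]) auto
      moreover have "add_strip n {} ?\<nu> = \<nu>"
        using pos less.prems(2) by (auto simp: add_strip_def fun_eq_iff Parts_def)
      ultimately show ?thesis using d(2) by simp
    qed
  qed
qed

section \<open>Interpolation by symmetric polynomials\<close>

text \<open>Values in a ring, since the variables are specialised both to scalars and to the
  generators of \<Lambda>, which are Laurent polynomials.\<close>

definition esym :: "nat \<Rightarrow> nat \<Rightarrow> (nat \<Rightarrow> 'a::comm_ring_1) \<Rightarrow> 'a" where
  "esym n j y = (\<Sum>S | S \<subseteq> {1..n} \<and> card S = j. \<Prod>i\<in>S. y i)"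

text \<open>A derivation is an expression in the elementary symmetric polynomials e_j, with e_j of
  degree j. Such an expression can be lifted to one more variable and re-evaluated at the generators
  of \<Lambda>.\<close>

inductive esfun :: "nat \<Rightarrow> nat \<Rightarrow> ((nat \<Rightarrow> 'k::comm_ring_1) \<Rightarrow> 'k) \<Rightarrow> bool" for n where
  const: "esfun n k (\<lambda>_. c)"
| gen: "j \<le> k \<Longrightarrow> esfun n k (esym n j)"
| add: "esfun n k f \<Longrightarrow> esfun n k g \<Longrightarrow> esfun n k (\<lambda>y. f y + g y)"
| mult: "esfun n j f \<Longrightarrow> esfun n k g \<Longrightarrow> esfun n (j + k) (\<lambda>y. f y * g y)"

lemma esfun_cmult: "esfun n k f \<Longrightarrow> esfun n k (\<lambda>y. c * f y)"
  using esfun.mult[OF esfun.const[of n 0 c]] by simp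

lemma esfun_sum: "(\<And>a. a \<in> A \<Longrightarrow> esfun n k (f a)) \<Longrightarrow> esfun n k (\<lambda>y. \<Sum>a\<in>A. f a y)"
  by (induction A rule: infinite_finite_induct) (auto intro: esfun.const esfun.add)

lemma esfun_cong: "esfun n k f \<Longrightarrow> (\<And>i. i \<in> {1..n} \<Longrightarrow> y i = y' i) \<Longrightarrow> f y = f y'"
proof (induction rule: esfun.induct)
  case (gen j k)
  then show ?case unfolding esym_def by (intro sum.cong prod.cong) auto
qed auto

lemma esym_0: "esym n 0 y = 1"
proof -
  have "{S. S \<subseteq> {1..n} \<and> card S = 0} = {{}}"
    by (auto dest: finite_subset[OF _ finite_atLeastAtMost])
  then show ?thesis by (simp add: esym_def)
qed

lemma esym_Suc: "esym (Suc n) (Suc j) y = esym n (Suc j) y + y (Suc n) * esym n j y"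
proof -
  let ?A = "{S. S \<subseteq> {1..n} \<and> card S = Suc j}" and ?B = "{S. S \<subseteq> {1..n} \<and> card S = j}"
  have fin: "finite S" if "S \<subseteq> {1..n}" for S using that finite_subset by blast
  have "{S. S \<subseteq> {1..Suc n} \<and> card S = Suc j} = ?A \<union> insert (Suc n) ` ?B"
  proof (intro equalityI subsetI)
    fix S assume S: "S \<in> {S. S \<subseteq> {1..Suc n} \<and> card S = Suc j}"
    then have "S - {Suc n} \<subseteq> {1..n}" by (auto simp: le_Suc_eq)
    moreover have "finite S" using S finite_subset by blast
    ultimately show "S \<in> ?A \<union> insert (Suc n) ` ?B"
    proof (cases "Suc n \<in> S")
      case True
      then have "S = insert (Suc n) (S - {Suc n})" by blast
      moreover have "card (S - {Suc n}) = j" using S True by (simp add: card_Diff_singleton)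
      ultimately show ?thesis using \<open>S - {Suc n} \<subseteq> {1..n}\<close> by blast
    next
      case False
      then show ?thesis using S \<open>S - {Suc n} \<subseteq> {1..n}\<close> by simp
    qed
  next
    fix S assume "S \<in> ?A \<union> insert (Suc n) ` ?B"
    then show "S \<in> {S. S \<subseteq> {1..Suc n} \<and> card S = Suc j}"
    proof
      assume "S \<in> insert (Suc n) ` ?B"
      then obtain T where T: "S = insert (Suc n) T" "T \<subseteq> {1..n}" "card T = j" by auto
      then have "Suc n \<notin> T" by auto
      then show ?thesis using T fin[OF T(2)] by auto
    qed auto
  qed
  moreover have "?A \<inter> insert (Suc n) ` ?B = {}" by auto
  moreover have "finite ?A" "finite ?B" by auto
  ultimately have "esym (Suc n) (Suc j) y = esym n (Suc j) y + (\<Sum>S\<in>insert (Suc n) ` ?B. \<Prod>i\<in>S. y i)"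
    by (simp add: esym_def sum.union_disjoint)
  also have "(\<Sum>S\<in>insert (Suc n) ` ?B. \<Prod>i\<in>S. y i) = (\<Sum>S\<in>?B. \<Prod>i\<in>insert (Suc n) S. y i)"
  proof (rule sum.reindex_cong[OF _ refl refl], rule inj_onI)
    fix S T assume "S \<in> ?B" "T \<in> ?B" and eq: "insert (Suc n) S = insert (Suc n) T"
    then have "Suc n \<notin> S" "Suc n \<notin> T" by auto
    then show "S = T" using eq insert_ident by metis
  qed
  also have "\<dots> = (\<Sum>S\<in>?B. y (Suc n) * (\<Prod>i\<in>S. y i))"
    using fin by (intro sum.cong refl prod.insert) auto
  finally show ?thesis by (simp add: esym_def sum_distrib_left)
qed

text \<open>On the hyperplane where the new variable is c, the old e_(j+1) equals the new e_(j+1)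
  minus c times the old e_j. Iterating this expresses the old e_j by the new ones without raising
  the degree.\<close>

lemma esfun_lift: "esfun n k f \<Longrightarrow> \<exists>F. esfun (Suc n) k F \<and> (\<forall>y. y (Suc n) = c \<longrightarrow> F y = f y)"
proof (induction rule: esfun.induct)
  case (const k a)
  show ?case by (rule exI[of _ "\<lambda>_. a"]) (simp add: esfun.const)
next
  case (gen j k)
  then show ?case
  proof (induction j)
    case 0
    show ?case by (rule exI[of _ "\<lambda>_. 1"]) (simp add: esfun.const esym_0)
  next
    case (Suc j)
    then obtain F where F: "esfun (Suc n) k F" "\<forall>y. y (Suc n) = c \<longrightarrow> F y = esym n j y" by auto
    show ?case
      using F by (intro exI[of _ "\<lambda>y. esym (Suc n) (Suc j) y + (- c) * F y"] conjI esfun.add esfun.gen esfun_cmult Suc.prems)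
        (auto simp: esym_Suc)
  qed
next
  case (add k f g)
  then obtain F G where "esfun (Suc n) k F" "\<forall>y. y (Suc n) = c \<longrightarrow> F y = f y"
    "esfun (Suc n) k G" "\<forall>y. y (Suc n) = c \<longrightarrow> G y = g y" by auto
  then show ?case by (intro exI[of _ "\<lambda>y. F y + G y"] conjI esfun.add) auto
next
  case (mult j f k g)
  then obtain F G where "esfun (Suc n) j F" "\<forall>y. y (Suc n) = c \<longrightarrow> F y = f y"
    "esfun (Suc n) k G" "\<forall>y. y (Suc n) = c \<longrightarrow> G y = g y" by auto
  then show ?case by (intro exI[of _ "\<lambda>y. F y * G y"] conjI esfun.mult) auto
qed

lemma esfun_prod_diff: "esfun n n (\<lambda>y. \<Prod>i\<in>{1..n}. y i - c)"
proof -
  have "(\<Prod>i\<in>{1..n}. y i - c) = (\<Sum>j\<in>{..n}. (- c) ^ (n - j) * esym n j y)" for y :: "nat \<Rightarrow> 'a"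
  proof -
    have "(\<Prod>i\<in>{1..n}. y i + (- c)) = (\<Sum>B\<in>Pow {1..n}. (\<Prod>i\<in>B. y i) * (\<Prod>i\<in>{1..n} - B. - c))"
      by (rule prod_add) simp
    also have "\<dots> = (\<Sum>B\<in>Pow {1..n}. (- c) ^ (n - card B) * (\<Prod>i\<in>B. y i))"
      by (intro sum.cong refl) (auto simp: mult.commute card_Diff_subset finite_subset)
    also have "\<dots> = (\<Sum>j\<in>{..n}. \<Sum>B\<in>{B\<in>Pow {1..n}. card B = j}. (- c) ^ (n - card B) * (\<Prod>i\<in>B. y i))"
      by (rule sum.group[symmetric]) (auto dest: card_mono[OF finite_atLeastAtMost])
    also have "\<dots> = (\<Sum>j\<in>{..n}. (- c) ^ (n - j) * esym n j y)"
      by (intro sum.cong refl) (simp add: esym_def sum_distrib_left)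
    finally show ?thesis by simp
  qed
  then have "(\<lambda>y. \<Prod>i\<in>{1..n}. y i - c) = (\<lambda>y. \<Sum>j\<in>{..n}. (- c) ^ (n - j) * esym n j y)" by blast
  moreover have "esfun n n (\<lambda>y. \<Sum>j\<in>{..n}. (- c) ^ (n - j) * esym n j y)"
    by (rule esfun_sum, rule esfun_cmult, rule esfun.gen) simp
  ultimately show ?thesis by simp
qed

text \<open>Newton interpolation, split by the last row. A lift \<open>F\<close> from one variable
  fewer settles the partitions whose last row is empty. At grid points of partitions the product
  \<open>?P\<close> vanishes exactly for these, by injectivity, so the others are corrected by
  \<open>?P * g\<close>, where g interpolates after removal of a column, with degree bound
  \<open>k - Suc n\<close>.\<close>

lemma interpolation_exists:
  fixes c :: "nat \<Rightarrow> nat \<Rightarrow> 'k::field"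
  assumes "inj (\<lambda>(m, j). c m j)"
  shows "\<exists>f. esfun n k f \<and> (\<forall>l\<in>Parts n. psize n l \<le> k \<longrightarrow> f (grid_point c n l) = \<phi> l)"
  using assms
proof (induction n arbitrary: c k \<phi>)
  case 0
  have "l = (\<lambda>_. 0)" if "l \<in> Parts 0" for l using that by (auto simp: Parts_def)
  then show ?case by (intro exI[of _ "\<lambda>_. \<phi> (\<lambda>_. 0)"]) (auto intro: esfun.const)
next
  case (Suc n)
  note inj_c = Suc.prems
  show ?case using Suc.prems
  proof (induction k arbitrary: c \<phi> rule: less_induct)
    case (less k)
    have "inj (\<lambda>(m, j). c m (Suc j))" using less.prems by (auto simp: inj_def)
    from Suc.IH[OF this] obtain f where f: "esfun n k f"
      "\<forall>l\<in>Parts n. psize n l \<le> k \<longrightarrow> f (grid_point (\<lambda>m j. c m (Suc j)) n l) = \<phi> l" by blast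
    from esfun_lift[OF f(1)] obtain F where F: "esfun (Suc n) k F" "\<forall>y. y (Suc n) = c 0 0 \<longrightarrow> F y = f y" by blast
    have F0: "F (grid_point c (Suc n) l) = \<phi> l"
      if l: "l \<in> Parts (Suc n)" "psize (Suc n) l \<le> k" "l (Suc n) = 0" for l
    proof -
      have "l \<in> Parts n" using l by (auto simp: Parts_def le_Suc_eq)
      moreover have "f (grid_point c (Suc n) l) = f (grid_point (\<lambda>m j. c m (Suc j)) n l)"
        by (rule esfun_cong[OF f(1)]) (auto simp: grid_point_def Suc_diff_le)
      ultimately show ?thesis using f(2) F(2) l by (simp add: psize_def grid_point_def)
    qed
    have pos: "1 \<le> l i" if "l \<in> Parts (Suc n)" "l (Suc n) \<noteq> 0" "i \<in> {1..Suc n}" for l i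
    proof -
      have "l (Suc n) \<le> l i" using that by (auto simp: Parts_def)
      then show ?thesis using that by simp
    qed
    have psz: "psize (Suc n) l = psize (Suc n) (\<lambda>i. l i - 1) + Suc n" if "l \<in> Parts (Suc n)" "l (Suc n) \<noteq> 0" for l
    proof -
      have "psize (Suc n) l = (\<Sum>i=1..Suc n. (l i - 1) + 1)"
        unfolding psize_def
      proof (rule sum.cong[OF refl])
        fix i assume "i \<in> {1..Suc n}"
        then show "l i = (l i - 1) + 1" using pos[OF that, of i] by simp
      qed
      then show ?thesis by (simp only: psize_def sum.distrib) simp
    qed
    show ?case
    proof (cases "k < Suc n")
      case True
      then have "l (Suc n) = 0" if "l \<in> Parts (Suc n)" "psize (Suc n) l \<le> k" for l
        using psz[OF that(1)] that by linarith
      then show ?thesis using F(1) F0 by blast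
    next
      case False
      let ?P = "\<lambda>y. \<Prod>i\<in>{1..Suc n}. y i - c 0 0"
      \<comment> \<open>Restores the removed column, so that the target values of g are indexed by
        the smaller partition.\<close>
      let ?up = "\<lambda>l i. if i \<in> {1..Suc n} then Suc (l i) else 0"
      let ?v = "\<lambda>l. (\<phi> (?up l) - F (grid_point c (Suc n) (?up l))) / ?P (grid_point c (Suc n) (?up l))"
      have "inj (\<lambda>(m, j). c (Suc m) j)" using less.prems by (auto simp: inj_def)
      from less.IH[OF _ this, of "k - Suc n" ?v] False obtain g where g: "esfun (Suc n) (k - Suc n) g" and
        gv: "\<And>l. l \<in> Parts (Suc n) \<Longrightarrow> psize (Suc n) l \<le> k - Suc n \<Longrightarrow>
          g (grid_point (\<lambda>m j. c (Suc m) j) (Suc n) l) = ?v l" by auto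
      let ?h = "\<lambda>y. F y + ?P y * g y"
      have "esfun (Suc n) (Suc n + (k - Suc n)) (\<lambda>y. ?P y * g y)"
        by (intro esfun.mult esfun_prod_diff g)
      then have "esfun (Suc n) k ?h" using False F(1) by (intro esfun.add) auto
      moreover have "?h (grid_point c (Suc n) l) = \<phi> l" if l: "l \<in> Parts (Suc n)" "psize (Suc n) l \<le> k" for l
      proof (cases "l (Suc n) = 0")
        case True
        have "?P (grid_point c (Suc n) l) = 0"
          by (rule prod_zero) (use True in \<open>auto simp: grid_point_def intro!: bexI[of _ "Suc n"]\<close>)
        then show ?thesis using F0[OF l True] by simp
      next
        case False
        let ?l = "\<lambda>i. l i - 1"
        have "?l \<in> Parts (Suc n)" using l by (auto simp: Parts_def intro: diff_le_mono)
        moreover have "psize (Suc n) ?l \<le> k - Suc n" using psz[OF l(1) False] l by linarith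
        moreover have up: "?up ?l = l"
        proof
          fix i show "?up ?l i = l i"
            using pos[OF l(1) False, of i] l by (cases "i \<in> {1..Suc n}") (auto simp: Parts_def)
        qed
        moreover have "grid_point (\<lambda>m j. c (Suc m) j) (Suc n) ?l = grid_point c (Suc n) l"
        proof
          fix i
          have "i \<in> {1..Suc n} \<Longrightarrow> Suc (l i - 1) = l i" using pos[OF l(1) False, of i] by simp
          then show "grid_point (\<lambda>m j. c (Suc m) j) (Suc n) ?l i = grid_point c (Suc n) l i"
            by (cases "i \<in> {1..Suc n}") (auto simp: grid_point_def)
        qed
        ultimately have "g (grid_point c (Suc n) l) = (\<phi> l - F (grid_point c (Suc n) l)) / ?P (grid_point c (Suc n) l)"
          using gv[of ?l] by simp
        moreover have "?P (grid_point c (Suc n) l) \<noteq> 0"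
        proof
          assume "?P (grid_point c (Suc n) l) = 0"
          then obtain i where i: "i \<in> {1..Suc n}" "c (l i) (Suc n - i) = c 0 0"
            by (subst (asm) prod_zero_iff) (auto simp: grid_point_def)
          then have "l i = 0" using less.prems by (auto simp: inj_def)
          then show False using pos[OF l(1) False i(1)] by simp
        qed
        ultimately show ?thesis by simp
      qed
      ultimately show ?thesis by blast
    qed
  qed
qed

section \<open>Laurent polynomials\<close>

text \<open>One construction for two substitutions: evaluation of a Laurent polynomial at a point
  (\<open>leval_eq_hom_eval\<close>), and substitution of the generators of \<Lambda> into a
  polynomial (\<open>expand\<close>).\<close>

definition hom_eval :: "('k::zero \<Rightarrow> 'r::comm_ring_1) \<Rightarrow> ('m \<Rightarrow> 'r) \<Rightarrow> ('m \<Rightarrow>\<^sub>0 'k) \<Rightarrow> 'r" where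
  "hom_eval h w P = (\<Sum>m\<in>Poly_Mapping.keys P. h (Poly_Mapping.lookup P m) * w m)"

definition coeff_hom :: "('k::comm_ring_1 \<Rightarrow> 'r::comm_ring_1) \<Rightarrow> bool" where
  "coeff_hom h \<longleftrightarrow> h 0 = 0 \<and> (\<forall>a b. h (a + b) = h a + h b) \<and> (\<forall>a b. h (a * b) = h a * h b)"

lemma hom_eval_single: "coeff_hom h \<Longrightarrow> hom_eval h w (Poly_Mapping.single m c) = h c * w m"
  by (simp add: hom_eval_def coeff_hom_def)

lemma hom_eval_add: "coeff_hom h \<Longrightarrow> hom_eval h w (P + Q) = hom_eval h w P + hom_eval h w Q"
  unfolding hom_eval_def
  by (rule setsum_keys_plus_distrib[where f = "\<lambda>m c. h c * w m"])
    (auto simp: coeff_hom_def distrib_right)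

lemma hom_eval_sum:
  "coeff_hom h \<Longrightarrow> hom_eval h w (\<Sum>a\<in>A. P a) = (\<Sum>a\<in>A. hom_eval h w (P a))"
  by (induction A rule: infinite_finite_induct) (auto simp: hom_eval_add, auto simp: hom_eval_def)

lemma sum_single_lookup: "(\<Sum>m\<in>Poly_Mapping.keys P. Poly_Mapping.single m (Poly_Mapping.lookup P m)) = P"
  by (rule poly_mapping_eqI)
    (auto simp: lookup_sum lookup_single when_def in_keys_iff)

lemma mult_eq_sum_single:
  fixes P Q :: "'m::comm_monoid_add \<Rightarrow>\<^sub>0 'k::comm_ring_1"
  shows "P * Q = (\<Sum>a\<in>Poly_Mapping.keys P. \<Sum>b\<in>Poly_Mapping.keys Q. Poly_Mapping.single (a + b) (Poly_Mapping.lookup P a * Poly_Mapping.lookup Q b))"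
proof -
  have "P * Q = (\<Sum>a\<in>Poly_Mapping.keys P. Poly_Mapping.single a (Poly_Mapping.lookup P a)) * (\<Sum>b\<in>Poly_Mapping.keys Q. Poly_Mapping.single b (Poly_Mapping.lookup Q b))"
    by (simp only: sum_single_lookup)
  then show ?thesis by (simp only: sum_product mult_single)
qed

text \<open>Multiplicativity of \<open>w\<close> is asked only for monomials that occur:
  \<open>mon x\<close> violates it when a zero coordinate meets a negative exponent.\<close>

lemma hom_eval_mult:
  fixes P Q :: "'m::comm_monoid_add \<Rightarrow>\<^sub>0 'k::comm_ring_1"
  assumes h: "coeff_hom h" and w: "\<And>a b. a \<in> Poly_Mapping.keys P \<Longrightarrow> b \<in> Poly_Mapping.keys Q \<Longrightarrow> w (a + b) = w a * w b"
  shows "hom_eval h w (P * Q) = hom_eval h w P * hom_eval h w Q"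
proof -
  have "hom_eval h w (P * Q) = (\<Sum>a\<in>Poly_Mapping.keys P. \<Sum>b\<in>Poly_Mapping.keys Q. h (Poly_Mapping.lookup P a * Poly_Mapping.lookup Q b) * w (a + b))"
    unfolding mult_eq_sum_single using h by (simp add: hom_eval_sum hom_eval_single)
  also have "\<dots> = (\<Sum>a\<in>Poly_Mapping.keys P. \<Sum>b\<in>Poly_Mapping.keys Q. (h (Poly_Mapping.lookup P a) * w a) * (h (Poly_Mapping.lookup Q b) * w b))"
    using h w by (intro sum.cong refl) (simp add: coeff_hom_def)
  finally show ?thesis by (simp add: hom_eval_def sum_product)
qed

section \<open>Evaluation of Laurent polynomials\<close>

definition mon :: "(nat \<Rightarrow> 'k::field) \<Rightarrow> (nat \<Rightarrow>\<^sub>0 int) \<Rightarrow> 'k" where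
  "mon x m = (\<Prod>i\<in>Poly_Mapping.keys m. x i powi Poly_Mapping.lookup m i)"

lemma leval_eq_hom_eval: "leval f x = hom_eval (\<lambda>c. c) (mon x) f"
  by (simp add: leval_def hom_eval_def mon_def)

lemma coeff_hom_id: "coeff_hom (\<lambda>c. c)"
  by (simp add: coeff_hom_def)

lemma leval_add: "leval (f + g) x = leval f x + leval g x"
  unfolding leval_eq_hom_eval by (rule hom_eval_add[OF coeff_hom_id])

lemma leval_sum: "leval (\<Sum>a\<in>A. f a) x = (\<Sum>a\<in>A. leval (f a) x)"
  unfolding leval_eq_hom_eval by (rule hom_eval_sum[OF coeff_hom_id])

lemma leval_single: "leval (Poly_Mapping.single m c) x = c * mon x m"
  unfolding leval_eq_hom_eval by (rule hom_eval_single[OF coeff_hom_id])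

lemma mon_zero [simp]: "mon x 0 = 1"
  by (simp add: mon_def)

lemma mon_superset: "finite S \<Longrightarrow> Poly_Mapping.keys m \<subseteq> S \<Longrightarrow> mon x m = (\<Prod>i\<in>S. x i powi Poly_Mapping.lookup m i)"
  unfolding mon_def by (rule prod.mono_neutral_left) (auto simp: in_keys_iff)

lemma power_int_add_nonneg:
  fixes x :: "'k::field"
  assumes "x = 0 \<Longrightarrow> 0 \<le> a" "x = 0 \<Longrightarrow> 0 \<le> b"
  shows "x powi (a + b) = x powi a * x powi b"
proof (cases "x = 0")
  case True
  with assms have "0 \<le> a" "0 \<le> b" by auto
  then show ?thesis using True by (auto simp: power_int_0_left_if)
qed (simp add: power_int_add)

lemma mon_add:
  assumes "\<And>i. x i = 0 \<Longrightarrow> 0 \<le> Poly_Mapping.lookup a i" "\<And>i. x i = 0 \<Longrightarrow> 0 \<le> Poly_Mapping.lookup b i"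
  shows "mon x (a + b) = mon x a * mon x b"
proof -
  let ?S = "Poly_Mapping.keys a \<union> Poly_Mapping.keys b"
  have "mon x (a + b) = (\<Prod>i\<in>?S. x i powi Poly_Mapping.lookup (a + b) i)"
    using keys_add[of a b] by (intro mon_superset) auto
  also have "\<dots> = (\<Prod>i\<in>?S. x i powi Poly_Mapping.lookup a i) * (\<Prod>i\<in>?S. x i powi Poly_Mapping.lookup b i)"
    unfolding prod.distrib[symmetric] lookup_add
    by (intro prod.cong refl power_int_add_nonneg) (use assms in auto)
  finally show ?thesis by (simp add: mon_superset[of ?S])
qed

section \<open>Permutations acting on Laurent polynomials\<close>

definition act :: "(nat \<Rightarrow> nat) \<Rightarrow> 'k::comm_ring_1 laurent \<Rightarrow> 'k laurent" where
  "act p f = Poly_Mapping.map_key (Poly_Mapping.map_key p) f"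

lemma lookup_map_key: "inj f \<Longrightarrow> Poly_Mapping.lookup (Poly_Mapping.map_key f P) k = Poly_Mapping.lookup P (f k)"
  by (simp add: map_key.rep_eq)

lemma map_key_inv:
  fixes m :: "nat \<Rightarrow>\<^sub>0 'v::zero"
  assumes "bij (p :: nat \<Rightarrow> nat)"
  shows "Poly_Mapping.map_key p (Poly_Mapping.map_key (inv p) m) = m"
    "Poly_Mapping.map_key (inv p) (Poly_Mapping.map_key p m) = m"
  using assms
  by (auto intro!: poly_mapping_eqI
      simp: lookup_map_key bij_is_inj bij_imp_bij_inv bij_is_surj surj_f_inv_f)

lemma inj_map_key: "bij (p :: nat \<Rightarrow> nat) \<Longrightarrow> inj (Poly_Mapping.map_key p :: (nat \<Rightarrow>\<^sub>0 'v::zero) \<Rightarrow> _)"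
  using map_key_inv(2) by (metis injI)

context
  fixes p :: "nat \<Rightarrow> nat"
  assumes p: "bij p"
begin

lemma lookup_act: "Poly_Mapping.lookup (act p f) m = Poly_Mapping.lookup f (Poly_Mapping.map_key p m)"
  unfolding act_def by (rule lookup_map_key[OF inj_map_key[OF p]])

lemma act_add: "act p (f + g) = act p f + act p g"
  by (rule poly_mapping_eqI) (simp add: lookup_act lookup_add)

lemma act_sum: "act p (\<Sum>a\<in>A. f a) = (\<Sum>a\<in>A. act p (f a))"
  by (rule poly_mapping_eqI) (simp add: lookup_act lookup_sum)

lemma act_single: "act p (Poly_Mapping.single m c) = Poly_Mapping.single (Poly_Mapping.map_key (inv p) m) c"
  by (rule poly_mapping_eqI) (auto simp: lookup_act lookup_single when_def map_key_inv[OF p])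

lemma act_const: "act p (Poly_Mapping.single 0 c) = Poly_Mapping.single 0 c"
  by (simp add: act_single bij_is_inj bij_imp_bij_inv p)

lemma act_mult: "act p (f * g) = act p f * act p g"
proof -
  have "act p f * act p g =
      (\<Sum>a\<in>Poly_Mapping.keys f. act p (Poly_Mapping.single a (Poly_Mapping.lookup f a))) * (\<Sum>b\<in>Poly_Mapping.keys g. act p (Poly_Mapping.single b (Poly_Mapping.lookup g b)))"
    by (simp only: act_sum[symmetric] sum_single_lookup)
  also have "\<dots> = (\<Sum>a\<in>Poly_Mapping.keys f. \<Sum>b\<in>Poly_Mapping.keys g. act p (Poly_Mapping.single (a + b) (Poly_Mapping.lookup f a * Poly_Mapping.lookup g b)))"
    by (simp add: act_single sum_product mult_single map_key_plus bij_is_inj bij_imp_bij_inv p)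
  also have "\<dots> = act p (f * g)"
    by (simp only: mult_eq_sum_single[of f g] act_sum)
  finally show ?thesis ..
qed

lemma act_prod: "act p (\<Prod>a\<in>A. f a) = (\<Prod>a\<in>A. act p (f a))"
proof (induction A rule: infinite_finite_induct)
  case (insert x A)
  then show ?case by (simp add: act_mult)
qed (use act_const[of 1] in auto)

end

text \<open>In this form symmetry passes to sums and products, because \<open>act p\<close> is
  additive and multiplicative.\<close>

lemma symmetric_iff_act: "symmetric n f \<longleftrightarrow> (\<forall>p. p permutes {1..n} \<longrightarrow> act p f = f)"
  unfolding symmetric_def poly_mapping_eq_iff
  by (auto simp: fun_eq_iff lookup_act permutes_bij)

lemma leval_transpose:
  assumes f: "symmetric n f" and ij: "i \<in> {1..n}" "j \<in> {1..n}"
  shows "leval f (x \<circ> Transposition.transpose i j) = leval f x"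
proof -
  let ?t = "Transposition.transpose i j"
  let ?k = "Poly_Mapping.map_key ?t"
  have inv: "inv ?t = ?t" by (rule inv_unique_comp) (auto simp: fun_eq_iff)
  have bij: "bij ?t" by simp
  have kk: "?k (?k m) = m" for m :: "nat \<Rightarrow>\<^sub>0 int" using map_key_inv(1)[OF bij, of m] by (simp add: inv)
  have f: "Poly_Mapping.lookup f (?k m) = Poly_Mapping.lookup f m" for m
    using f permutes_swap_id[OF ij] by (auto simp: symmetric_def)
  have m: "mon (x \<circ> ?t) m = mon x (?k m)" for m
  proof -
    have "mon x (?k m) = (\<Prod>i\<in>?t -` Poly_Mapping.keys m. x i powi Poly_Mapping.lookup m (?t i))"
      by (simp add: mon_def keys_map_key lookup_map_key)
    also have "\<dots> = mon (x \<circ> ?t) m"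
      unfolding mon_def
      by (rule prod.reindex_bij_witness[of _ ?t ?t]) auto
    finally show ?thesis ..
  qed
  have "leval f (x \<circ> ?t) = (\<Sum>m\<in>Poly_Mapping.keys f. Poly_Mapping.lookup f m * mon (x \<circ> ?t) m)"
    by (simp add: leval_eq_hom_eval hom_eval_def)
  also have "\<dots> = (\<Sum>m\<in>Poly_Mapping.keys f. Poly_Mapping.lookup f m * mon x m)"
    by (rule sum.reindex_bij_witness[of _ ?k ?k]) (auto simp: kk f m in_keys_iff)
  finally show ?thesis by (simp add: leval_eq_hom_eval hom_eval_def)
qed

section \<open>Degree bounds for Laurent polynomials\<close>

lemma mdegree_superset: "finite S \<Longrightarrow> Poly_Mapping.keys m \<subseteq> S \<Longrightarrow> mdegree m = (\<Sum>i\<in>S. nat \<bar>Poly_Mapping.lookup m i\<bar>)"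
  unfolding mdegree_def by (rule sum.mono_neutral_left) (auto simp: in_keys_iff)

lemma mdegree_add: "mdegree (a + b) \<le> mdegree a + mdegree b"
proof -
  let ?S = "Poly_Mapping.keys a \<union> Poly_Mapping.keys b"
  have "mdegree (a + b) = (\<Sum>i\<in>?S. nat \<bar>Poly_Mapping.lookup (a + b) i\<bar>)"
    using keys_add[of a b] by (intro mdegree_superset) auto
  also have "\<dots> \<le> (\<Sum>i\<in>?S. nat \<bar>Poly_Mapping.lookup a i\<bar> + nat \<bar>Poly_Mapping.lookup b i\<bar>)"
    by (rule sum_mono) (simp add: lookup_add)
  finally show ?thesis by (simp add: sum.distrib mdegree_superset[of ?S])
qed

lemma ldegree_le_iff: "ldegree f \<le> k \<longleftrightarrow> (\<forall>m\<in>Poly_Mapping.keys f. mdegree m \<le> k)"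
  by (auto simp: ldegree_def)

lemma ldegree_add: "ldegree f \<le> k \<Longrightarrow> ldegree g \<le> k \<Longrightarrow> ldegree (f + g) \<le> k"
  unfolding ldegree_le_iff using keys_add[of f g] by blast

lemma ldegree_mult: "ldegree f \<le> j \<Longrightarrow> ldegree g \<le> k \<Longrightarrow> ldegree (f * g) \<le> j + k"
  unfolding ldegree_le_iff
proof
  fix m assume fg: "\<forall>m\<in>Poly_Mapping.keys f. mdegree m \<le> j" "\<forall>m\<in>Poly_Mapping.keys g. mdegree m \<le> k" and "m \<in> Poly_Mapping.keys (f * g)"
  then obtain a b where "m = a + b" "a \<in> Poly_Mapping.keys f" "b \<in> Poly_Mapping.keys g" using keys_mult[of f g] by blast
  then show "mdegree m \<le> j + k" using fg mdegree_add[of a b] by fastforce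
qed

lemma ldegree_const: "ldegree (Poly_Mapping.single 0 c) \<le> k"
  by (simp add: ldegree_le_iff mdegree_def)

lemma ldegree_sum: "(\<And>a. a \<in> A \<Longrightarrow> ldegree (f a) \<le> k) \<Longrightarrow> ldegree (\<Sum>a\<in>A. f a) \<le> k"
  by (induction A rule: infinite_finite_induct) (auto intro: ldegree_add, auto simp: ldegree_le_iff)

lemma ldegree_prod: "(\<And>a. a \<in> A \<Longrightarrow> ldegree (f a) \<le> k) \<Longrightarrow> ldegree (\<Prod>a\<in>A. f a) \<le> k * card A"
proof (induction A rule: infinite_finite_induct)
  case (insert x A)
  then have "ldegree (f x * (\<Prod>a\<in>A. f a)) \<le> k + k * card A" by (intro ldegree_mult) auto
  then show ?case using insert by simp
qed (auto simp: ldegree_def mdegree_def)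

section \<open>Coefficients of polynomial functions\<close>

text \<open>Linear independence of monomial functions. With all variables but v frozen, the
  coefficient of the power \<open>\<beta> v\<close> must vanish, which leaves a relation in the
  variables V among the exponents that agree with \<beta> at v.\<close>

lemma sum_monomials_eq_0:
  fixes c :: "(nat \<Rightarrow> nat) \<Rightarrow> 'k::field_char_0"
  assumes "finite V" "finite B" "\<forall>\<beta>\<in>B. \<forall>i. i \<notin> V \<longrightarrow> \<beta> i = 0"
    "\<forall>y. (\<Sum>\<beta>\<in>B. c \<beta> * (\<Prod>i\<in>V. y i ^ \<beta> i)) = 0" "\<beta> \<in> B"
  shows "c \<beta> = 0"
  using assms
proof (induction V arbitrary: B c \<beta> rule: finite_induct)
  case empty
  then have "\<gamma> = \<beta>" if "\<gamma> \<in> B" for \<gamma> using that by (intro ext) (metis empty_iff)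
  then have "B = {\<beta>}" using empty by blast
  then show ?case using empty by simp
next
  case (insert v V)
  let ?e = "\<beta> v"
  let ?B = "{\<gamma>\<in>B. \<gamma> v = ?e}"
  have fin: "finite B" using insert by simp
  have zero: "(\<Sum>\<gamma>\<in>?B. c \<gamma> * (\<Prod>i\<in>V. y i ^ \<gamma> i)) = 0" for y
  proof -
    let ?p = "\<Sum>\<gamma>\<in>B. monom (c \<gamma> * (\<Prod>i\<in>V. y i ^ \<gamma> i)) (\<gamma> v)"
    have "poly ?p s = 0" for s
    proof -
      have "poly ?p s = (\<Sum>\<gamma>\<in>B. c \<gamma> * (\<Prod>i\<in>insert v V. (y(v := s)) i ^ \<gamma> i))"
        unfolding poly_sum
      proof (rule sum.cong[OF refl])
        fix \<gamma>
        have "(\<Prod>i\<in>V. (y(v := s)) i ^ \<gamma> i) = (\<Prod>i\<in>V. y i ^ \<gamma> i)"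
          using insert by (intro prod.cong) auto
        then show "poly (monom (c \<gamma> * (\<Prod>i\<in>V. y i ^ \<gamma> i)) (\<gamma> v)) s = c \<gamma> * (\<Prod>i\<in>insert v V. (y(v := s)) i ^ \<gamma> i)"
          using insert by (simp add: poly_monom mult_ac)
      qed
      then show ?thesis using insert.prems(3) by metis
    qed
    then have "?p = 0" using poly_all_0_iff_0 by blast
    then have "coeff ?p ?e = 0" by simp
    moreover have "coeff ?p ?e = (\<Sum>\<gamma>\<in>B. if \<gamma> v = ?e then c \<gamma> * (\<Prod>i\<in>V. y i ^ \<gamma> i) else 0)"
      by (simp add: coeff_sum)
    ultimately show ?thesis using fin by (simp add: sum.inter_filter)
  qed
  \<comment> \<open>The induction hypothesis wants exponents supported in V, so the entry at v is
    reset to 0. This is injective on \<open>?B\<close>, where that entry is constant.\<close>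
  let ?g = "\<lambda>\<gamma> :: nat \<Rightarrow> nat. \<gamma>(v := 0)"
  have inj: "inj_on ?g ?B"
    by (rule inj_onI) (metis (mono_tags, lifting) fun_upd_triv fun_upd_upd mem_Collect_eq)
  have "c ((?g \<beta>)(v := ?e)) = 0"
  proof (rule insert.IH[where B = "?g ` ?B" and c = "\<lambda>\<gamma>. c (\<gamma>(v := ?e))" and \<beta> = "?g \<beta>"])
    show "finite (?g ` ?B)" using fin by simp
    show "\<forall>\<gamma>\<in>?g ` ?B. \<forall>i. i \<notin> V \<longrightarrow> \<gamma> i = 0" using insert.prems(2) by auto
    show "?g \<beta> \<in> ?g ` ?B" using insert.prems(4) by blast
    show "\<forall>y. (\<Sum>\<gamma>\<in>?g ` ?B. c (\<gamma>(v := ?e)) * (\<Prod>i\<in>V. y i ^ \<gamma> i)) = 0"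
    proof
      fix y
      have "(\<Sum>\<gamma>\<in>?g ` ?B. c (\<gamma>(v := ?e)) * (\<Prod>i\<in>V. y i ^ \<gamma> i)) =
          (\<Sum>\<gamma>\<in>?B. c ((?g \<gamma>)(v := ?e)) * (\<Prod>i\<in>V. y i ^ (?g \<gamma>) i))"
        by (simp add: sum.reindex[OF inj])
      also have "\<dots> = (\<Sum>\<gamma>\<in>?B. c \<gamma> * (\<Prod>i\<in>V. y i ^ \<gamma> i))"
      proof (rule sum.cong[OF refl])
        fix \<gamma> assume "\<gamma> \<in> ?B"
        then have "(?g \<gamma>)(v := ?e) = \<gamma>" by auto
        moreover have "(\<Prod>i\<in>V. y i ^ (?g \<gamma>) i) = (\<Prod>i\<in>V. y i ^ \<gamma> i)"
          using insert(2) by (intro prod.cong) auto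
        ultimately show "c ((?g \<gamma>)(v := ?e)) * (\<Prod>i\<in>V. y i ^ (?g \<gamma>) i) = c \<gamma> * (\<Prod>i\<in>V. y i ^ \<gamma> i)" by simp
      qed
      finally show "(\<Sum>\<gamma>\<in>?g ` ?B. c (\<gamma>(v := ?e)) * (\<Prod>i\<in>V. y i ^ \<gamma> i)) = 0" using zero by simp
    qed
  qed
  then show ?case by simp
qed

section \<open>Symmetric Laurent polynomials as polynomial functions\<close>

lemma keys_mult_cases:
  assumes "m \<in> Poly_Mapping.keys (f * g)"
  obtains a b where "m = a + b" "a \<in> Poly_Mapping.keys f" "b \<in> Poly_Mapping.keys g"
  using subsetD[OF keys_mult assms] that by auto

text \<open>
  The weight is the signed total exponent. The generator \<open>x\<^sub>i\<^sup>d + e x\<^sub>i\<^sup>-\<^sup>1\<close> has a unique term of maximal weight,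
  hence so has every monomial in the generators.
\<close>

definition weight :: "(nat \<Rightarrow>\<^sub>0 int) \<Rightarrow> int" where
  "weight m = (\<Sum>i\<in>Poly_Mapping.keys m. Poly_Mapping.lookup m i)"

definition lead :: "'k::comm_ring_1 laurent \<Rightarrow> (nat \<Rightarrow>\<^sub>0 int) \<Rightarrow> bool" where
  "lead f m \<longleftrightarrow> (\<exists>g. f = Poly_Mapping.single m 1 + g \<and> (\<forall>a\<in>Poly_Mapping.keys g. weight a < weight m))"

lemma weight_add: "weight (a + b) = weight a + weight b"
  unfolding weight_def by (rule setsum_keys_plus_distrib[where f = "\<lambda>_ v. v"]) auto

lemma weight_sum: "weight (\<Sum>a\<in>A. f a) = (\<Sum>a\<in>A. weight (f a))"
  by (induction A rule: infinite_finite_induct) (auto simp: weight_add, auto simp: weight_def)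

lemma weight_single [simp]: "weight (Poly_Mapping.single i v) = v"
  by (simp add: weight_def)

lemma weight_le_mdegree: "weight m \<le> int (mdegree m)"
  unfolding weight_def mdegree_def of_nat_sum by (rule sum_mono) simp

lemma lead_one: "lead 1 0"
  unfolding lead_def by (rule exI[of _ 0]) simp

lemma lead_mult:
  assumes "lead f a" "lead g b"
  shows "lead (f * g) (a + b)"
proof -
  obtain f' g' where f: "f = Poly_Mapping.single a 1 + f'" "\<forall>m\<in>Poly_Mapping.keys f'. weight m < weight a"
    and g: "g = Poly_Mapping.single b 1 + g'" "\<forall>m\<in>Poly_Mapping.keys g'. weight m < weight b"
    using assms by (auto simp: lead_def)
  let ?h = "Poly_Mapping.single a 1 * g' + f' * g"
  have "f * g = Poly_Mapping.single (a + b) 1 + ?h"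
    by (simp add: f(1) g(1) algebra_simps mult_single)
  moreover have "weight m < weight (a + b)" if "m \<in> Poly_Mapping.keys ?h" for m
  proof -
    have wg: "weight y \<le> weight b" if "y \<in> Poly_Mapping.keys g" for y
    proof -
      from that have "y \<in> Poly_Mapping.keys (Poly_Mapping.single b (1::'a)) \<union> Poly_Mapping.keys g'" unfolding g(1) using keys_add by (rule subsetD[rotated])
      then show ?thesis using g(2) by (auto split: if_splits)
    qed
    from that have "m \<in> Poly_Mapping.keys (Poly_Mapping.single a 1 * g') \<union> Poly_Mapping.keys (f' * g)" using keys_add by (rule subsetD[rotated])
    then show ?thesis
    proof
      assume "m \<in> Poly_Mapping.keys (Poly_Mapping.single a 1 * g')"
      then obtain x y where "m = x + y" "x \<in> Poly_Mapping.keys (Poly_Mapping.single a (1::'a))" "y \<in> Poly_Mapping.keys g'" by (rule keys_mult_cases)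
      then show ?thesis using g(2) by (auto simp: weight_add split: if_splits)
    next
      assume "m \<in> Poly_Mapping.keys (f' * g)"
      then obtain x y where "m = x + y" "x \<in> Poly_Mapping.keys f'" "y \<in> Poly_Mapping.keys g" by (rule keys_mult_cases)
      then show ?thesis using f(2) wg[of y] by (auto simp: weight_add intro!: add_less_le_mono)
    qed
  qed
  ultimately show ?thesis unfolding lead_def by blast
qed

lemma lookup_lead:
  assumes "lead f m" "weight m \<le> weight m'"
  shows "Poly_Mapping.lookup f m' = (if m' = m then 1 else 0)"
proof -
  obtain g where g: "f = Poly_Mapping.single m 1 + g" "\<forall>a\<in>Poly_Mapping.keys g. weight a < weight m" using assms by (auto simp: lead_def)
  then have "m' \<notin> Poly_Mapping.keys g" using assms by force
  then show ?thesis by (auto simp: g(1) lookup_add lookup_single when_def in_keys_iff)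
qed

section \<open>Closure properties of the generated algebras\<close>

lemma lookup_const_mult: "Poly_Mapping.lookup (Poly_Mapping.single 0 c * g) m = c * Poly_Mapping.lookup g m"
  unfolding mult_map_scale_conv_mult[symmetric] by (simp add: map.rep_eq when_def)

lemma coeff_hom_single: "coeff_hom (\<lambda>c. Poly_Mapping.single 0 c)"
  by (simp add: coeff_hom_def single_add mult_single)

lemma adjoin_sum: "(\<And>a. a \<in> A \<Longrightarrow> f a \<in> adjoin G) \<Longrightarrow> (\<Sum>a\<in>A. f a) \<in> adjoin G"
  by (induction A rule: infinite_finite_induct)
    (auto intro: adjoin.add, use adjoin.const[of 0] in auto)

lemma adjoin_one: "1 \<in> adjoin G"
  using adjoin.const[of 1] by simp

lemma adjoin_prod: "(\<And>a. a \<in> A \<Longrightarrow> f a \<in> adjoin G) \<Longrightarrow> (\<Prod>a\<in>A. f a) \<in> adjoin G"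
  by (induction A rule: infinite_finite_induct) (auto intro: adjoin.mult adjoin_one)

lemma adjoin_power: "f \<in> adjoin G \<Longrightarrow> f ^ k \<in> adjoin G"
  by (induction k) (auto intro: adjoin.mult adjoin_one)

lemma adjoin_diff: "f \<in> adjoin G \<Longrightarrow> g \<in> adjoin G \<Longrightarrow> f - g \<in> adjoin G"
proof -
  assume f: "f \<in> adjoin G" and g: "g \<in> adjoin G"
  have "f + Poly_Mapping.single 0 (- 1) * g \<in> adjoin G"
    by (intro adjoin.add adjoin.mult adjoin.const f g)
  moreover have "f + Poly_Mapping.single 0 (- 1) * g = f - g"
    by (rule poly_mapping_eqI) (simp add: lookup_add lookup_minus lookup_const_mult)
  ultimately show ?thesis by simp
qed

lemma symmetric_diff: "symmetric n f \<Longrightarrow> symmetric n g \<Longrightarrow> symmetric n (f - g :: 'k::ab_group_add laurent)"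
  by (simp add: symmetric_def lookup_minus)

lemma ldegree_diff: "ldegree f \<le> k \<Longrightarrow> ldegree g \<le> k \<Longrightarrow> ldegree (f - g :: 'k::ab_group_add laurent) \<le> k"
  unfolding ldegree_le_iff by (metis diff_zero in_keys_iff lookup_minus)

definition multi_power :: "(nat \<Rightarrow> 'r::comm_ring_1) \<Rightarrow> (nat \<Rightarrow>\<^sub>0 nat) \<Rightarrow> 'r" where
  "multi_power y \<beta> = (\<Prod>i\<in>Poly_Mapping.keys \<beta>. y i ^ Poly_Mapping.lookup \<beta> i)"

lemma multi_power_superset: "finite S \<Longrightarrow> Poly_Mapping.keys \<beta> \<subseteq> S \<Longrightarrow> multi_power y \<beta> = (\<Prod>i\<in>S. y i ^ Poly_Mapping.lookup \<beta> i)"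
  unfolding multi_power_def by (rule prod.mono_neutral_left) (auto simp: in_keys_iff)

lemma multi_power_add: "multi_power y (a + b) = multi_power y a * multi_power y b"
proof -
  let ?S = "Poly_Mapping.keys a \<union> Poly_Mapping.keys b"
  have "multi_power y (a + b) = (\<Prod>i\<in>?S. y i ^ Poly_Mapping.lookup (a + b) i)"
    using keys_add[of a b] by (intro multi_power_superset) auto
  then show ?thesis by (simp add: lookup_add power_add prod.distrib multi_power_superset[of ?S])
qed

text \<open>One shape for the four sets of generators: e = 0 with d = 1 for AJ and AM and d = 2 for
  BJ, and d = e = 1 for BM.\<close>

locale laurent_family =
  fixes F :: "'k::field_char_0 family" and d :: nat and e :: 'k
  assumes gen_F: "gen F = (\<lambda>i. Poly_Mapping.single (Poly_Mapping.single i (int d)) 1 + Poly_Mapping.single (Poly_Mapping.single i (- 1)) e)"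
    and d_pos: "0 < d" and dscale_F: "dscale F = d"
begin

definition val :: "'k \<Rightarrow> 'k" where
  "val x = x ^ d + e * inverse x"

text \<open>The points where evaluation is multiplicative on the algebra: negative exponents occur
  only for nonzero e, and must not meet a zero coordinate.\<close>

definition regular :: "nat \<Rightarrow> (nat \<Rightarrow> 'k) \<Rightarrow> bool" where
  "regular n x \<longleftrightarrow> (e \<noteq> 0 \<longrightarrow> (\<forall>i\<in>{1..n}. x i \<noteq> 0))"

text \<open>The exponent of the term of maximal weight in
  \<open>multi_power (gen F) \<beta>\<close>, see \<open>lead_multi_power\<close>.\<close>

definition pexp :: "(nat \<Rightarrow>\<^sub>0 nat) \<Rightarrow> (nat \<Rightarrow>\<^sub>0 int)" where
  "pexp \<beta> = (\<Sum>i\<in>Poly_Mapping.keys \<beta>. Poly_Mapping.single i (int d * int (Poly_Mapping.lookup \<beta> i)))"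

abbreviation expand :: "((nat \<Rightarrow>\<^sub>0 nat) \<Rightarrow>\<^sub>0 'k) \<Rightarrow> 'k laurent" where
  "expand P \<equiv> hom_eval (\<lambda>c. Poly_Mapping.single 0 c) (multi_power (gen F)) P"

lemma adjoin_neg_exponent:
  assumes "f \<in> adjoin (gen F ` {1..n})" "m \<in> Poly_Mapping.keys f" "Poly_Mapping.lookup m i < 0"
  shows "e \<noteq> 0 \<and> i \<in> {1..n}"
  using assms
proof (induction arbitrary: m rule: adjoin.induct)
  case (const c)
  then show ?case by (auto split: if_splits)
next
  case (gen g)
  then obtain j where j: "j \<in> {1..n}" "g = Poly_Mapping.single (Poly_Mapping.single j (int d)) 1 + Poly_Mapping.single (Poly_Mapping.single j (- 1)) e"
    by (auto simp: gen_F)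
  then have "m = Poly_Mapping.single j (int d) \<or> (m = Poly_Mapping.single j (- 1) \<and> e \<noteq> 0)"
    using gen.prems(1) keys_add[of "Poly_Mapping.single (Poly_Mapping.single j (int d)) (1::'k)" "Poly_Mapping.single (Poly_Mapping.single j (- 1)) e"]
    by (auto split: if_splits)
  then show ?case using gen.prems(2) j by (auto simp: lookup_single when_def split: if_splits)
next
  case (add f g)
  then show ?case using keys_add[of f g] by blast
next
  case (mult f g)
  from mult.prems(1) obtain a b where "m = a + b" "a \<in> Poly_Mapping.keys f" "b \<in> Poly_Mapping.keys g" by (rule keys_mult_cases)
  moreover from this mult.prems(2) have "Poly_Mapping.lookup a i < 0 \<or> Poly_Mapping.lookup b i < 0" by (auto simp: lookup_add)
  ultimately show ?case using mult.IH by blast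
qed

lemma leval_mult:
  assumes "f \<in> adjoin (gen F ` {1..n})" "g \<in> adjoin (gen F ` {1..n})" "regular n x"
  shows "leval (f * g) x = leval f x * leval g x"
  unfolding leval_eq_hom_eval
proof (rule hom_eval_mult[OF coeff_hom_id])
  have *: "0 \<le> Poly_Mapping.lookup m i" if "h \<in> adjoin (gen F ` {1..n})" "m \<in> Poly_Mapping.keys h" "x i = 0" for h m i
    using adjoin_neg_exponent[OF that(1,2), of i] that(3) assms(3) by (auto simp: regular_def not_less[symmetric])
  fix a b assume "a \<in> Poly_Mapping.keys f" "b \<in> Poly_Mapping.keys g"
  then show "mon x (a + b) = mon x a * mon x b"
    using * assms by (intro mon_add) blast+
qed

lemma leval_const: "leval (Poly_Mapping.single 0 c) x = c"
  by (simp add: leval_single)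

lemma leval_gen: "leval (gen F i) x = val (x i)"
  by (auto simp: gen_F leval_add leval_single mon_def val_def d_pos power_int_minus)

lemma leval_prod:
  assumes "\<And>a. a \<in> A \<Longrightarrow> f a \<in> adjoin (gen F ` {1..n})" "regular n x"
  shows "leval (\<Prod>a\<in>A. f a) x = (\<Prod>a\<in>A. leval (f a) x)"
  using assms
proof (induction A rule: infinite_finite_induct)
  case (insert a A)
  then have "leval (f a * (\<Prod>a\<in>A. f a)) x = leval (f a) x * leval (\<Prod>a\<in>A. f a) x"
    by (intro leval_mult adjoin_prod) auto
  then show ?case using insert by simp
qed (use leval_const[of 1] in auto)

lemma leval_power:
  assumes "f \<in> adjoin (gen F ` {1..n})" "regular n x"
  shows "leval (f ^ k) x = leval f x ^ k"
  using leval_prod[of "{..<k}" "\<lambda>_. f" n x] assms by simp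

lemma adjoin_eq_expand:
  assumes "f \<in> adjoin (gen F ` {1..n})"
  shows "\<exists>P. (\<forall>\<beta>\<in>Poly_Mapping.keys P. Poly_Mapping.keys \<beta> \<subseteq> {1..n}) \<and> f = expand P"
  using assms
proof (induction rule: adjoin.induct)
  case (const c)
  show ?case
    by (rule exI[of _ "Poly_Mapping.single 0 c"]) (simp add: hom_eval_single[OF coeff_hom_single] multi_power_def)
next
  case (gen g)
  then obtain j where "j \<in> {1..n}" "g = gen F j" by auto
  then show ?case
    by (intro exI[of _ "Poly_Mapping.single (Poly_Mapping.single j 1) 1"]) (simp add: hom_eval_single[OF coeff_hom_single] multi_power_def)
next
  case (add f g)
  then obtain P Q where "\<forall>\<beta>\<in>Poly_Mapping.keys P. Poly_Mapping.keys \<beta> \<subseteq> {1..n}" "f = expand P"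
    "\<forall>\<beta>\<in>Poly_Mapping.keys Q. Poly_Mapping.keys \<beta> \<subseteq> {1..n}" "g = expand Q" by blast
  then show ?case
    using keys_add[of P Q] by (intro exI[of _ "P + Q"]) (auto simp: hom_eval_add[OF coeff_hom_single])
next
  case (mult f g)
  then obtain P Q where PQ: "\<forall>\<beta>\<in>Poly_Mapping.keys P. Poly_Mapping.keys \<beta> \<subseteq> {1..n}" "f = expand P"
    "\<forall>\<beta>\<in>Poly_Mapping.keys Q. Poly_Mapping.keys \<beta> \<subseteq> {1..n}" "g = expand Q" by blast
  have "Poly_Mapping.keys \<beta> \<subseteq> {1..n}" if "\<beta> \<in> Poly_Mapping.keys (P * Q)" for \<beta>
  proof -
    from that obtain a b where "\<beta> = a + b" "a \<in> Poly_Mapping.keys P" "b \<in> Poly_Mapping.keys Q" by (rule keys_mult_cases)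
    then show ?thesis using PQ keys_add[of a b] by blast
  qed
  then show ?case
    using PQ by (intro exI[of _ "P * Q"]) (auto simp: hom_eval_mult[OF coeff_hom_single multi_power_add])
qed

lemma lookup_pexp: "Poly_Mapping.lookup (pexp \<beta>) i = int d * int (Poly_Mapping.lookup \<beta> i)"
  by (auto simp: pexp_def lookup_sum lookup_single when_def in_keys_iff)

lemma pexp_inject: "pexp a = pexp b \<longleftrightarrow> a = b"
  using d_pos by (auto simp: poly_mapping_eq_iff fun_eq_iff lookup_pexp)

lemma weight_pexp: "weight (pexp \<beta>) = int d * int (\<Sum>i\<in>Poly_Mapping.keys \<beta>. Poly_Mapping.lookup \<beta> i)"
  by (simp add: pexp_def weight_sum sum_distrib_left)

lemma lead_gen: "lead (gen F i) (Poly_Mapping.single i (int d))"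
  unfolding lead_def gen_F using d_pos by (intro exI[of _ "Poly_Mapping.single (Poly_Mapping.single i (- 1)) e"]) auto

lemma lead_multi_power: "lead (multi_power (gen F) \<beta>) (pexp \<beta>)"
proof -
  have pow: "lead (gen F i ^ k) (Poly_Mapping.single i (int d * int k))" for i k
  proof (induction k)
    case (Suc k)
    then show ?case using lead_mult[OF lead_gen Suc, of i] by (simp add: single_add[symmetric] algebra_simps)
  qed (simp add: lead_one)
  have "finite A \<Longrightarrow> lead (\<Prod>i\<in>A. gen F i ^ b i) (\<Sum>i\<in>A. Poly_Mapping.single i (int d * int (b i)))" for A b
    by (induction A rule: finite_induct) (auto simp: lead_one intro!: lead_mult pow)
  then show ?thesis by (simp add: multi_power_def pexp_def)
qed

text \<open>At maximal weight a monomial in the generators contributes at most its leading term, and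
  different \<beta> have different leading terms, so nothing cancels.\<close>

lemma lookup_expand_pexp:
  assumes "\<And>\<beta>. \<beta> \<in> Poly_Mapping.keys P \<Longrightarrow> weight (pexp \<beta>) \<le> weight (pexp \<alpha>)"
  shows "Poly_Mapping.lookup (expand P) (pexp \<alpha>) = Poly_Mapping.lookup P \<alpha>"
proof -
  have "Poly_Mapping.lookup (expand P) (pexp \<alpha>) = (\<Sum>\<beta>\<in>Poly_Mapping.keys P. Poly_Mapping.lookup P \<beta> * (if \<alpha> = \<beta> then 1 else 0))"
    unfolding hom_eval_def lookup_sum lookup_const_mult
    by (intro sum.cong refl) (simp add: lookup_lead[OF lead_multi_power assms] pexp_inject)
  also have "\<dots> = (\<Sum>\<beta>\<in>Poly_Mapping.keys P. if \<alpha> = \<beta> then Poly_Mapping.lookup P \<beta> else 0)"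
    by (intro sum.cong) auto
  also have "\<dots> = Poly_Mapping.lookup P \<alpha>" by (simp add: sum.delta' in_keys_iff)
  finally show ?thesis .
qed

text \<open>The leading term of an exponent of maximal weight survives in \<open>expand P\<close>,
  and weight is at most degree. So the degree bound on the Laurent polynomial bounds the degree of P
  in the generators.\<close>

lemma expand_degree:
  assumes "ldegree (expand P) \<le> d * k" "\<beta> \<in> Poly_Mapping.keys P"
  shows "(\<Sum>i\<in>Poly_Mapping.keys \<beta>. Poly_Mapping.lookup \<beta> i) \<le> k"
proof -
  let ?S = "(\<lambda>\<beta>. weight (pexp \<beta>)) ` Poly_Mapping.keys P"
  have "Max ?S \<in> ?S" using assms(2) by (intro Max_in) auto
  then obtain \<alpha> where \<alpha>: "\<alpha> \<in> Poly_Mapping.keys P" "weight (pexp \<alpha>) = Max ?S" by auto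
  then have max: "weight (pexp \<beta>) \<le> weight (pexp \<alpha>)" if "\<beta> \<in> Poly_Mapping.keys P" for \<beta> using that by auto
  have "pexp \<alpha> \<in> Poly_Mapping.keys (expand P)"
    using lookup_expand_pexp[OF max] \<alpha>(1) by (simp add: in_keys_iff)
  then have "weight (pexp \<alpha>) \<le> int (d * k)"
    using assms(1) weight_le_mdegree[of "pexp \<alpha>"] unfolding ldegree_le_iff by (meson of_nat_mono order_trans)
  with max[OF assms(2)] have "int d * int (\<Sum>i\<in>Poly_Mapping.keys \<beta>. Poly_Mapping.lookup \<beta> i) \<le> int d * int k"
    unfolding weight_pexp of_nat_mult by linarith
  then have "d * (\<Sum>i\<in>Poly_Mapping.keys \<beta>. Poly_Mapping.lookup \<beta> i) \<le> d * k" unfolding of_nat_mult[symmetric] of_nat_le_iff .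
  then show ?thesis using d_pos by simp
qed

text \<open>The passage from \<Lambda> to polynomial functions of the generators. The last clause is
  the way back, needed for uniqueness of the interpolation polynomials as formal objects.\<close>

lemma adjoin_polyfun:
  assumes "f \<in> adjoin (gen F ` {1..n})" "ldegree f \<le> d * k"
  shows "\<exists>g. polyfun {1..n} (int k) g \<and> (\<forall>x. regular n x \<longrightarrow> leval f x = g (\<lambda>i. val (x i))) \<and>
    ((\<forall>y. g y = 0) \<longrightarrow> f = 0)"
proof -
  obtain P where P: "\<And>\<beta>. \<beta> \<in> Poly_Mapping.keys P \<Longrightarrow> Poly_Mapping.keys \<beta> \<subseteq> {1..n}" and f: "f = expand P"
    using adjoin_eq_expand[OF assms(1)] by blast
  let ?g = "\<lambda>y. hom_eval (\<lambda>c. c) (multi_power y) P"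
  have "polyfun {1..n} (int k) ?g"
    unfolding hom_eval_def
  proof (intro polyfun_sum polyfun_cmult)
    fix \<beta> assume \<beta>: "\<beta> \<in> Poly_Mapping.keys P"
    have "(\<Sum>i\<in>Poly_Mapping.keys \<beta>. int (Poly_Mapping.lookup \<beta> i)) \<le> int k"
      using expand_degree[OF _ \<beta>, of k] assms(2) f by (simp flip: of_nat_sum)
    then show "polyfun {1..n} (int k) (\<lambda>y. multi_power y \<beta>)"
      unfolding multi_power_def using P[OF \<beta>]
      by (intro polyfun_prod[where d = "\<lambda>i. int (Poly_Mapping.lookup \<beta> i)"] polyfun_power[where d = 1] polyfun.var) auto
  qed
  moreover have "leval f x = ?g (\<lambda>i. val (x i))" if x: "regular n x" for x
  proof -
    have adj: "gen F i ^ k \<in> adjoin (gen F ` {1..n})" if "i \<in> {1..n}" for i k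
      using that by (intro adjoin_power adjoin.gen) auto
    have "leval f x = (\<Sum>\<beta>\<in>Poly_Mapping.keys P. leval (Poly_Mapping.single 0 (Poly_Mapping.lookup P \<beta>) * multi_power (gen F) \<beta>) x)"
      by (simp add: f hom_eval_def leval_sum)
    also have "\<dots> = (\<Sum>\<beta>\<in>Poly_Mapping.keys P. Poly_Mapping.lookup P \<beta> * multi_power (\<lambda>i. val (x i)) \<beta>)"
    proof (rule sum.cong[OF refl])
      fix \<beta> assume \<beta>: "\<beta> \<in> Poly_Mapping.keys P"
      have "leval (multi_power (gen F) \<beta>) x = (\<Prod>i\<in>Poly_Mapping.keys \<beta>. leval (gen F i ^ Poly_Mapping.lookup \<beta> i) x)"
        unfolding multi_power_def by (rule leval_prod[OF _ x]) (use P[OF \<beta>] adj in blast)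
      also have "\<dots> = multi_power (\<lambda>i. val (x i)) \<beta>"
        unfolding multi_power_def
      proof (rule prod.cong[OF refl])
        fix i assume "i \<in> Poly_Mapping.keys \<beta>"
        then have "gen F i \<in> adjoin (gen F ` {1..n})" using P[OF \<beta>] by (intro adjoin.gen) auto
        then show "leval (gen F i ^ Poly_Mapping.lookup \<beta> i) x = val (x i) ^ Poly_Mapping.lookup \<beta> i"
          using leval_power[OF _ x] by (simp add: leval_gen)
      qed
      finally have "leval (multi_power (gen F) \<beta>) x = multi_power (\<lambda>i. val (x i)) \<beta>" .
      moreover have "multi_power (gen F) \<beta> \<in> adjoin (gen F ` {1..n})"
        unfolding multi_power_def using P[OF \<beta>] by (intro adjoin_prod adj) auto
      ultimately show "leval (Poly_Mapping.single 0 (Poly_Mapping.lookup P \<beta>) * multi_power (gen F) \<beta>) x = Poly_Mapping.lookup P \<beta> * multi_power (\<lambda>i. val (x i)) \<beta>"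
        using leval_mult[OF adjoin.const _ x] by (simp add: leval_const)
    qed
    finally show ?thesis by (simp add: hom_eval_def)
  qed
  moreover have "f = 0" if g: "\<forall>y. ?g y = 0"
  proof -
    have "Poly_Mapping.lookup P \<beta> = 0" if \<beta>: "\<beta> \<in> Poly_Mapping.keys P" for \<beta>
    proof -
      have inj: "inj_on Poly_Mapping.lookup (Poly_Mapping.keys P)" by (rule inj_onI) (simp only: lookup_inject)
      \<comment> \<open>\<open>sum_monomials_eq_0\<close> takes exponents as plain functions, so P
        is transported along the injection \<open>Poly_Mapping.lookup\<close>.\<close>
      have "Poly_Mapping.lookup P (Abs_poly_mapping (Poly_Mapping.lookup \<beta>)) = 0"
      proof (rule sum_monomials_eq_0[of "{1..n}" "Poly_Mapping.lookup ` Poly_Mapping.keys P" "\<lambda>\<gamma>. Poly_Mapping.lookup P (Abs_poly_mapping \<gamma>)" "Poly_Mapping.lookup \<beta>"])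
        show "\<forall>\<gamma>\<in>Poly_Mapping.lookup ` Poly_Mapping.keys P. \<forall>i. i \<notin> {1..n} \<longrightarrow> \<gamma> i = 0"
          using P by (fastforce simp: in_keys_iff)
        show "\<forall>y. (\<Sum>\<gamma>\<in>Poly_Mapping.lookup ` Poly_Mapping.keys P. Poly_Mapping.lookup P (Abs_poly_mapping \<gamma>) * (\<Prod>i\<in>{1..n}. y i ^ \<gamma> i)) = 0"
        proof
          fix y :: "nat \<Rightarrow> 'k"
          have "(\<Sum>\<gamma>\<in>Poly_Mapping.lookup ` Poly_Mapping.keys P. Poly_Mapping.lookup P (Abs_poly_mapping \<gamma>) * (\<Prod>i\<in>{1..n}. y i ^ \<gamma> i)) =
            (\<Sum>\<gamma>\<in>Poly_Mapping.keys P. Poly_Mapping.lookup P \<gamma> * (\<Prod>i\<in>{1..n}. y i ^ Poly_Mapping.lookup \<gamma> i))"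
            by (simp add: sum.reindex[OF inj] lookup_inverse)
          also have "\<dots> = ?g y"
            unfolding hom_eval_def using P by (intro sum.cong refl) (simp add: multi_power_superset[of "{1..n}"])
          finally show "(\<Sum>\<gamma>\<in>Poly_Mapping.lookup ` Poly_Mapping.keys P. Poly_Mapping.lookup P (Abs_poly_mapping \<gamma>) * (\<Prod>i\<in>{1..n}. y i ^ \<gamma> i)) = 0"
            using g by simp
        qed
      qed (use \<beta> in auto)
      then show ?thesis by (simp add: lookup_inverse)
    qed
    then have "P = 0" by (intro poly_mapping_eqI) (metis in_keys_iff lookup_zero)
    then show ?thesis by (simp add: f hom_eval_def)
  qed
  ultimately show ?thesis by blast
qed

lemma act_gen: "p permutes {1..n} \<Longrightarrow> act p (gen F i) = gen F (p i)"
proof -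
  assume p: "p permutes {1..n}"
  have "Poly_Mapping.map_key (inv p) (Poly_Mapping.single i v) = Poly_Mapping.single (p i) v" for v :: int
    using map_key_single[OF permutes_inj[OF permutes_inv[OF p]], of "p i" v]
    by (simp add: permutes_inverses[OF p])
  then show ?thesis
    by (simp add: gen_F act_add act_single permutes_bij[OF p])
qed

lemma esym_permute:
  assumes "p permutes {1..n}"
  shows "esym n j (\<lambda>i. y (p i)) = esym n j y"
proof -
  have inj: "inj p" and p: "p ` {1..n} = {1..n}"
    using assms by (auto simp: permutes_inj permutes_image)
  have "esym n j (\<lambda>i. y (p i)) = (\<Sum>S | S \<subseteq> {1..n} \<and> card S = j. \<Prod>i\<in>p ` S. y i)"
    unfolding esym_def using inj by (simp add: prod.reindex inj_on_subset)
  also have "\<dots> = esym n j y"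
    unfolding esym_def
  proof (rule sum.reindex_bij_witness[of _ "image (inv p)" "image p"])
    fix S assume S: "S \<in> {S. S \<subseteq> {1..n} \<and> card S = j}"
    then show "p ` S \<in> {S. S \<subseteq> {1..n} \<and> card S = j}"
      using p inj by (auto simp: card_image inj_on_subset)
    have "inv p ` {1..n} = {1..n}" by (rule permutes_image[OF permutes_inv[OF assms]])
    then show "inv p ` S \<in> {S. S \<subseteq> {1..n} \<and> card S = j}"
      using S permutes_inj[OF permutes_inv[OF assms]] by (auto simp: card_image inj_on_subset)
    show "p ` inv p ` S = S" "inv p ` p ` S = S"
      using assms by (auto simp: image_image permutes_inverses)
  qed simp
  finally show ?thesis .
qed

text \<open>Substituting the generators into the expression gives the element of \<Lambda>:
  permutations of the variables permute the generators, and each generator has degree at most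
  d.\<close>

lemma esfun_realized:
  assumes "esfun n k f"
  shows "\<exists>L\<in>Lam F n. ldegree L \<le> d * k \<and> (\<forall>x. regular n x \<longrightarrow> leval L x = f (\<lambda>i. val (x i)))"
  using assms
proof (induction rule: esfun.induct)
  case (const k c)
  show ?case
    by (rule bexI[of _ "Poly_Mapping.single 0 c"])
      (auto simp: ldegree_const leval_const Lam_def symmetric_iff_act act_const permutes_bij intro: adjoin.const)
next
  case (gen j k)
  have adj: "gen F i \<in> adjoin (gen F ` {1..n})" if "i \<in> {1..n}" for i
    using that by (intro adjoin.gen) auto
  have "symmetric n (esym n j (gen F))"
    unfolding symmetric_iff_act
  proof (intro allI impI)
    fix p assume p: "p permutes {1..n}"
    have "act p (esym n j (gen F)) = esym n j (\<lambda>i. gen F (p i))"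
      unfolding esym_def by (simp add: act_sum act_prod act_gen[OF p] permutes_bij[OF p])
    then show "act p (esym n j (gen F)) = esym n j (gen F)"
      by (simp add: esym_permute[OF p])
  qed
  moreover have "esym n j (gen F) \<in> adjoin (gen F ` {1..n})"
    unfolding esym_def by (intro adjoin_sum adjoin_prod adj) auto
  moreover have "ldegree (esym n j (gen F)) \<le> d * k"
    unfolding esym_def
  proof (rule ldegree_sum)
    fix S assume S: "S \<in> {S. S \<subseteq> {1..n} \<and> card S = j}"
    have "ldegree (gen F i) \<le> d" for i
      unfolding gen_F using d_pos by (intro ldegree_add) (auto simp: ldegree_le_iff mdegree_def)
    then have "ldegree (\<Prod>i\<in>S. gen F i) \<le> d * card S" by (rule ldegree_prod)
    also have "\<dots> \<le> d * k" using S gen by simp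
    finally show "ldegree (\<Prod>i\<in>S. gen F i) \<le> d * k" .
  qed
  moreover have "leval (esym n j (gen F)) x = esym n j (\<lambda>i. val (x i))" if x: "regular n x" for x
    unfolding esym_def leval_sum
  proof (rule sum.cong[OF refl])
    fix S assume "S \<in> {S. S \<subseteq> {1..n} \<and> card S = j}"
    then have "leval (\<Prod>i\<in>S. gen F i) x = (\<Prod>i\<in>S. leval (gen F i) x)"
      by (intro leval_prod[OF _ x]) (use adj in blast)
    then show "leval (\<Prod>i\<in>S. gen F i) x = (\<Prod>i\<in>S. val (x i))" by (simp add: leval_gen)
  qed
  ultimately show ?case by (intro bexI[of _ "esym n j (gen F)"]) (auto simp: Lam_def)
next
  case (add k f g)
  from add.IH(1) obtain L where L: "L \<in> Lam F n"
    "ldegree L \<le> d * k \<and> (\<forall>x. regular n x \<longrightarrow> leval L x = f (\<lambda>i. val (x i)))" by (rule bexE)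
  from add.IH(2) obtain M where M: "M \<in> Lam F n"
    "ldegree M \<le> d * k \<and> (\<forall>x. regular n x \<longrightarrow> leval M x = g (\<lambda>i. val (x i)))" by (rule bexE)
  note LM = L(1) conjunct1[OF L(2)] conjunct2[OF L(2), rule_format] M(1) conjunct1[OF M(2)] conjunct2[OF M(2), rule_format]
  have "L + M \<in> Lam F n" using LM(1,4) by (auto simp: Lam_def symmetric_iff_act act_add permutes_bij intro: adjoin.add)
  then show ?case
    by (intro bexI[of _ "L + M"] conjI ldegree_add LM(2,5) allI impI) (simp_all add: leval_add LM(3,6))
next
  case (mult j f k g)
  from mult.IH(1) obtain L where L: "L \<in> Lam F n"
    "ldegree L \<le> d * j \<and> (\<forall>x. regular n x \<longrightarrow> leval L x = f (\<lambda>i. val (x i)))" by (rule bexE)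
  from mult.IH(2) obtain M where M: "M \<in> Lam F n"
    "ldegree M \<le> d * k \<and> (\<forall>x. regular n x \<longrightarrow> leval M x = g (\<lambda>i. val (x i)))" by (rule bexE)
  note LM = L(1) conjunct1[OF L(2)] conjunct2[OF L(2), rule_format] M(1) conjunct1[OF M(2)] conjunct2[OF M(2), rule_format]
  have "L * M \<in> Lam F n" using LM(1,4) by (auto simp: Lam_def symmetric_iff_act act_mult permutes_bij intro: adjoin.mult)
  moreover have "leval (L * M) x = f (\<lambda>i. val (x i)) * g (\<lambda>i. val (x i))" if "regular n x" for x
    using leval_mult[of L n M x] LM(1,4) that by (simp add: Lam_def LM(3,6))
  ultimately show ?case using ldegree_mult[OF LM(2,5)]
    by (intro bexI[of _ "L * M"]) (simp_all add: distrib_left)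
qed

end

section \<open>Unitriangular matrices\<close>

lemma finite_Parts_le: "finite {k \<in> Parts n. psize n k \<le> K}"
proof (rule finite_subset)
  show "{k \<in> Parts n. psize n k \<le> K} \<subseteq> {k. \<forall>i. (i \<in> {1..n} \<longrightarrow> k i \<in> {..K}) \<and> (i \<notin> {1..n} \<longrightarrow> k i = 0)}"
  proof (intro subsetI CollectI allI conjI impI)
    fix k i assume k: "k \<in> {k \<in> Parts n. psize n k \<le> K}"
    show "k i \<in> {..K}" if "i \<in> {1..n}"
    proof -
      have "k i \<le> psize n k" unfolding psize_def by (rule member_le_sum) (use that in auto)
      then show ?thesis using k by simp
    qed
    show "k i = 0" if "i \<notin> {1..n}" using k that by (auto simp: Parts_def)
  qed
  show "finite {k. \<forall>i. (i \<in> {1..n} \<longrightarrow> k i \<in> {..K}) \<and> (i \<notin> {1..n} \<longrightarrow> k i = (0::nat))}"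
    by (rule finite_set_of_finite_funs) auto
qed

lemma finite_Parts_less: "finite {k \<in> Parts n. psize n k < K}"
  by (rule finite_subset[OF _ finite_Parts_le[of n K]]) auto

definition lower_mtx :: "nat \<Rightarrow> 'k::field mtx \<Rightarrow> bool" where
  "lower_mtx n X \<longleftrightarrow> (\<forall>l\<in>Parts n. \<forall>k\<in>Parts n. psize n l < psize n k \<longrightarrow> X l k = 0)"

definition unitri :: "nat \<Rightarrow> 'k::field mtx \<Rightarrow> bool" where
  "unitri n X \<longleftrightarrow> (\<forall>l\<in>Parts n. X l l = 1) \<and> vanishing n X"

lemma unitri_lower: "unitri n X \<Longrightarrow> lower_mtx n X"
  unfolding unitri_def lower_mtx_def vanishing_def by (metis less_imp_le less_irrefl)

lemma unitri_cong: "unitri n X \<Longrightarrow> mtx_eq n X Y \<Longrightarrow> unitri n Y"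
  unfolding unitri_def vanishing_def mtx_eq_def by metis

text \<open>Replaces the range of nonzero terms by a finite set independent of the entries, so that
  sums can be split and interchanged. The freedom in K lets different rows share one range.\<close>

lemma mtx_mult_lower:
  assumes "lower_mtx n X" "l \<in> Parts n" "psize n l \<le> K"
  shows "mtx_mult n X Y l m = (\<Sum>k\<in>{k \<in> Parts n. psize n k \<le> K}. X l k * Y k m)"
  unfolding mtx_mult_def
proof (rule sum.mono_neutral_left)
  show "{k \<in> Parts n. X l k * Y k m \<noteq> 0} \<subseteq> {k \<in> Parts n. psize n k \<le> K}"
  proof (intro subsetI CollectI conjI)
    fix k assume k: "k \<in> {k \<in> Parts n. X l k * Y k m \<noteq> 0}"
    then show "k \<in> Parts n" by simp
    have "X l k \<noteq> 0" using k by auto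
    then have "\<not> psize n l < psize n k" using assms k by (auto simp: lower_mtx_def)
    then show "psize n k \<le> K" using assms(3) by simp
  qed
qed (use finite_Parts_le in auto)

lemma mtx_mult_cong:
  assumes "mtx_eq n X X'" "mtx_eq n Y Y'" "l \<in> Parts n" "m \<in> Parts n"
  shows "mtx_mult n X Y l m = mtx_mult n X' Y' l m"
  unfolding mtx_mult_def by (rule sum.cong) (use assms in \<open>auto simp: mtx_eq_def\<close>)

lemma lower_mtx_mult:
  assumes X: "lower_mtx n X" and Y: "lower_mtx n Y"
  shows "lower_mtx n (mtx_mult n X Y)"
  unfolding lower_mtx_def
proof (intro ballI impI)
  fix l m assume lm: "l \<in> Parts n" "m \<in> Parts n" "psize n l < psize n m"
  show "mtx_mult n X Y l m = 0"
    unfolding mtx_mult_lower[OF X lm(1) order_refl]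
    by (rule sum.neutral) (use Y lm in \<open>auto simp: lower_mtx_def\<close>)
qed

lemma mtx_mult_assoc:
  assumes X: "lower_mtx n X" and Y: "lower_mtx n Y" and l: "l \<in> Parts n"
  shows "mtx_mult n (mtx_mult n X Y) W l m = mtx_mult n X (mtx_mult n Y W) l m"
proof -
  let ?P = "{k \<in> Parts n. psize n k \<le> psize n l}"
  have "mtx_mult n (mtx_mult n X Y) W l m = (\<Sum>j\<in>?P. (\<Sum>k\<in>?P. X l k * Y k j) * W j m)"
    by (simp add: mtx_mult_lower[OF lower_mtx_mult[OF X Y] l order_refl] mtx_mult_lower[OF X l order_refl])
  also have "\<dots> = (\<Sum>k\<in>?P. X l k * (\<Sum>j\<in>?P. Y k j * W j m))"
    unfolding sum_distrib_left sum_distrib_right mult.assoc by (rule sum.swap)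
  also have "\<dots> = (\<Sum>k\<in>?P. X l k * mtx_mult n Y W k m)"
    by (intro sum.cong refl) (simp add: mtx_mult_lower[OF Y, where K = "psize n l"])
  also have "\<dots> = mtx_mult n X (mtx_mult n Y W) l m"
    by (simp add: mtx_mult_lower[OF X l order_refl])
  finally show ?thesis .
qed

lemma mtx_mult_one_right:
  assumes "m \<in> Parts n"
  shows "mtx_mult n X mtx_one l m = X l m"
proof -
  have "{k \<in> Parts n. X l k * mtx_one k m \<noteq> 0} = (if X l m = 0 then {} else {m})"
    using assms by (auto simp: mtx_one_def)
  then show ?thesis by (auto simp: mtx_mult_def mtx_one_def)
qed

lemma mtx_mult_one_left:
  assumes "l \<in> Parts n"
  shows "mtx_mult n mtx_one Y l m = Y l m"
proof -
  have "{k \<in> Parts n. mtx_one l k * Y k m \<noteq> 0} = (if Y l m = 0 then {} else {l})"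
    using assms by (auto simp: mtx_one_def)
  then show ?thesis by (auto simp: mtx_mult_def mtx_one_def)
qed

text \<open>Forward substitution in X R = 1, by increasing size of the row index.\<close>

function right_inv :: "nat \<Rightarrow> 'k::field mtx \<Rightarrow> 'k mtx" where
  "right_inv n X l m = (if l = m then 1 else
     - (\<Sum>k\<in>{k \<in> Parts n. psize n k < psize n l}. X l k * right_inv n X k m))"
  by pat_completeness auto
termination by (relation "measure (\<lambda>(n, X, l, m). psize n l)") auto

declare right_inv.simps [simp del]

lemma unitri_right_inv: "unitri n (right_inv n X)"
proof -
  have "psize n l \<le> psize n m \<Longrightarrow> l \<noteq> m \<Longrightarrow> right_inv n X l m = 0" for l m
  proof (induction "psize n l" arbitrary: l rule: less_induct)
    case less
    have "(\<Sum>k\<in>{k \<in> Parts n. psize n k < psize n l}. X l k * right_inv n X k m) = 0"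
    proof (intro sum.neutral ballI)
      fix k assume "k \<in> {k \<in> Parts n. psize n k < psize n l}"
      then have "k \<noteq> m" "psize n k < psize n l" using less.prems(1) by auto
      then have "right_inv n X k m = 0" using less.hyps[of k] less.prems(1) by simp
      then show "X l k * right_inv n X k m = 0" by simp
    qed
    then show ?case using less.prems by (subst right_inv.simps) simp
  qed
  then show ?thesis by (auto simp: unitri_def vanishing_def right_inv.simps[of n X l l for l])
qed

lemma mtx_mult_right_inv:
  assumes X: "unitri n X"
  shows "mtx_eq n (mtx_mult n X (right_inv n X)) mtx_one"
  unfolding mtx_eq_def
proof (intro ballI)
  fix l m assume l: "l \<in> Parts n" and m: "m \<in> Parts n"
  let ?R = "right_inv n X" and ?L = "{k \<in> Parts n. psize n k < psize n l}"
  have "mtx_mult n X ?R l m = (\<Sum>k\<in>{k \<in> Parts n. psize n k \<le> psize n l}. X l k * ?R k m)"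
    by (rule mtx_mult_lower[OF unitri_lower[OF X] l order_refl])
  also have "\<dots> = (\<Sum>k\<in>insert l ?L. X l k * ?R k m)"
  proof (rule sum.mono_neutral_right)
    show "\<forall>k\<in>{k \<in> Parts n. psize n k \<le> psize n l} - insert l ?L. X l k * ?R k m = 0"
    proof
      fix k assume "k \<in> {k \<in> Parts n. psize n k \<le> psize n l} - insert l ?L"
      then have "X l k = 0" using X l by (auto simp: unitri_def vanishing_def not_less)
      then show "X l k * ?R k m = 0" by simp
    qed
  qed (use l finite_Parts_le in auto)
  also have "\<dots> = ?R l m + (\<Sum>k\<in>?L. X l k * ?R k m)"
    using X l by (simp add: finite_Parts_less unitri_def)
  also have "\<dots> = mtx_one l m"
  proof (cases "l = m")
    case True
    have "(\<Sum>k\<in>?L. X l k * ?R k m) = 0"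
    proof (intro sum.neutral ballI)
      fix k assume "k \<in> ?L"
      then have "k \<in> Parts n" "psize n k \<le> psize n m" "k \<noteq> m" using True by auto
      then have "?R k m = 0" using unitri_right_inv[of n X] m by (simp add: unitri_def vanishing_def)
      then show "X l k * ?R k m = 0" by simp
    qed
    then show ?thesis using True by (simp add: mtx_one_def right_inv.simps[of n X m m])
  qed (simp add: mtx_one_def right_inv.simps[of n X l m])
  finally show "mtx_mult n X ?R l m = mtx_one l m" .
qed

text \<open>The right inverse R of X is unitriangular, so it has a right inverse S itself. Then X =
  X (R S) = (X R) S = S, so R X = 1, and any Y with X Y = 1 equals R.\<close>

lemma right_inverse_eq:
  assumes X: "unitri n X" and Y: "mtx_eq n (mtx_mult n X Y) mtx_one"
  shows "mtx_eq n Y (right_inv n X)"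
    and "mtx_eq n (mtx_mult n (right_inv n X) X) mtx_one"
proof -
  let ?R = "right_inv n X"
  let ?S = "right_inv n ?R"
  note R = unitri_right_inv[of n X]
  have refl: "mtx_eq n Z Z" for Z :: "'a mtx" by (simp add: mtx_eq_def)
  have XS: "mtx_eq n X ?S"
    unfolding mtx_eq_def
  proof (intro ballI)
    fix l m assume l: "l \<in> Parts n" and m: "m \<in> Parts n"
    have "X l m = mtx_mult n X (mtx_mult n ?R ?S) l m"
      using mtx_mult_cong[OF refl mtx_mult_right_inv[OF R] l m] by (simp add: mtx_mult_one_right[OF m])
    also have "\<dots> = mtx_mult n (mtx_mult n X ?R) ?S l m"
      by (rule mtx_mult_assoc[OF unitri_lower[OF X] unitri_lower[OF R] l, symmetric])
    also have "\<dots> = ?S l m"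
      using mtx_mult_cong[OF mtx_mult_right_inv[OF X] refl l m] by (simp add: mtx_mult_one_left[OF l])
    finally show "X l m = ?S l m" .
  qed
  show RX: "mtx_eq n (mtx_mult n ?R X) mtx_one"
    using mtx_mult_cong[OF refl XS] mtx_mult_right_inv[OF R] by (simp add: mtx_eq_def)
  show "mtx_eq n Y ?R"
    unfolding mtx_eq_def
  proof (intro ballI)
    fix l m assume l: "l \<in> Parts n" and m: "m \<in> Parts n"
    have "Y l m = mtx_mult n (mtx_mult n ?R X) Y l m"
      using mtx_mult_cong[OF RX refl l m] by (simp add: mtx_mult_one_left[OF l])
    also have "\<dots> = mtx_mult n ?R (mtx_mult n X Y) l m"
      by (rule mtx_mult_assoc[OF unitri_lower[OF R] unitri_lower[OF X] l])
    also have "\<dots> = ?R l m"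
      using mtx_mult_cong[OF refl Y l m] by (simp add: mtx_mult_one_right[OF m])
    finally show "Y l m = ?R l m" .
  qed
qed

lemma mtx_inv_unitri:
  assumes X: "unitri n X"
  shows "unitri n (mtx_inv n X)" "mtx_eq n (mtx_mult n X (mtx_inv n X)) mtx_one"
    "mtx_eq n (mtx_mult n (mtx_inv n X) X) mtx_one"
proof -
  let ?R = "right_inv n X"
  \<comment> \<open>Set to zero outside the partitions, as \<open>mtx_inv\<close>
    prescribes.\<close>
  let ?Y = "\<lambda>l m. if l \<in> Parts n \<and> m \<in> Parts n then ?R l m else 0"
  have YR: "mtx_eq n ?R ?Y" and refl: "mtx_eq n Z Z" for Z :: "'a mtx" by (auto simp: mtx_eq_def)
  have "mtx_eq n (mtx_mult n X ?Y) mtx_one" "mtx_eq n (mtx_mult n ?Y X) mtx_one"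
    using mtx_mult_right_inv[OF X] right_inverse_eq(2)[OF X mtx_mult_right_inv[OF X]]
      mtx_mult_cong[OF refl YR] mtx_mult_cong[OF YR refl] by (simp_all add: mtx_eq_def)
  moreover have "Z = ?Y" if "\<forall>l m. l \<notin> Parts n \<or> m \<notin> Parts n \<longrightarrow> Z l m = 0"
    "mtx_eq n (mtx_mult n X Z) mtx_one" for Z
    using right_inverse_eq(1)[OF X that(2)] that(1) by (intro ext) (auto simp: mtx_eq_def)
  ultimately have "mtx_inv n X = ?Y" unfolding mtx_inv_def by (intro the_equality) auto
  then show "unitri n (mtx_inv n X)" "mtx_eq n (mtx_mult n X (mtx_inv n X)) mtx_one"
    "mtx_eq n (mtx_mult n (mtx_inv n X) X) mtx_one"
    using \<open>mtx_eq n (mtx_mult n X ?Y) mtx_one\<close> \<open>mtx_eq n (mtx_mult n ?Y X) mtx_one\<close>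
      unitri_cong[OF unitri_right_inv YR] by simp_all
qed

section \<open>The recursions\<close>

lemma psize_strict_mono:
  assumes "l \<in> Parts n" "m \<in> Parts n" "contains n l m" "m \<noteq> l"
  shows "psize n m < psize n l"
proof -
  obtain i where i: "m i \<noteq> l i" using assms(4) by blast
  then have "i \<in> {1..n}" using assms(1,2) unfolding Parts_def by fastforce
  moreover from this have "m i < l i" using i assms(3) by (meson contains_def le_neq_implies_less)
  ultimately show ?thesis
    unfolding psize_def using assms(3) by (intro sum_strict_mono_ex1) (auto simp: contains_def)
qed

text \<open>\<open>val_shift\<close> identifies the shifted partitions with the grid c, which
  belongs to the class N closed under lowering. \<open>separated\<close> permits division by
  differences of norms, whence uniqueness in the recursions.\<close>

locale interpolation_family = laurent_family F d e
  for F :: "'k::field_char_0 family" and d :: nat and e :: 'k +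
  fixes n :: nat and N :: "(nat \<Rightarrow> nat \<Rightarrow> 'k) set" and c :: "nat \<Rightarrow> nat \<Rightarrow> 'k"
  assumes N: "lowerable N" and c_N: "c \<in> N" and inj_c: "inj (\<lambda>(m, j). c m j)"
    and val_shift: "\<And>l i. val (shift F n l i) = c (l i) (n - i)"
    and shift_nonzero: "\<And>l i. e \<noteq> 0 \<Longrightarrow> shift F n l i \<noteq> 0"
    and nrm_eq: "\<And>x. nrm F n x = (\<Sum>i=1..n. val (x i))"
    and separated: "\<And>l m. l \<in> Parts n \<Longrightarrow> m \<in> Parts n \<Longrightarrow> psize n m < psize n l \<Longrightarrow> znorm F n l \<noteq> znorm F n m"
begin

lemma inj_c': "inj (\<lambda>m. c m j)"
  using inj_c by (auto simp: inj_def)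

lemma znorm_eq: "znorm F n l = (\<Sum>i=1..n. grid_point c n l i)"
  by (simp add: znorm_def nrm_eq val_shift grid_point_def)

text \<open>Once the size of l exceeds k, the degree is smaller than the size, so
  \<open>extra_vanishing\<close> carries the zeros from smaller partitions to l.\<close>

lemma symfun_vanishing:
  assumes f: "polyfun {1..n} (int k) f" "symfun n f"
    and van: "\<And>l. l \<in> Parts n \<Longrightarrow> psize n l \<le> k \<Longrightarrow> f (grid_point c n l) = 0"
  shows "l \<in> Parts n \<Longrightarrow> f (grid_point c n l) = 0"
proof (induction "psize n l" arbitrary: l rule: less_induct)
  case less
  show ?case
  proof (cases "psize n l \<le> k")
    case False
    show ?thesis
    proof (rule extra_vanishing[OF N c_N less.prems f])
      fix m assume m: "m \<in> Parts n" "contains n l m" "m \<noteq> l"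
      have "psize n m < psize n l" by (rule psize_strict_mono[OF less.prems m])
      then show "f (grid_point c n m) = 0" using less.hyps m(1) by blast
    qed (use False in simp)
  qed (use van less.prems in simp)
qed

lemma regular_shift: "regular n (shift F n l)"
  using shift_nonzero by (simp add: regular_def)

lemma Lam_polyfun:
  assumes "f \<in> Lam F n" "ldegree f \<le> d * k"
  shows "\<exists>g. polyfun {1..n} (int k) g \<and> symfun n g \<and>
    (\<forall>l. leval f (shift F n l) = g (grid_point c n l)) \<and> ((\<forall>y. g y = 0) \<longrightarrow> f = 0)"
proof -
  have f: "f \<in> adjoin (gen F ` {1..n})" "symmetric n f" using assms(1) by (auto simp: Lam_def)
  obtain g where g: "polyfun {1..n} (int k) g" and fg: "\<And>x. regular n x \<Longrightarrow> leval f x = g (\<lambda>i. val (x i))"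
    and zero: "(\<forall>y. g y = 0) \<longrightarrow> f = 0"
    using adjoin_polyfun[OF f(1) assms(2)] by blast
  have eval: "leval f (shift F n l) = g (grid_point c n l)" for l
    unfolding fg[OF regular_shift]
    by (rule polyfun_cong[OF g]) (simp add: val_shift grid_point_def)
  \<comment> \<open>g comes from some expression of f in the generators, so its symmetry is checked
    at grid points, through the values of the symmetric f, and extended by density.\<close>
  have "g (y \<circ> Transposition.transpose i j) = g y" if ij: "i \<in> {1..n}" "j \<in> {1..n}" for i j y
  proof -
    let ?t = "Transposition.transpose i j"
    have "g (y \<circ> ?t) - g y = 0"
    proof (rule grid_dense[where f = "\<lambda>y. g (y \<circ> ?t) - g y" and c = c and k = "int k" and n = n])
      show "polyfun {1..n} (int k) (\<lambda>y. g (y \<circ> ?t) - g y)"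
        by (intro polyfun_diff polyfun_transpose g ij)
      fix l
      have "regular n (shift F n l \<circ> ?t)" using shift_nonzero by (simp add: regular_def)
      then have "leval f (shift F n l \<circ> ?t) = g (\<lambda>a. val ((shift F n l \<circ> ?t) a))" by (rule fg)
      also have "\<dots> = g (grid_point c n l \<circ> ?t)"
      proof (rule polyfun_cong[OF g])
        fix a assume "a \<in> {1..n}"
        then have "?t a \<in> {1..n}" using ij by (auto simp: Transposition.transpose_def)
        then show "val ((shift F n l \<circ> ?t) a) = (grid_point c n l \<circ> ?t) a"
          by (simp add: val_shift grid_point_def)
      qed
      finally show "g (grid_point c n l \<circ> ?t) - g (grid_point c n l) = 0"
        using leval_transpose[OF f(2) ij, of "shift F n l"] eval[of l] by simp
    qed (rule inj_c')
    then show ?thesis by simp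
  qed
  then have "symfun n g" by (simp add: symfun_def)
  then show ?thesis using g eval zero by blast
qed

text \<open>Justifies the \<open>THE\<close> in \<open>hpoly\<close>. For uniqueness the difference
  of two candidates vanishes first at sizes up to that of m, then at all partitions, then
  everywhere, and finally as a Laurent polynomial.\<close>

lemma hpoly_unique_exists:
  assumes m: "m \<in> Parts n"
  shows "\<exists>!f. f \<in> Lam F n \<and> ldegree f \<le> dscale F * psize n m \<and>
     (\<forall>l\<in>Parts n. psize n l \<le> psize n m \<longrightarrow> leval f (shift F n l) = (if l = m then 1 else 0))"
  unfolding dscale_F
proof (rule ex_ex1I)
  obtain f where f: "esfun n (psize n m) f" and
    fv: "\<And>l. l \<in> Parts n \<Longrightarrow> psize n l \<le> psize n m \<Longrightarrow> f (grid_point c n l) = (if l = m then 1 else 0)"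
    using interpolation_exists[OF inj_c, of n "psize n m" "\<lambda>l. if l = m then 1 else 0"] by blast
  obtain L where L: "L \<in> Lam F n" "ldegree L \<le> d * psize n m" and
    Lv: "\<And>x. regular n x \<Longrightarrow> leval L x = f (\<lambda>i. val (x i))" using esfun_realized[OF f] by blast
  have "leval L (shift F n l) = f (grid_point c n l)" for l
    unfolding Lv[OF regular_shift] by (rule esfun_cong[OF f]) (simp add: val_shift grid_point_def)
  then show "\<exists>f. f \<in> Lam F n \<and> ldegree f \<le> d * psize n m \<and>
     (\<forall>l\<in>Parts n. psize n l \<le> psize n m \<longrightarrow> leval f (shift F n l) = (if l = m then 1 else 0))"
    using L fv by (intro exI[of _ L]) simp
next
  fix f g
  assume f: "f \<in> Lam F n \<and> ldegree f \<le> d * psize n m \<and>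
     (\<forall>l\<in>Parts n. psize n l \<le> psize n m \<longrightarrow> leval f (shift F n l) = (if l = m then 1 else 0))"
    and g: "g \<in> Lam F n \<and> ldegree g \<le> d * psize n m \<and>
     (\<forall>l\<in>Parts n. psize n l \<le> psize n m \<longrightarrow> leval g (shift F n l) = (if l = m then 1 else 0))"
  have "f - g \<in> Lam F n" "ldegree (f - g) \<le> d * psize n m"
    using f g by (auto simp: Lam_def intro: adjoin_diff symmetric_diff ldegree_diff)
  from Lam_polyfun[OF this] obtain h where h: "polyfun {1..n} (int (psize n m)) h" "symfun n h" and
    hv: "\<And>l. leval (f - g) (shift F n l) = h (grid_point c n l)" and zero: "(\<forall>y. h y = 0) \<longrightarrow> f - g = 0" by blast
  have "h (grid_point c n l) = 0" if l: "l \<in> Parts n" "psize n l \<le> psize n m" for l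
    using leval_add[of "f - g" g "shift F n l"] f g l hv[of l] by (auto split: if_splits)
  then have "h (grid_point c n l) = 0" if "l \<in> Parts n" for l
    using symfun_vanishing[OF h] that by blast
  then have "h y = 0" for y by (rule grid_dense[OF h(1) inj_c'])
  then show "f = g" using zero by simp
qed

lemma binom_polyfun:
  assumes m: "m \<in> Parts n"
  obtains g where "polyfun {1..n} (int (psize n m)) g" "symfun n g"
    "\<And>l. binom F n l m = g (grid_point c n l)"
    "\<And>l. l \<in> Parts n \<Longrightarrow> psize n l \<le> psize n m \<Longrightarrow> binom F n l m = (if l = m then 1 else 0)"
proof -
  have h: "hpoly F n m \<in> Lam F n \<and> ldegree (hpoly F n m) \<le> dscale F * psize n m \<and>
     (\<forall>l\<in>Parts n. psize n l \<le> psize n m \<longrightarrow> leval (hpoly F n m) (shift F n l) = (if l = m then 1 else 0))"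
    unfolding hpoly_def by (rule theI'[OF hpoly_unique_exists[OF m]])
  obtain g where "polyfun {1..n} (int (psize n m)) g" "symfun n g"
    "\<And>l. leval (hpoly F n m) (shift F n l) = g (grid_point c n l)"
    using Lam_polyfun[of "hpoly F n m" "psize n m"] h by (auto simp: dscale_F)
  then show ?thesis using h that by (simp add: binom_def)
qed

lemma binom_le:
  assumes "l \<in> Parts n" "m \<in> Parts n" "psize n l \<le> psize n m"
  shows "binom F n l m = (if l = m then 1 else 0)"
  using binom_polyfun[OF assms(2)] assms by metis

lemma unitri_binom: "unitri n (binom F n)"
  by (auto simp: unitri_def vanishing_def binom_le)

text \<open>The partitions properly inside l have size at most that of m and differ from m. So the
  interpolation polynomial of m vanishes at all of them, and its degree in the generators is below
  the size of l.\<close>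

lemma binom_not_contains:
  assumes l: "l \<in> Parts n" and m: "m \<in> Parts n" and size: "psize n l = psize n m + 1"
    and "\<not> contains n l m"
  shows "binom F n l m = 0"
proof -
  obtain g where g: "polyfun {1..n} (int (psize n m)) g" "symfun n g" and gv: "\<And>l. binom F n l m = g (grid_point c n l)"
    using binom_polyfun[OF m] by metis
  show ?thesis unfolding gv
  proof (rule extra_vanishing[OF N c_N l g])
    fix k assume k: "k \<in> Parts n" "contains n l k" "k \<noteq> l"
    show "g (grid_point c n k) = 0"
    proof -
      have "psize n k \<le> psize n m" using psize_strict_mono[OF l k] size by simp
      then show ?thesis using binom_le[OF k(1) m] k(2) assms(4) gv[of k] by auto
    qed
  qed (use size in simp)
qed

lemma binom_identity:
  assumes l: "l \<in> Parts n" and m: "m \<in> Parts n"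
  shows "(znorm F n l - znorm F n m) * binom F n l m =
    (\<Sum>k | k \<in> Parts n \<and> covers n k m. binom F n l k * (znorm F n k - znorm F n m) * adj F n k m)"
proof -
  let ?C = "{k \<in> Parts n. psize n k = psize n m + 1}"
  let ?z = "znorm F n"
  have fin: "finite ?C" by (rule finite_subset[OF _ finite_Parts_le[of n "psize n m + 1"]]) auto
  obtain g where g: "polyfun {1..n} (int (psize n m)) g" "symfun n g" and gv: "\<And>l. binom F n l m = g (grid_point c n l)"
    using binom_polyfun[OF m] by metis
  have "\<forall>k\<in>?C. \<exists>h. polyfun {1..n} (int (psize n m + 1)) h \<and> symfun n h \<and> (\<forall>l. binom F n l k = h (grid_point c n l))"
  proof
    fix k assume "k \<in> ?C"
    then have k: "k \<in> Parts n" "psize n k = psize n m + 1" by auto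
    obtain h where "polyfun {1..n} (int (psize n k)) h" "symfun n h" "\<And>l. binom F n l k = h (grid_point c n l)"
      using binom_polyfun[OF k(1)] by metis
    then show "\<exists>h. polyfun {1..n} (int (psize n m + 1)) h \<and> symfun n h \<and> (\<forall>l. binom F n l k = h (grid_point c n l))"
      using k(2) by auto
  qed
  from bchoice[OF this] obtain h where H: "\<forall>k\<in>?C. polyfun {1..n} (int (psize n m + 1)) (h k) \<and> symfun n (h k) \<and>
    (\<forall>l. binom F n l k = h k (grid_point c n l))" by (rule exE)
  have h: "\<And>k. k \<in> ?C \<Longrightarrow> polyfun {1..n} (int (psize n m + 1)) (h k)"
    "\<And>k. k \<in> ?C \<Longrightarrow> symfun n (h k)" and hv: "\<And>k l. k \<in> ?C \<Longrightarrow> binom F n l k = h k (grid_point c n l)"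
    using bspec[OF H] by simp_all
  \<comment> \<open>The coefficient of \<open>h k\<close> is the value at k of the first product,
    which makes G vanish at all sizes up to \<open>psize n m + 1\<close>, its degree bound. The sum
    takes every k of the next size; \<open>binom_not_contains\<close> discards those not containing
    m at the end.\<close>
  define G where "G y = ((\<Sum>i=1..n. y i) - ?z m) * g y - (\<Sum>k\<in>?C. ((?z k - ?z m) * binom F n k m) * h k y)" for y
  have G: "G (grid_point c n l) = (?z l - ?z m) * binom F n l m - (\<Sum>k\<in>?C. ((?z k - ?z m) * binom F n k m) * binom F n l k)" for l
    unfolding G_def gv[of l, symmetric] znorm_eq[of l, symmetric] using hv by simp
  have "G (grid_point c n l) = 0"
  proof (rule symfun_vanishing[OF _ _ _ l])
    show "polyfun {1..n} (int (psize n m + 1)) G"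
      unfolding G_def
    proof (intro polyfun_diff polyfun_sum polyfun_cmult h)
      have "polyfun {1..n} 1 (\<lambda>y. (\<Sum>i=1..n. y i) - ?z m)"
        by (intro polyfun_diff polyfun_sum polyfun.var polyfun.const) auto
      from polyfun_mult'[OF this g(1)]
      show "polyfun {1..n} (int (psize n m + 1)) (\<lambda>y. ((\<Sum>i=1..n. y i) - ?z m) * g y)" by simp
    qed
    show "symfun n G"
      unfolding symfun_def
    proof (intro ballI allI)
      fix i j and y :: "nat \<Rightarrow> 'k" assume ij: "i \<in> {1..n}" "j \<in> {1..n}"
      have "(\<Sum>a=1..n. (y \<circ> Transposition.transpose i j) a) = (\<Sum>a=1..n. y a)"
        using sum.permute[OF permutes_swap_id[OF ij], of y] by simp
      moreover have "(\<Sum>k\<in>?C. ((?z k - ?z m) * binom F n k m) * h k (y \<circ> Transposition.transpose i j)) =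
          (\<Sum>k\<in>?C. ((?z k - ?z m) * binom F n k m) * h k y)"
        by (rule sum.cong[OF refl]) (use h(2) ij in \<open>simp add: symfun_def\<close>)
      moreover have "g (y \<circ> Transposition.transpose i j) = g y" using g(2) ij by (simp add: symfun_def)
      ultimately show "G (y \<circ> Transposition.transpose i j) = G y" by (simp only: G_def)
    qed
    fix l assume l: "l \<in> Parts n" "psize n l \<le> psize n m + 1"
    have sum: "(\<Sum>k\<in>?C. ((?z k - ?z m) * binom F n k m) * binom F n l k) =
        (\<Sum>k\<in>?C. if l = k then (?z k - ?z m) * binom F n k m else 0)"
      by (intro sum.cong refl) (use l binom_le in auto)
    show "G (grid_point c n l) = 0"
    proof (cases "psize n l \<le> psize n m")
      case True
      then have "l \<notin> ?C" by simp
      then show ?thesis unfolding G sum using True binom_le[OF l(1) m] fin by (auto simp: sum.delta')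
    next
      case False
      then have "l \<in> ?C" using l by simp
      then show ?thesis unfolding G sum using fin by (simp add: sum.delta')
    qed
  qed
  then have "(?z l - ?z m) * binom F n l m = (\<Sum>k\<in>?C. ((?z k - ?z m) * binom F n k m) * binom F n l k)"
    unfolding G by simp
  also have "\<dots> = (\<Sum>k\<in>{k. k \<in> Parts n \<and> covers n k m}. ((?z k - ?z m) * binom F n k m) * binom F n l k)"
    by (rule sum.mono_neutral_right) (use fin binom_not_contains m in \<open>auto simp: covers_def\<close>)
  also have "\<dots> = (\<Sum>k\<in>{k. k \<in> Parts n \<and> covers n k m}. binom F n l k * (?z k - ?z m) * adj F n k m)"
    by (rule sum.cong[OF refl]) (simp add: adj_def mult_ac)
  finally show ?thesis .
qed

section \<open>The commutator identities\<close>

lemma comm_Z: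
  assumes "l \<in> Parts n" "m \<in> Parts n"
  shows "mtx_comm n (zmtx F n) X l m = (znorm F n l - znorm F n m) * X l m"
proof -
  have "{k \<in> Parts n. zmtx F n l k * X k m \<noteq> 0} = (if znorm F n l * X l m = 0 then {} else {l})"
    using assms by (auto simp: zmtx_def)
  then have 1: "mtx_mult n (zmtx F n) X l m = znorm F n l * X l m"
    by (auto simp: mtx_mult_def zmtx_def)
  have "{k \<in> Parts n. X l k * zmtx F n k m \<noteq> 0} = (if X l m * znorm F n m = 0 then {} else {m})"
    using assms by (auto simp: zmtx_def)
  then have 2: "mtx_mult n X (zmtx F n) l m = X l m * znorm F n m"
    by (auto simp: mtx_mult_def zmtx_def)
  show ?thesis by (simp add: mtx_comm_def 1 2 algebra_simps)
qed

abbreviation CA :: "'k mtx" where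
  "CA \<equiv> mtx_comm n (zmtx F n) (adj F n)"

lemma CA_eq: "l \<in> Parts n \<Longrightarrow> m \<in> Parts n \<Longrightarrow> CA l m = (znorm F n l - znorm F n m) * adj F n l m"
  by (rule comm_Z)

lemma lower_CA: "lower_mtx n CA"
  by (auto simp: lower_mtx_def CA_eq adj_def covers_def)

lemma comm_binom:
  "mtx_eq n (mtx_comm n (zmtx F n) (binom F n)) (mtx_mult n (binom F n) CA)"
  unfolding mtx_eq_def
proof (intro ballI)
  fix l m assume l: "l \<in> Parts n" and m: "m \<in> Parts n"
  let ?K = "psize n l + psize n m + 1"
  have "mtx_mult n (binom F n) CA l m = (\<Sum>k\<in>{k \<in> Parts n. psize n k \<le> ?K}. binom F n l k * CA k m)"
    by (rule mtx_mult_lower[OF unitri_lower[OF unitri_binom] l]) simp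
  also have "\<dots> = (\<Sum>k\<in>{k \<in> Parts n. psize n k \<le> ?K}. binom F n l k * (znorm F n k - znorm F n m) * adj F n k m)"
    by (rule sum.cong[OF refl]) (simp add: CA_eq m)
  also have "\<dots> = (\<Sum>k | k \<in> Parts n \<and> covers n k m. binom F n l k * (znorm F n k - znorm F n m) * adj F n k m)"
    by (rule sum.mono_neutral_right) (use finite_Parts_le in \<open>auto simp: covers_def adj_def\<close>)
  finally show "mtx_comm n (zmtx F n) (binom F n) l m = mtx_mult n (binom F n) CA l m"
    by (simp add: comm_Z[OF l m] binom_identity[OF l m])
qed

lemma unitri_inv_binom: "unitri n (inv_binom F n)"
  and binom_inv_binom: "mtx_eq n (mtx_mult n (binom F n) (inv_binom F n)) mtx_one"
  and inv_binom_binom: "mtx_eq n (mtx_mult n (inv_binom F n) (binom F n)) mtx_one"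
  unfolding inv_binom_def by (rule mtx_inv_unitri[OF unitri_binom])+

text \<open>Commutation with Z is a derivation. Let R be the inverse of B and S = [Z,R] + [Z,A] R.
  Then B S = B [Z,R] + [Z,B] R = [Z, B R] = [Z,1] = 0, and multiplication by R on the left gives S =
  0.\<close>

lemma comm_inv_binom:
  "mtx_eq n (mtx_comm n (zmtx F n) (inv_binom F n)) (\<lambda>l m. - mtx_mult n CA (inv_binom F n) l m)"
proof -
  let ?B = "binom F n" and ?R = "inv_binom F n" and ?z = "znorm F n"
  let ?D = "mtx_comm n (zmtx F n) ?R"
  let ?S = "\<lambda>l m. ?D l m + mtx_mult n CA ?R l m"
  note B = unitri_lower[OF unitri_binom] and R = unitri_lower[OF unitri_inv_binom]
  have rfl: "mtx_eq n Z Z" for Z :: "'k mtx" by (simp add: mtx_eq_def)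
  have BS: "mtx_mult n ?B ?S l m = 0" if l: "l \<in> Parts n" and m: "m \<in> Parts n" for l m
  proof -
    let ?P = "{k \<in> Parts n. psize n k \<le> psize n l}"
    have one: "(\<Sum>k\<in>?P. ?B l k * ?R k m) = mtx_one l m"
      using binom_inv_binom l m by (simp add: mtx_mult_lower[OF B l order_refl, symmetric] mtx_eq_def)
    have "mtx_mult n ?B ?S l m = (\<Sum>k\<in>?P. ?B l k * ?D k m) + (\<Sum>k\<in>?P. ?B l k * mtx_mult n CA ?R k m)"
      by (simp add: mtx_mult_lower[OF B l order_refl] distrib_left sum.distrib)
    also have "(\<Sum>k\<in>?P. ?B l k * ?D k m) = (\<Sum>k\<in>?P. ?B l k * ((?z k - ?z m) * ?R k m))"
      by (rule sum.cong[OF refl]) (simp add: comm_Z m)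
    also have "(\<Sum>k\<in>?P. ?B l k * mtx_mult n CA ?R k m) = mtx_mult n (mtx_mult n ?B CA) ?R l m"
      by (simp add: mtx_mult_assoc[OF B lower_CA l] mtx_mult_lower[OF B l order_refl])
    also have "\<dots> = mtx_mult n (mtx_comm n (zmtx F n) ?B) ?R l m"
      by (rule mtx_mult_cong[OF comm_binom rfl l m, symmetric])
    also have "\<dots> = (\<Sum>k\<in>?P. ((?z l - ?z k) * ?B l k) * ?R k m)"
    proof -
      have "lower_mtx n (mtx_comm n (zmtx F n) ?B)"
        using B by (auto simp: lower_mtx_def comm_Z)
      from mtx_mult_lower[OF this l order_refl] show ?thesis
        by (simp add: comm_Z l)
    qed
    also have "(\<Sum>k\<in>?P. ?B l k * ((?z k - ?z m) * ?R k m)) + (\<Sum>k\<in>?P. ((?z l - ?z k) * ?B l k) * ?R k m) =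
        (\<Sum>k\<in>?P. (?z l - ?z m) * (?B l k * ?R k m))"
      unfolding sum.distrib[symmetric] by (rule sum.cong[OF refl]) (simp add: algebra_simps)
    also have "\<dots> = (?z l - ?z m) * mtx_one l m" by (simp only: sum_distrib_left[symmetric] one)
    finally show ?thesis by (simp add: mtx_one_def)
  qed
  have "?S l m = 0" if l: "l \<in> Parts n" and m: "m \<in> Parts n" for l m
  proof -
    have "?S l m = mtx_mult n (mtx_mult n ?R ?B) ?S l m"
      using mtx_mult_cong[OF inv_binom_binom rfl l m, of ?S] by (simp add: mtx_mult_one_left[OF l])
    also have "\<dots> = mtx_mult n ?R (mtx_mult n ?B ?S) l m" by (rule mtx_mult_assoc[OF R B l])
    also have "\<dots> = 0" unfolding mtx_mult_def[of n ?R] by (rule sum.neutral) (use BS m in auto)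
    finally show ?thesis .
  qed
  then show ?thesis by (simp add: mtx_eq_def eq_neg_iff_add_eq_0)
qed

lemma inv_binom_identity:
  assumes l: "l \<in> Parts n" and m: "m \<in> Parts n"
  shows "(znorm F n l - znorm F n m) * inv_binom F n l m =
    (\<Sum>k | k \<in> Parts n \<and> covers n l k. adj F n l k * (znorm F n k - znorm F n l) * inv_binom F n k m)"
proof -
  let ?P = "{k \<in> Parts n. psize n k \<le> psize n l}"
  have "(znorm F n l - znorm F n m) * inv_binom F n l m = - mtx_mult n CA (inv_binom F n) l m"
    using comm_inv_binom l m by (simp add: mtx_eq_def comm_Z)
  also have "\<dots> = (\<Sum>k\<in>?P. - (CA l k * inv_binom F n k m))"
    by (simp add: mtx_mult_lower[OF lower_CA l order_refl] sum_negf)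
  also have "\<dots> = (\<Sum>k\<in>?P. adj F n l k * (znorm F n k - znorm F n l) * inv_binom F n k m)"
    by (rule sum.cong[OF refl]) (simp add: CA_eq l algebra_simps)
  also have "\<dots> = (\<Sum>k | k \<in> Parts n \<and> covers n l k. adj F n l k * (znorm F n k - znorm F n l) * inv_binom F n k m)"
    by (rule sum.mono_neutral_right) (use finite_Parts_le in \<open>auto simp: covers_def adj_def\<close>)
  finally show ?thesis .
qed

section \<open>Uniqueness of the solutions of the recursions\<close>

lemma binom_characterization:
  "vanishing n b \<and> binom_recursion F n b \<longleftrightarrow> mtx_eq n b (binom F n)"
proof
  assume b: "vanishing n b \<and> binom_recursion F n b"
  have "b l m = binom F n l m" if "l \<in> Parts n" "m \<in> Parts n" for l m
    using that
  \<comment> \<open>The row l stays fixed; the recursion refers to columns one box larger than m, so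
    the gap in size shrinks.\<close>
  proof (induction "psize n l - psize n m" arbitrary: m rule: less_induct)
    case less
    note l = less.prems(1) and m = less.prems(2)
    show ?case
    proof (cases "psize n l \<le> psize n m")
      case True
      then have "b l m = (if l = m then 1 else 0)"
        using b l m by (auto simp: vanishing_def binom_recursion_def)
      then show ?thesis using binom_le[OF l m True] by simp
    next
      case False
      then have "(znorm F n l - znorm F n m) * b l m =
          (\<Sum>k | k \<in> Parts n \<and> covers n k m. b l k * (znorm F n k - znorm F n m) * adj F n k m)"
        using b l m by (simp add: binom_recursion_def)
      also have "\<dots> = (\<Sum>k | k \<in> Parts n \<and> covers n k m. binom F n l k * (znorm F n k - znorm F n m) * adj F n k m)"
      proof (rule sum.cong[OF refl])
        fix k assume "k \<in> {k. k \<in> Parts n \<and> covers n k m}"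
        then have k: "k \<in> Parts n" "psize n k = psize n m + 1" by (auto simp: covers_def)
        then have "b l k = binom F n l k" using less.hyps[of k] l False by simp
        then show "b l k * (znorm F n k - znorm F n m) * adj F n k m =
          binom F n l k * (znorm F n k - znorm F n m) * adj F n k m" by simp
      qed
      also have "\<dots> = (znorm F n l - znorm F n m) * binom F n l m" by (rule binom_identity[OF l m, symmetric])
      finally show ?thesis using separated[OF l m] False by simp
    qed
  qed
  then show "mtx_eq n b (binom F n)" by (simp add: mtx_eq_def)
next
  assume eq: "mtx_eq n b (binom F n)"
  then have "unitri n b" using unitri_cong[OF unitri_binom] by (auto simp: mtx_eq_def)
  moreover have "binom_recursion F n b"
    unfolding binom_recursion_def
  proof (intro conjI ballI impI)
    show "b l l = 1" if "l \<in> Parts n" for l using \<open>unitri n b\<close> that by (simp add: unitri_def)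
    fix l m assume lm: "l \<in> Parts n" "m \<in> Parts n"
    have "(\<Sum>k | k \<in> Parts n \<and> covers n k m. b l k * (znorm F n k - znorm F n m) * adj F n k m) =
      (\<Sum>k | k \<in> Parts n \<and> covers n k m. binom F n l k * (znorm F n k - znorm F n m) * adj F n k m)"
      using eq lm by (intro sum.cong) (auto simp: mtx_eq_def)
    then show "(znorm F n l - znorm F n m) * b l m =
      (\<Sum>k | k \<in> Parts n \<and> covers n k m. b l k * (znorm F n k - znorm F n m) * adj F n k m)"
      using binom_identity[OF lm] eq lm by (simp add: mtx_eq_def)
  qed
  ultimately show "vanishing n b \<and> binom_recursion F n b" by (simp add: unitri_def)
qed

lemma inv_binom_characterization:
  "vanishing n b \<and> inv_binom_recursion F n b \<longleftrightarrow> mtx_eq n b (inv_binom F n)"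
proof
  assume b: "vanishing n b \<and> inv_binom_recursion F n b"
  have "b l m = inv_binom F n l m" if "l \<in> Parts n" "m \<in> Parts n" for l m
    using that
  \<comment> \<open>Here the column m stays fixed, and the recursion refers to rows one box smaller
    than l.\<close>
  proof (induction "psize n l" arbitrary: l rule: less_induct)
    case less
    note l = less.prems(1) and m = less.prems(2)
    show ?case
    proof (cases "psize n l \<le> psize n m")
      case True
      then have "b l m = (if l = m then 1 else 0)"
        using b l m by (auto simp: vanishing_def inv_binom_recursion_def)
      moreover have "inv_binom F n l m = (if l = m then 1 else 0)"
        using unitri_inv_binom True l m by (auto simp: unitri_def vanishing_def)
      ultimately show ?thesis by simp
    next
      case False
      then have "(znorm F n l - znorm F n m) * b l m =
          (\<Sum>k | k \<in> Parts n \<and> covers n l k. adj F n l k * (znorm F n k - znorm F n l) * b k m)"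
        using b l m by (simp add: inv_binom_recursion_def)
      also have "\<dots> = (\<Sum>k | k \<in> Parts n \<and> covers n l k. adj F n l k * (znorm F n k - znorm F n l) * inv_binom F n k m)"
      proof (rule sum.cong[OF refl])
        fix k assume "k \<in> {k. k \<in> Parts n \<and> covers n l k}"
        then have k: "k \<in> Parts n" "psize n l = psize n k + 1" by (auto simp: covers_def)
        then have "b k m = inv_binom F n k m" using less.hyps[of k] m by simp
        then show "adj F n l k * (znorm F n k - znorm F n l) * b k m =
          adj F n l k * (znorm F n k - znorm F n l) * inv_binom F n k m" by simp
      qed
      also have "\<dots> = (znorm F n l - znorm F n m) * inv_binom F n l m" by (rule inv_binom_identity[OF l m, symmetric])
      finally show ?thesis using separated[OF l m] False by simp
    qed
  qed
  then show "mtx_eq n b (inv_binom F n)" by (simp add: mtx_eq_def)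
next
  assume eq: "mtx_eq n b (inv_binom F n)"
  then have "unitri n b" using unitri_cong[OF unitri_inv_binom] by (auto simp: mtx_eq_def)
  moreover have "inv_binom_recursion F n b"
    unfolding inv_binom_recursion_def
  proof (intro conjI ballI impI)
    show "b l l = 1" if "l \<in> Parts n" for l using \<open>unitri n b\<close> that by (simp add: unitri_def)
    fix l m assume lm: "l \<in> Parts n" "m \<in> Parts n"
    have "(\<Sum>k | k \<in> Parts n \<and> covers n l k. adj F n l k * (znorm F n k - znorm F n l) * b k m) =
      (\<Sum>k | k \<in> Parts n \<and> covers n l k. adj F n l k * (znorm F n k - znorm F n l) * inv_binom F n k m)"
      using eq lm by (intro sum.cong) (auto simp: mtx_eq_def)
    then show "(znorm F n l - znorm F n m) * b l m =
      (\<Sum>k | k \<in> Parts n \<and> covers n l k. adj F n l k * (znorm F n k - znorm F n l) * b k m)"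
      using inv_binom_identity[OF lm] eq lm by (simp add: mtx_eq_def)
  qed
  ultimately show "vanishing n b \<and> inv_binom_recursion F n b" by (simp add: unitri_def)
qed

lemma recursions:
  "(\<forall>b. vanishing n b \<and> binom_recursion F n b \<longleftrightarrow> mtx_eq n b (binom F n)) \<and>
   (\<forall>b. vanishing n b \<and> inv_binom_recursion F n b \<longleftrightarrow> mtx_eq n b (inv_binom F n)) \<and>
   mtx_eq n (mtx_comm n (zmtx F n) (binom F n)) (mtx_mult n (binom F n) CA) \<and>
   mtx_eq n (mtx_comm n (zmtx F n) (inv_binom F n)) (\<lambda>l m. - mtx_mult n CA (inv_binom F n) l m)"
  using binom_characterization inv_binom_characterization comm_binom comm_inv_binom by blast

end

section \<open>The Jack grids\<close>

definition jack :: "'k::field_char_0 \<Rightarrow> 'k \<Rightarrow> 'k \<Rightarrow> 'k \<Rightarrow> nat \<Rightarrow> nat \<Rightarrow> 'k" where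
  "jack \<tau> \<gamma> \<delta> s m j = \<gamma> * (s + of_nat m + of_nat j * \<tau>)\<^sup>2 + \<delta> * (s + of_nat m + of_nat j * \<tau>)"

text \<open>For x and y of the form s + m + j \<tau>, the grid values differ by (\<gamma> (x + y) +
  \<delta>)(x - y). The second condition keeps the first factor nonzero; its range of a and b is
  wide enough to persist when \<delta> grows by \<gamma> or s by \<tau>.\<close>

definition jack_generic :: "'k::field_char_0 \<Rightarrow> 'k \<Rightarrow> 'k \<Rightarrow> 'k \<Rightarrow> bool" where
  "jack_generic \<tau> \<gamma> \<delta> s \<longleftrightarrow> inj (\<lambda>(m, j). of_nat m + of_nat j * \<tau>) \<and>
    (\<forall>a b. \<gamma> * (2 * s + of_nat a + of_nat b * \<tau>) + \<delta> \<noteq> 0)"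

text \<open>The grid of \<open>AJ\<close> has \<open>\<gamma> = 0\<close> and \<open>\<delta> = 1\<close>, that of \<open>BJ\<close> has \<open>\<gamma> = 1\<close> and \<open>\<delta> = 0\<close>; lowering replaces \<open>\<delta>\<close> by \<open>\<delta> + \<gamma>\<close>.\<close>

definition jacks :: "'k::field_char_0 \<Rightarrow> 'k \<Rightarrow> (nat \<Rightarrow> nat \<Rightarrow> 'k) set" where
  "jacks \<tau> \<gamma> = {jack \<tau> \<gamma> \<delta> s | \<delta> s. jack_generic \<tau> \<gamma> \<delta> s}"

text \<open>Used with a = b = 0 for the grid itself, and with a = b = 1 for the upper auxiliary
  nodes.\<close>

lemma jack_generic_nodes_inj:
  assumes "jack_generic \<tau> \<gamma> \<delta> s"
    and "(\<gamma> * (x + y + of_nat a + of_nat b * \<tau>) + \<delta>) * (x - y) = 0"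
    and "x = s + of_nat m + of_nat j * \<tau>" "y = s + of_nat m' + of_nat j' * \<tau>"
  shows "m = m' \<and> j = j'"
proof -
  have "\<gamma> * (x + y + of_nat a + of_nat b * \<tau>) + \<delta> =
      \<gamma> * (2 * s + of_nat (m + m' + a) + of_nat (j + j' + b) * \<tau>) + \<delta>"
    using assms(3,4) by (simp add: algebra_simps)
  also have "\<dots> \<noteq> 0" using assms(1) unfolding jack_generic_def by blast
  finally have "x = y" using assms(2) by simp
  then have "of_nat m + of_nat j * \<tau> = of_nat m' + of_nat j' * \<tau>" using assms(3,4) by (simp add: add.assoc)
  then show ?thesis using assms(1) unfolding jack_generic_def inj_def by auto
qed

lemma inj_jack:
  assumes "jack_generic \<tau> \<gamma> \<delta> s"
  shows "inj (\<lambda>(m, j). jack \<tau> \<gamma> \<delta> s m j)"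
proof (rule injI, clarify)
  fix m j m' j'
  let ?x = "s + of_nat m + of_nat j * \<tau>" and ?y = "s + of_nat m' + of_nat j' * \<tau>"
  assume "jack \<tau> \<gamma> \<delta> s m j = jack \<tau> \<gamma> \<delta> s m' j'"
  then have "(\<gamma> * (?x + ?y + of_nat 0 + of_nat 0 * \<tau>) + \<delta>) * (?x - ?y) = 0"
    unfolding jack_def by (simp add: algebra_simps power2_eq_square)
  then show "m = m' \<and> j = j'" by (rule jack_generic_nodes_inj[OF assms]) auto
qed

lemma jack_generic_shifts:
  assumes "jack_generic \<tau> \<gamma> \<delta> s"
  shows "jack_generic \<tau> \<gamma> (\<delta> + \<gamma>) s" "jack_generic \<tau> \<gamma> \<delta> (s + \<tau>)"
proof -
  have *: "\<gamma> * (2 * s + of_nat a + of_nat b * \<tau>) + \<delta> \<noteq> 0" for a b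
    using assms by (simp add: jack_generic_def)
  show "jack_generic \<tau> \<gamma> (\<delta> + \<gamma>) s"
    unfolding jack_generic_def
  proof (intro conjI allI)
    fix a b show "\<gamma> * (2 * s + of_nat a + of_nat b * \<tau>) + (\<delta> + \<gamma>) \<noteq> 0"
      using *[of "a + 1" b] by (simp add: algebra_simps)
  qed (use assms in \<open>simp add: jack_generic_def\<close>)
  show "jack_generic \<tau> \<gamma> \<delta> (s + \<tau>)"
    unfolding jack_generic_def
  proof (intro conjI allI)
    fix a b show "\<gamma> * (2 * (s + \<tau>) + of_nat a + of_nat b * \<tau>) + \<delta> \<noteq> 0"
      using *[of a "b + 2"] by (simp add: algebra_simps)
  qed (use assms in \<open>simp add: jack_generic_def\<close>)
qed

lemma lowering_jack:
  assumes g: "jack_generic \<tau> \<gamma> \<delta> s"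
  shows "lowering (jack \<tau> \<gamma> \<delta> s) (jack \<tau> \<gamma> (\<delta> + \<gamma>) s)"
proof -
  define S where "S m j = s + of_nat m + of_nat j * \<tau>" for m j :: nat
  \<comment> \<open>Half the difference of the values at \<open>Suc m\<close> and \<open>m\<close>.
    Half their sum is the grid with \<delta> + \<gamma> plus the constant (\<gamma> + \<delta>) / 2,
    which dictates the new grid, p1 and p0.\<close>
  let ?r = "\<lambda>m j. (\<gamma> * (2 * S m j + 1) + \<delta>) / 2"
  have S: "S (Suc m) j = S m j + 1" "S m (Suc j) = S m j + \<tau>" for m j by (simp_all add: S_def algebra_simps)
  have jack: "jack \<tau> \<gamma> \<delta>' s m j = \<gamma> * (S m j)\<^sup>2 + \<delta>' * S m j" for \<delta>' m j by (simp add: jack_def S_def)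
  have "inj (\<lambda>(m, j). 1 * jack \<tau> \<gamma> (\<delta> + \<gamma>) s m j + 0 + \<tau> * ?r m j)"
  proof (rule injI, clarify)
    fix m j m' j'
    assume eq: "1 * jack \<tau> \<gamma> (\<delta> + \<gamma>) s m j + 0 + \<tau> * ?r m j = 1 * jack \<tau> \<gamma> (\<delta> + \<gamma>) s m' j' + 0 + \<tau> * ?r m' j'"
    have "(\<gamma> * (S m j + S m' j' + of_nat 1 + of_nat 1 * \<tau>) + \<delta>) * (S m j - S m' j') =
      (1 * jack \<tau> \<gamma> (\<delta> + \<gamma>) s m j + 0 + \<tau> * ?r m j) - (1 * jack \<tau> \<gamma> (\<delta> + \<gamma>) s m' j' + 0 + \<tau> * ?r m' j')"
      unfolding jack by (simp add: field_simps power2_eq_square)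
    then have "(\<gamma> * (S m j + S m' j' + of_nat 1 + of_nat 1 * \<tau>) + \<delta>) * (S m j - S m' j') = 0"
      using eq by simp
    then show "m = m' \<and> j = j'" by (rule jack_generic_nodes_inj[OF g]) (simp_all add: S_def)
  qed
  moreover have "?r m j \<noteq> 0" for m j
  proof -
    have "\<gamma> * (2 * s + of_nat (2 * m + 1) + of_nat (2 * j) * \<tau>) + \<delta> \<noteq> 0"
      using g unfolding jack_generic_def by blast
    then show ?thesis by (simp add: S_def algebra_simps)
  qed
  \<comment> \<open>Moving S by \<tau> changes the new grid by \<tau> times the sum of the two
    values of \<open>?r\<close>; hence w1 = 1 and \<kappa> = \<tau>.\<close>
  ultimately show ?thesis
    by (intro loweringI[where r = ?r and ?p1.0 = 1 and ?p0.0 = "(\<gamma> + \<delta>) / 2" and ?w1.0 = 1 and ?w0.0 = 0 and \<kappa> = \<tau>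
          and ?\<rho>2.0 = 0 and ?\<rho>1.0 = \<gamma> and ?\<rho>0.0 = "((\<gamma> + \<delta>) / 2)\<^sup>2"] inj_jack jack_generic_shifts g)
      (simp_all add: jack S field_simps power2_eq_square)
qed

lemma lowerable_jacks: "lowerable (jacks \<tau> \<gamma>)"
  unfolding lowerable_def
proof
  fix c assume "c \<in> jacks \<tau> \<gamma>"
  then obtain \<delta> s where c: "c = jack \<tau> \<gamma> \<delta> s" and g: "jack_generic \<tau> \<gamma> \<delta> s" by (auto simp: jacks_def)
  have "(\<lambda>m j. c m (Suc j)) = jack \<tau> \<gamma> \<delta> (s + \<tau>)"
    by (intro ext) (simp add: c jack_def algebra_simps)
  then have "(\<lambda>m j. c m (Suc j)) \<in> jacks \<tau> \<gamma>" using jack_generic_shifts[OF g] by (auto simp: jacks_def)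
  moreover have "jack \<tau> \<gamma> (\<delta> + \<gamma>) s \<in> jacks \<tau> \<gamma>" using jack_generic_shifts[OF g] by (auto simp: jacks_def)
  ultimately show "(\<exists>c'\<in>jacks \<tau> \<gamma>. lowering c c') \<and> (\<lambda>m j. c m (Suc j)) \<in> jacks \<tau> \<gamma>"
    using lowering_jack[OF g] c by blast
qed

section \<open>The Macdonald grids\<close>

definition macd :: "'k::field_char_0 \<Rightarrow> 'k \<Rightarrow> 'k \<Rightarrow> 'k \<Rightarrow> nat \<Rightarrow> nat \<Rightarrow> 'k" where
  "macd q t \<beta> z m j = z * q ^ m * t ^ j + \<beta> / (z * q ^ m * t ^ j)"

text \<open>For x and y of the form z q^m t^j, the grid values differ by (x y - \<beta>)(x - y) / (x
  y). The last condition keeps x y - \<beta> nonzero, and persists when \<beta> is divided by q or z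
  multiplied by t.\<close>

definition macd_generic :: "'k::field_char_0 \<Rightarrow> 'k \<Rightarrow> 'k \<Rightarrow> 'k \<Rightarrow> bool" where
  "macd_generic q t \<beta> z \<longleftrightarrow> q \<noteq> 0 \<and> t \<noteq> 0 \<and> z \<noteq> 0 \<and> inj (\<lambda>(m, j). q ^ m * t ^ j) \<and>
    (\<forall>a b. \<beta> \<noteq> z\<^sup>2 * q ^ a * t ^ b)"

text \<open>The grid of \<open>AM\<close> has \<open>\<beta> = 0\<close>, that of \<open>BM\<close> has \<open>\<beta> = 1\<close>; lowering replaces \<open>\<beta>\<close> by \<open>\<beta> / q\<close>.\<close>

definition macds :: "'k::field_char_0 \<Rightarrow> 'k \<Rightarrow> (nat \<Rightarrow> nat \<Rightarrow> 'k) set" where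
  "macds q t = {macd q t \<beta> z | \<beta> z. macd_generic q t \<beta> z}"

lemma macd_generic_nodes_inj:
  assumes g: "macd_generic q t \<beta> z"
    and "(x * y * q ^ a * t ^ b - \<beta>) * (x - y) = 0"
    and "x = z * q ^ m * t ^ j" "y = z * q ^ m' * t ^ j'"
  shows "m = m' \<and> j = j'"
proof -
  have "x * y * q ^ a * t ^ b = z\<^sup>2 * q ^ (m + m' + a) * t ^ (j + j' + b)"
    using assms(3,4) by (simp add: power_add power2_eq_square)
  then have "x * y * q ^ a * t ^ b \<noteq> \<beta>" using g unfolding macd_generic_def by metis
  then have "x = y" using assms(2) by simp
  then have "q ^ m * t ^ j = q ^ m' * t ^ j'" using assms(3,4) g by (simp add: macd_generic_def mult.assoc)
  then show ?thesis using g unfolding macd_generic_def inj_def by auto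
qed

lemma inj_macd:
  assumes g: "macd_generic q t \<beta> z"
  shows "inj (\<lambda>(m, j). macd q t \<beta> z m j)"
proof (rule injI, clarify)
  fix m j m' j'
  let ?x = "z * q ^ m * t ^ j" and ?y = "z * q ^ m' * t ^ j'"
  have nz: "?x \<noteq> 0" "?y \<noteq> 0" using g by (simp_all add: macd_generic_def)
  assume "macd q t \<beta> z m j = macd q t \<beta> z m' j'"
  then have "?x + \<beta> / ?x = ?y + \<beta> / ?y" by (simp add: macd_def)
  then have "(?x + \<beta> / ?x) * ?x * ?y = (?y + \<beta> / ?y) * ?x * ?y" by simp
  moreover have "(x * y * q ^ 0 * t ^ 0 - \<beta>) * (x - y) = (x + \<beta> / x) * x * y - (y + \<beta> / y) * x * y"
    if "x \<noteq> 0" "y \<noteq> 0" for x y using that by (simp add: field_simps)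
  ultimately have "(?x * ?y * q ^ 0 * t ^ 0 - \<beta>) * (?x - ?y) = 0" using nz by (metis diff_self)
  then show "m = m' \<and> j = j'" by (rule macd_generic_nodes_inj[OF g]) auto
qed

lemma macd_generic_shifts:
  assumes g: "macd_generic q t \<beta> z"
  shows "macd_generic q t (\<beta> / q) z" "macd_generic q t \<beta> (z * t)"
proof -
  have *: "\<beta> \<noteq> z\<^sup>2 * q ^ a * t ^ b" for a b
    using g by (simp add: macd_generic_def)
  show "macd_generic q t (\<beta> / q) z"
    unfolding macd_generic_def
  proof (intro conjI allI)
    fix a b show "\<beta> / q \<noteq> z\<^sup>2 * q ^ a * t ^ b"
      using *[of "a + 1" b] g by (auto simp: field_simps macd_generic_def)
  qed (use g in \<open>simp_all add: macd_generic_def\<close>)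
  show "macd_generic q t \<beta> (z * t)"
    unfolding macd_generic_def
  proof (intro conjI allI)
    fix a b show "\<beta> \<noteq> (z * t)\<^sup>2 * q ^ a * t ^ b"
      using *[of a "b + 2"] by (simp add: power_add power2_eq_square mult_ac)
  qed (use g in \<open>simp_all add: macd_generic_def\<close>)
qed

lemma lowering_macd:
  assumes g: "macd_generic q t \<beta> z"
  shows "lowering (macd q t \<beta> z) (macd q t (\<beta> / q) z)"
proof -
  define S where "S m j = z * q ^ m * t ^ j" for m j :: nat
  \<comment> \<open>At x = \<open>S m j\<close>, half the difference of the values at q x and x.
    Half their sum is (q + 1) / 2 times x + \<beta> / (q x); hence the new parameter \<beta> / q, p1
    = (q + 1) / 2 and p0 = 0.\<close>
  let ?r = "\<lambda>m j. (q - 1) / 2 * (S m j - \<beta> / (q * S m j))"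
  have nz: "q \<noteq> 0" "t \<noteq> 0" "S m j \<noteq> 0" for m j using g by (simp_all add: macd_generic_def S_def)
  have q1: "q - 1 \<noteq> 0"
  proof
    assume "q - 1 = 0"
    then have "(\<lambda>(m, j). q ^ m * t ^ j) (1, 0) = (\<lambda>(m, j). q ^ m * t ^ j) (0, 0)" by simp
    then show False using g unfolding macd_generic_def by (metis Pair_inject injD one_neq_zero)
  qed
  have S: "S (Suc m) j = q * S m j" "S m (Suc j) = t * S m j" for m j by (simp_all add: S_def)
  have macd: "macd q t \<beta>' z m j = S m j + \<beta>' / S m j" for \<beta>' m j by (simp add: macd_def S_def)
  \<comment> \<open>w1 = (t + 1) / 2 and \<kappa> = (t - 1) / (q - 1) are chosen to give these two
    nodes: the second one, taken at t x, is the first one at x.\<close>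
  have node: "(t + 1) / 2 * (x + \<beta> / q / x) + 0 + (t - 1) / (q - 1) * ((q - 1) / 2 * (x - \<beta> / (q * x))) = t * x + \<beta> / (q * x)"
    "(t + 1) / 2 * (x + \<beta> / q / x) + 0 - (t - 1) / (q - 1) * ((q - 1) / 2 * (x - \<beta> / (q * x))) = x + t * \<beta> / (q * x)"
    if "x \<noteq> 0" for x using that nz q1 by (simp_all add: divide_simps) (simp_all add: algebra_simps)
  have upper: "inj (\<lambda>(m, j). (t + 1) / 2 * macd q t (\<beta> / q) z m j + 0 + (t - 1) / (q - 1) * ?r m j)"
  proof (rule injI, clarify)
    fix m j m' j'
    let ?x = "S m j" and ?y = "S m' j'"
    assume "(t + 1) / 2 * macd q t (\<beta> / q) z m j + 0 + (t - 1) / (q - 1) * ?r m j =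
      (t + 1) / 2 * macd q t (\<beta> / q) z m' j' + 0 + (t - 1) / (q - 1) * ?r m' j'"
    then have "t * ?x + \<beta> / (q * ?x) = t * ?y + \<beta> / (q * ?y)" unfolding macd node(1)[OF nz(3)] .
    then have "(t * ?x + \<beta> / (q * ?x)) * q * ?x * ?y = (t * ?y + \<beta> / (q * ?y)) * q * ?x * ?y" by simp
    moreover have "(x * y * q ^ 1 * t ^ 1 - \<beta>) * (x - y) =
        (t * x + \<beta> / (q * x)) * q * x * y - (t * y + \<beta> / (q * y)) * q * x * y"
      if "x \<noteq> 0" "y \<noteq> 0" for x y using that nz(1) by (simp add: field_simps)
    ultimately have "(?x * ?y * q ^ 1 * t ^ 1 - \<beta>) * (?x - ?y) = 0" using nz by (metis diff_self)
    then show "m = m' \<and> j = j'" by (rule macd_generic_nodes_inj[OF g]) (simp_all add: S_def)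
  qed
  have r0: "?r m j \<noteq> 0" for m j
  proof -
    have "\<beta> \<noteq> z\<^sup>2 * q ^ (2 * m + 1) * t ^ (2 * j)"
      using g unfolding macd_generic_def by blast
    then have "S m j * (q * S m j) \<noteq> \<beta>" by (simp add: S_def power2_eq_square power_mult power_mult_distrib mult_ac)
    then show ?thesis using q1 nz by (simp add: eq_divide_eq)
  qed
  have nodes: "macd q t \<beta> z (Suc m) j = (q + 1) / 2 * macd q t (\<beta> / q) z m j + 0 + ?r m j"
    "macd q t \<beta> z m j = (q + 1) / 2 * macd q t (\<beta> / q) z m j + 0 - ?r m j" for m j
  proof -
    have "q * x + \<beta> / (q * x) = (q + 1) / 2 * (x + \<beta> / q / x) + 0 + (q - 1) / 2 * (x - \<beta> / (q * x))"
      "x + \<beta> / x = (q + 1) / 2 * (x + \<beta> / q / x) + 0 - (q - 1) / 2 * (x - \<beta> / (q * x))"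
      if "x \<noteq> 0" for x using that nz by (simp_all add: divide_simps) (simp_all add: algebra_simps)
    then show "macd q t \<beta> z (Suc m) j = (q + 1) / 2 * macd q t (\<beta> / q) z m j + 0 + ?r m j"
      "macd q t \<beta> z m j = (q + 1) / 2 * macd q t (\<beta> / q) z m j + 0 - ?r m j"
      using nz(3)[of m j] by (simp_all only: macd S)
  qed
  \<comment> \<open>The square of x - \<beta> / (q x) is that of x + \<beta> / (q x) minus 4 \<beta>
    / q.\<close>
  have square: "(?r m j)\<^sup>2 = ((q - 1) / 2)\<^sup>2 * (macd q t (\<beta> / q) z m j)\<^sup>2 + 0 * macd q t (\<beta> / q) z m j +
      - ((q - 1)\<^sup>2 * \<beta> / q)" for m j
  proof -
    have "((q - 1) / 2 * (x - \<beta> / (q * x)))\<^sup>2 = ((q - 1) / 2)\<^sup>2 * (x + \<beta> / q / x)\<^sup>2 + 0 * (x + \<beta> / q / x) +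
      - ((q - 1)\<^sup>2 * \<beta> / q)" if "x \<noteq> 0" for x
      using that nz by (simp add: divide_simps power2_eq_square) (simp add: algebra_simps)
    then show ?thesis using nz(3)[of m j] by (simp only: macd)
  qed
  have meet: "(t + 1) / 2 * macd q t (\<beta> / q) z m (Suc j) + 0 - (t - 1) / (q - 1) * ?r m (Suc j) =
      (t + 1) / 2 * macd q t (\<beta> / q) z m j + 0 + (t - 1) / (q - 1) * ?r m j" for m j
  proof -
    have "S m (Suc j) \<noteq> 0" "S m j \<noteq> 0" by (rule nz)+
    then show ?thesis
      unfolding macd unfolding node(1)[OF \<open>S m j \<noteq> 0\<close>] node(2)[OF \<open>S m (Suc j) \<noteq> 0\<close>]
      unfolding S using nz by simp
  qed
  show ?thesis
    by (rule loweringI[where r = ?r, OF nodes r0 square inj_macd[OF macd_generic_shifts(1)[OF g]] upper meet])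
qed

lemma lowerable_macds: "lowerable (macds q t)"
  unfolding lowerable_def
proof
  fix c assume "c \<in> macds q t"
  then obtain \<beta> z where c: "c = macd q t \<beta> z" and g: "macd_generic q t \<beta> z" by (auto simp: macds_def)
  have "(\<lambda>m j. c m (Suc j)) = macd q t \<beta> (z * t)"
    by (intro ext) (simp add: c macd_def mult_ac)
  then have "(\<lambda>m j. c m (Suc j)) \<in> macds q t" using macd_generic_shifts[OF g] by (auto simp: macds_def)
  moreover have "macd q t (\<beta> / q) z \<in> macds q t" using macd_generic_shifts[OF g] by (auto simp: macds_def)
  ultimately show "(\<exists>c'\<in>macds q t. lowering c c') \<and> (\<lambda>m j. c m (Suc j)) \<in> macds q t"
    using lowering_macd[OF g] c by blast
qed

section \<open>The four families\<close>

lemma Fract_one_eq_iff: "Fraction_Field.Fract a 1 = Fraction_Field.Fract b 1 \<longleftrightarrow> a = b"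
  by (simp add: eq_fract)

lemma Fract_one_power: "Fraction_Field.Fract a 1 ^ k = Fraction_Field.Fract (a ^ k) 1"
  by (induction k) (simp_all add: One_fract_def)

lemma Fract_one_sum: "(\<Sum>i\<in>A. Fraction_Field.Fract (f i) 1) = Fraction_Field.Fract (\<Sum>i\<in>A. f i) 1"
  by (induction A rule: infinite_finite_induct) (simp_all add: Zero_fract_def)

lemma xpow_eq: "xpow i k = Poly_Mapping.single (Poly_Mapping.single i k) 1"
  by (simp add: xpow_def)

lemma AJ_interpolation_family:
  "interpolation_family AJ 1 0 n (jacks (Fraction_Field.Fract [:0, 1:] 1) 0) (jack (Fraction_Field.Fract [:0, 1:] 1) 0 1 0)"
proof -
  let ?\<tau> = "Fraction_Field.Fract [:0, 1:] 1 :: rat poly fract"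
  have lf: "laurent_family AJ 1 0"
    by unfold_locales (simp_all add: AJ_def xpow_eq fun_eq_iff)
  note val = laurent_family.val_def[OF lf]
  have "of_nat m + of_nat j * ?\<tau> = Fraction_Field.Fract [:of_nat m, of_nat j:] 1" for m j
    by (simp add: of_nat_fract of_nat_poly)
  then have "inj (\<lambda>(m, j). of_nat m + of_nat j * ?\<tau>)"
    by (auto simp: inj_def Fract_one_eq_iff)
  then have generic: "jack_generic ?\<tau> 0 1 0" by (simp add: jack_generic_def)
  \<comment> \<open>The part with \<tau> does not depend on l, so the norm determines the
    size.\<close>
  have z: "znorm AJ n l = of_nat (psize n l) + (\<Sum>i=1..n. of_nat (n - i) * ?\<tau>)" for l
    by (simp add: znorm_def AJ_def psize_def sum.distrib)
  show ?thesis
  proof (intro interpolation_family.intro lf interpolation_family_axioms.intro lowerable_jacks inj_jack generic)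
    show "jack ?\<tau> 0 1 0 \<in> jacks ?\<tau> 0" using generic by (auto simp: jacks_def)
    show "laurent_family.val 1 0 (shift AJ n l i) = jack ?\<tau> 0 1 0 (l i) (n - i)" for l i
      unfolding val by (simp add: AJ_def jack_def)
    show "nrm AJ n x = (\<Sum>i=1..n. laurent_family.val 1 0 (x i))" for x
      unfolding val by (simp add: AJ_def)
  qed (simp_all add: z)
qed

lemma BJ_interpolation_family:
  "interpolation_family BJ 2 0 n (jacks (Fraction_Field.Fract [:[:0, 1:]:] 1) 1)
    (jack (Fraction_Field.Fract [:[:0, 1:]:] 1) 1 0 (Fraction_Field.Fract [:0, 1:] 1))"
proof -
  let ?\<tau> = "Fraction_Field.Fract [:[:0, 1:]:] 1 :: rat poly poly fract"
  let ?\<alpha> = "Fraction_Field.Fract [:0, 1:] 1 :: rat poly poly fract"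
  have lf: "laurent_family BJ 2 0"
    by unfold_locales (simp_all add: BJ_def xpow_eq fun_eq_iff)
  note val = laurent_family.val_def[OF lf]
  have point: "of_nat m + of_nat j * ?\<tau> = Fraction_Field.Fract [:[:of_nat m, of_nat j:]:] 1" for m j
    by (simp add: of_nat_fract of_nat_poly)
  then have "inj (\<lambda>(m, j). of_nat m + of_nat j * ?\<tau>)"
    by (auto simp: inj_def Fract_one_eq_iff)
  have two: "2 = Fraction_Field.Fract [:[:2:]:] (1 :: rat poly poly)"
    using of_nat_fract[of 2, where 'a = "rat poly poly"] by (simp add: numeral_poly)
  have "2 * ?\<alpha> + of_nat a + of_nat b * ?\<tau> \<noteq> 0" for a b
  proof -
    have "2 * ?\<alpha> + (of_nat a + of_nat b * ?\<tau>) = Fraction_Field.Fract [:[:of_nat a, of_nat b:], 2:] 1"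
      unfolding point two by (simp add: numeral_poly)
    then show ?thesis by (simp add: Zero_fract_def Fract_one_eq_iff add.assoc)
  qed
  with \<open>inj _\<close> have generic: "jack_generic ?\<tau> 1 0 ?\<alpha>" by (simp add: jack_generic_def)
  have z: "znorm BJ n l = Fraction_Field.Fract (\<Sum>i=1..n. [:[:of_nat (l i), of_nat (n - i):], 1:]\<^sup>2) 1" for l
  proof -
    have "of_nat (l i) + of_nat (n - i) * ?\<tau> + ?\<alpha> = Fraction_Field.Fract [:[:of_nat (l i), of_nat (n - i):], 1:] 1" for i
      unfolding point by simp
    then show ?thesis by (simp add: znorm_def BJ_def Fract_one_power Fract_one_sum)
  qed
  have "psize n l = psize n m" if "znorm BJ n l = znorm BJ n m" for l m
  proof -
    \<comment> \<open>The size is read off from the terms linear in \<alpha>, where the squares of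
      the rows do not enter.\<close>
    have c: "coeff (coeff (\<Sum>i=1..n. [:[:of_nat (l i), of_nat (n - i):], 1:]\<^sup>2) 1) 0 = (2 * of_nat (psize n l) :: rat)" for l :: part
      by (simp add: coeff_sum power2_eq_square psize_def sum_distrib_left)
    from that have "(\<Sum>i=1..n. [:[:of_nat (l i), of_nat (n - i):], 1:]\<^sup>2) = (\<Sum>i=1..n. [:[:of_nat (m i), of_nat (n - i):], 1:]\<^sup>2 :: rat poly poly)"
      unfolding z Fract_one_eq_iff .
    then show ?thesis using c[of l] c[of m] by simp
  qed
  note separated = this
  show ?thesis
  proof (intro interpolation_family.intro lf interpolation_family_axioms.intro lowerable_jacks inj_jack generic)
    show "jack ?\<tau> 1 0 ?\<alpha> \<in> jacks ?\<tau> 1" using generic by (auto simp: jacks_def)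
    show "laurent_family.val 2 0 (shift BJ n l i) = jack ?\<tau> 1 0 ?\<alpha> (l i) (n - i)" for l i
      unfolding val by (simp add: BJ_def jack_def add_ac)
    show "nrm BJ n x = (\<Sum>i=1..n. laurent_family.val 2 0 (x i))" for x
      unfolding val by (simp add: BJ_def)
    show "znorm BJ n l \<noteq> znorm BJ n m" if "psize n m < psize n l" for l m
      using separated[of l m] that by auto
  qed simp
qed

text \<open>Different rows carry different powers of t in the norm, so its coefficients give q^(l_i)
  row by row. The offset K allows for the factor that clears the denominators in BM.\<close>

lemma coeff_sum_monom:
  fixes f :: "nat \<Rightarrow> nat"
  assumes "i \<in> {1..n}"
  shows "coeff (\<Sum>j=1..n. monom (monom (1::'a::comm_semiring_1) (f j)) (K + (n - j))) (K + (n - i)) = monom 1 (f i)"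
proof -
  have "coeff (\<Sum>j=1..n. monom (monom (1::'a) (f j)) (K + (n - j))) (K + (n - i)) =
      (\<Sum>j=1..n. if j = i then monom 1 (f j) else 0)"
    unfolding coeff_sum by (rule sum.cong[OF refl]) (use assms in auto)
  then show ?thesis using assms by simp
qed

lemma AM_interpolation_family:
  "interpolation_family AM 1 0 n (macds (Fraction_Field.Fract [:[:0, 1:]:] 1) (Fraction_Field.Fract [:0, 1:] 1))
    (macd (Fraction_Field.Fract [:[:0, 1:]:] 1) (Fraction_Field.Fract [:0, 1:] 1) 0 1)"
proof -
  let ?q = "Fraction_Field.Fract [:[:0, 1:]:] 1 :: rat poly poly fract"
  let ?t = "Fraction_Field.Fract [:0, 1:] 1 :: rat poly poly fract"
  have lf: "laurent_family AM 1 0"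
    by unfold_locales (simp_all add: AM_def xpow_eq fun_eq_iff)
  note val = laurent_family.val_def[OF lf]
  have gens: "[:[:0, 1:]:] = monom (monom 1 1) 0" "[:0, 1:] = monom (1 :: rat poly) 1"
    by (simp_all add: monom_0 monom_Suc)
  have point: "?q ^ m * ?t ^ j = Fraction_Field.Fract (monom (monom 1 m) j) 1" for m j
    unfolding gens by (simp add: Fract_one_power monom_power mult_monom)
  have nz: "?q \<noteq> 0" "?t \<noteq> 0" by (simp_all add: Zero_fract_def Fract_one_eq_iff)
  have "inj (\<lambda>(m, j). ?q ^ m * ?t ^ j)"
    unfolding point by (auto simp: inj_def Fract_one_eq_iff monom_eq_iff')
  then have generic: "macd_generic ?q ?t 0 1" using nz by (simp add: macd_generic_def)
  have z: "znorm AM n l = Fraction_Field.Fract (\<Sum>i=1..n. monom (monom 1 (l i)) (0 + (n - i))) 1" for l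
    by (simp add: znorm_def AM_def point Fract_one_sum)
  have "psize n l = psize n m" if "znorm AM n l = znorm AM n m" for l m
  proof -
    have "l i = m i" if "i \<in> {1..n}" for i
    proof -
      have "monom (1::rat) (l i) = monom 1 (m i)"
        using \<open>znorm AM n l = znorm AM n m\<close> coeff_sum_monom[OF that, of l 0, where 'a = rat]
          coeff_sum_monom[OF that, of m 0, where 'a = rat] unfolding z Fract_one_eq_iff by metis
      then show ?thesis by (simp add: monom_eq_iff')
    qed
    then show ?thesis unfolding psize_def by (intro sum.cong) auto
  qed
  note separated = this
  show ?thesis
  proof (intro interpolation_family.intro lf interpolation_family_axioms.intro lowerable_macds inj_macd generic)
    show "macd ?q ?t 0 1 \<in> macds ?q ?t" using generic by (auto simp: macds_def)
    show "laurent_family.val 1 0 (shift AM n l i) = macd ?q ?t 0 1 (l i) (n - i)" for l i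
      unfolding val by (simp add: AM_def macd_def)
    show "nrm AM n x = (\<Sum>i=1..n. laurent_family.val 1 0 (x i))" for x
      unfolding val by (simp add: AM_def)
    show "znorm AM n l \<noteq> znorm AM n m" if "psize n m < psize n l" for l m
      using separated[of l m] that by auto
  qed simp
qed

lemma BM_interpolation_family:
  "interpolation_family BM 1 1 n (macds (Fraction_Field.Fract [:[:[:0, 1:]:]:] 1) (Fraction_Field.Fract [:[:0, 1:]:] 1))
    (macd (Fraction_Field.Fract [:[:[:0, 1:]:]:] 1) (Fraction_Field.Fract [:[:0, 1:]:] 1) 1 (Fraction_Field.Fract [:0, 1:] 1))"
proof -
  let ?q = "Fraction_Field.Fract [:[:[:0, 1:]:]:] 1 :: rat poly poly poly fract"
  let ?t = "Fraction_Field.Fract [:[:0, 1:]:] 1 :: rat poly poly poly fract"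
  let ?a = "Fraction_Field.Fract [:0, 1:] 1 :: rat poly poly poly fract"
  have lf: "laurent_family BM 1 1"
    by unfold_locales (simp_all add: BM_def xpow_eq fun_eq_iff)
  note val = laurent_family.val_def[OF lf]
  have gens: "[:[:[:0, 1:]:]:] = monom (monom (monom 1 1) 0) 0" "[:[:0, 1:]:] = monom (monom (1 :: rat poly) 1) 0"
    "[:0, 1:] = monom (1 :: rat poly poly) 1"
    by (simp_all add: monom_0 monom_Suc)
  have point: "?a ^ k * ?q ^ m * ?t ^ j = Fraction_Field.Fract (monom (monom (monom 1 m) j) k) 1" for k m j
    unfolding gens by (simp add: Fract_one_power monom_power mult_monom)
  have inj: "?a ^ k * ?q ^ m * ?t ^ j = ?a ^ k' * ?q ^ m' * ?t ^ j' \<longleftrightarrow> k = k' \<and> m = m' \<and> j = j'" for k m j k' m' j'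
    unfolding point by (auto simp: Fract_one_eq_iff monom_eq_iff')
  have nz: "?q \<noteq> 0" "?t \<noteq> 0" "?a \<noteq> 0" by (simp_all add: Zero_fract_def Fract_one_eq_iff)
  have "1 \<noteq> ?a\<^sup>2 * ?q ^ a * ?t ^ b" for a b using inj[of 0 0 0 2 a b] by simp
  moreover have "inj (\<lambda>(m, j). ?q ^ m * ?t ^ j)" using inj[of 0 _ _ 0] by (auto simp: inj_def)
  ultimately have generic: "macd_generic ?q ?t 1 ?a" using nz by (simp add: macd_generic_def)
  let ?S = "\<lambda>K l. \<Sum>i=1..n. monom (monom (1::rat) (K + l i)) (K + (n - i))"
  let ?S' = "\<lambda>K l. \<Sum>i=1..n. monom (monom (1::rat) (K - l i)) (K - (n - i))"
  \<comment> \<open>The factor a q^K t^K clears the denominators of all inverses. The coordinates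
    then contribute to a^2 and their inverses to a^0, so the two kinds of terms can be told
    apart.\<close>
  have z: "(?a * ?q ^ K * ?t ^ K) * znorm BM n l = Fraction_Field.Fract (monom (?S K l) 2 + monom (?S' K l) 0) 1"
    if K: "\<And>i. i \<in> {1..n} \<Longrightarrow> l i \<le> K" "n \<le> K" for K l
  proof -
    have "(?a * ?q ^ K * ?t ^ K) * znorm BM n l = (\<Sum>i=1..n. (?a * ?q ^ K * ?t ^ K) *
        (?a * ?q ^ l i * ?t ^ (n - i) + inverse (?a * ?q ^ l i * ?t ^ (n - i))))"
      by (simp add: znorm_def BM_def sum_distrib_left)
    also have "\<dots> = (\<Sum>i=1..n. ?a ^ 2 * ?q ^ (K + l i) * ?t ^ (K + (n - i)) + ?a ^ 0 * ?q ^ (K - l i) * ?t ^ (K - (n - i)))"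
    proof (rule sum.cong[OF refl])
      fix i assume "i \<in> {1..n}"
      then have "l i \<le> K" "n - i \<le> K" using K by auto
      then have K: "?q ^ K = ?q ^ (K - l i) * ?q ^ l i" "?t ^ K = ?t ^ (K - (n - i)) * ?t ^ (n - i)"
        by (simp_all add: power_add[symmetric])
      have clear: "(a * (Q * q) * (T * t)) * (a * q * t + inverse (a * q * t)) = a ^ 2 * ((Q * q) * q) * ((T * t) * t) + a ^ 0 * Q * T"
        if "a \<noteq> 0" "q \<noteq> 0" "t \<noteq> 0" for a q t Q T :: "rat poly poly poly fract"
        using that by (simp add: field_simps power2_eq_square)
      show "(?a * ?q ^ K * ?t ^ K) * (?a * ?q ^ l i * ?t ^ (n - i) + inverse (?a * ?q ^ l i * ?t ^ (n - i))) =
          ?a ^ 2 * ?q ^ (K + l i) * ?t ^ (K + (n - i)) + ?a ^ 0 * ?q ^ (K - l i) * ?t ^ (K - (n - i))"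
        unfolding power_add K by (rule clear) (use nz in simp_all)
    qed
    also have "\<dots> = Fraction_Field.Fract (monom (?S K l) 2 + monom (?S' K l) 0) 1"
      by (simp only: point sum.distrib Fract_one_sum) (simp add: monom_sum)
    finally show ?thesis .
  qed
  have "psize n l = psize n m" if eq: "znorm BM n l = znorm BM n m" for l m
  proof -
    let ?K = "n + (\<Sum>i=1..n. l i) + (\<Sum>i=1..n. m i)"
    have le: "f i \<le> (\<Sum>i=1..n. f i)" if "i \<in> {1..n}" for f :: part and i
      by (rule member_le_sum) (use that in auto)
    have K: "\<And>i. i \<in> {1..n} \<Longrightarrow> l i \<le> ?K" "\<And>i. i \<in> {1..n} \<Longrightarrow> m i \<le> ?K" "n \<le> ?K"
      using le[of _ l] le[of _ m] by (auto simp: trans_le_add1 trans_le_add2)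
    have "monom (?S ?K l) 2 + monom (?S' ?K l) 0 = monom (?S ?K m) 2 + monom (?S' ?K m) 0"
    proof (rule Fract_one_eq_iff[THEN iffD1])
      show "Fraction_Field.Fract (monom (?S ?K l) 2 + monom (?S' ?K l) 0) 1 =
          Fraction_Field.Fract (monom (?S ?K m) 2 + monom (?S' ?K m) 0) 1"
        using z[of l ?K, OF K(1,3)] z[of m ?K, OF K(2,3)] unfolding eq by (rule trans[OF sym])
    qed
    then have "coeff (monom (?S ?K l) 2 + monom (?S' ?K l) 0) 2 = coeff (monom (?S ?K m) 2 + monom (?S' ?K m) 0) 2"
      by (rule arg_cong)
    then have S: "?S ?K l = ?S ?K m" by simp
    have "l i = m i" if "i \<in> {1..n}" for i
    proof -
      have "monom (1::rat) (?K + l i) = monom 1 (?K + m i)"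
        using S coeff_sum_monom[OF that, of "\<lambda>i. ?K + l i" ?K, where 'a = rat]
          coeff_sum_monom[OF that, of "\<lambda>i. ?K + m i" ?K, where 'a = rat] by metis
      then show ?thesis by (simp add: monom_eq_iff')
    qed
    then show ?thesis unfolding psize_def by (intro sum.cong) auto
  qed
  note separated = this
  show ?thesis
  proof (intro interpolation_family.intro lf interpolation_family_axioms.intro lowerable_macds inj_macd generic)
    show "macd ?q ?t 1 ?a \<in> macds ?q ?t" using generic by (auto simp: macds_def)
    show "laurent_family.val 1 1 (shift BM n l i) = macd ?q ?t 1 ?a (l i) (n - i)" for l i
      unfolding val by (simp add: BM_def macd_def divide_inverse del: inverse_fract)
    show "nrm BM n x = (\<Sum>i=1..n. laurent_family.val 1 1 (x i))" for x
      unfolding val by (simp add: BM_def)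
    show "shift BM n l i \<noteq> 0" for l i
      using nz by (simp add: BM_def)
    show "znorm BM n l \<noteq> znorm BM n m" if "psize n m < psize n l" for l m
      using separated[of l m] that by auto
  qed
qed

theorem theorem3p2:
  fixes n :: nat
  assumes "n \<ge> 1"
  shows "
   ((\<forall>b. vanishing n b \<and> binom_recursion AJ n b \<longleftrightarrow> mtx_eq n b (binom AJ n)) \<and>
    (\<forall>b. vanishing n b \<and> inv_binom_recursion AJ n b \<longleftrightarrow> mtx_eq n b (inv_binom AJ n)) \<and>
    mtx_eq n (mtx_comm n (zmtx AJ n) (binom AJ n))
             (mtx_mult n (binom AJ n) (mtx_comm n (zmtx AJ n) (adj AJ n))) \<and>
    mtx_eq n (mtx_comm n (zmtx AJ n) (inv_binom AJ n))
             (\<lambda>l m. - mtx_mult n (mtx_comm n (zmtx AJ n) (adj AJ n)) (inv_binom AJ n) l m)) \<and>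

   ((\<forall>b. vanishing n b \<and> binom_recursion BJ n b \<longleftrightarrow> mtx_eq n b (binom BJ n)) \<and>
    (\<forall>b. vanishing n b \<and> inv_binom_recursion BJ n b \<longleftrightarrow> mtx_eq n b (inv_binom BJ n)) \<and>
    mtx_eq n (mtx_comm n (zmtx BJ n) (binom BJ n))
             (mtx_mult n (binom BJ n) (mtx_comm n (zmtx BJ n) (adj BJ n))) \<and>
    mtx_eq n (mtx_comm n (zmtx BJ n) (inv_binom BJ n))
             (\<lambda>l m. - mtx_mult n (mtx_comm n (zmtx BJ n) (adj BJ n)) (inv_binom BJ n) l m)) \<and>

   ((\<forall>b. vanishing n b \<and> binom_recursion AM n b \<longleftrightarrow> mtx_eq n b (binom AM n)) \<and>
    (\<forall>b. vanishing n b \<and> inv_binom_recursion AM n b \<longleftrightarrow> mtx_eq n b (inv_binom AM n)) \<and>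
    mtx_eq n (mtx_comm n (zmtx AM n) (binom AM n))
             (mtx_mult n (binom AM n) (mtx_comm n (zmtx AM n) (adj AM n))) \<and>
    mtx_eq n (mtx_comm n (zmtx AM n) (inv_binom AM n))
             (\<lambda>l m. - mtx_mult n (mtx_comm n (zmtx AM n) (adj AM n)) (inv_binom AM n) l m)) \<and>

   ((\<forall>b. vanishing n b \<and> binom_recursion BM n b \<longleftrightarrow> mtx_eq n b (binom BM n)) \<and>
    (\<forall>b. vanishing n b \<and> inv_binom_recursion BM n b \<longleftrightarrow> mtx_eq n b (inv_binom BM n)) \<and>
    mtx_eq n (mtx_comm n (zmtx BM n) (binom BM n))
             (mtx_mult n (binom BM n) (mtx_comm n (zmtx BM n) (adj BM n))) \<and>
    mtx_eq n (mtx_comm n (zmtx BM n) (inv_binom BM n))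
             (\<lambda>l m. - mtx_mult n (mtx_comm n (zmtx BM n) (adj BM n)) (inv_binom BM n) l m))"
  by (rule conjI, rule interpolation_family.recursions[OF AJ_interpolation_family],
      rule conjI, rule interpolation_family.recursions[OF BJ_interpolation_family],
      rule conjI, rule interpolation_family.recursions[OF AM_interpolation_family],
      rule interpolation_family.recursions[OF BM_interpolation_family])

end
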